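(* Let $X$ be a smooth projective variety over $\mathbb{C}$, $A$ an ample line bundle on $X$, and $L$ a pseudo-effective line bundle on $X$. Let $h_L=e^{-\varphi_L}$ be a smooth Hermitian metric of $L$ and let $h_A=e^{-\varphi_A}$ be a smooth Hermitian metric of $A$ satisfying $dd^c\varphi_A>0$. Use local coordinates $(z,x)\mapsto[z s_A^*(x)+s_L^*(x)]\in\mathbb{P}(A\oplus L)$, where $s_A^*$ and $s_L^*$ are local trivializations of $A^{-1}$ and $L^{-1}$, respectively. Then the metric of the relative hyperplane line bundle $\mathcal{O}_{\mathbb{P}(A\oplus L)}(1)$ on $\mathbb{P}(A\oplus L)$ defined by the local weights $$\tilde\varphi(z,x)=\log\max_{t\in[0,1]}|z|^{2t}e^{(t\varphi_A+(1-t)\varphi_L)_e(x)}$$ is a minimal singular metric.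
   Context: $dd^c=\frac{\sqrt{-1}}{2\pi}\partial\overline\partial$. $\mathbb{P}(E)$ denotes the bundle of lines in the fibers of $E^{*}$ (rank-one quotients of $E$), and $\mathcal{O}_{\mathbb{P}(E)}(1)$ is dual to the tautological line subbundle of the pull-back of $E^*$; local weights of metrics of $\mathcal{O}_{\mathbb{P}(A\oplus L)}(1)$ in the coordinates $(z,x)$ are taken with respect to the frame dual to the local frame $z s_A^*+s_L^*$ of the tautological bundle, and local weights of metrics of $A$, $L$ with respect to the frames dual to $s_A^*$, $s_L^*$. Convention: $|z|^{0}=1$, including at $z=0$. For a smooth (real) weight $\varphi$, a function $\psi\colon X\to\mathbb{R}\cup\{-\infty\}$ is $\varphi$-psh if $\varphi+\psi$ is plurisubharmonic (psh) locally. Equilibrium metric: for $t\in[0,1]$, regard $t\varphi_A+(1-t)\varphi_L$ as the local weight of the smooth metric $h_A^t h_L^{1-t}$ of the $\mathbb{R}$-line bundle $A^{\otimes t}\otimes L^{\otimes(1-t)}$; then $$(t\varphi_A+(1-t)\varphi_L)_e=t\varphi_A+(1-t)\varphi_L+\sup{}^*\{\psi\colon X\to\mathbb{R}\cup\{-\infty\}\mid\psi\text{ is }(t\varphi_A+(1-t)\varphi_L)\text{-psh},\ \psi\le0\},$$ where $\sup{}^*$ is the upper semi-continuous regularization of the supremum. A line bundle is pseudo-effective if it admits a singular Hermitian metric with psh local weights. A minimal singular metric of a pseudo-effective line bundle $M$ on a compact complex manifold is a singular Hermitian metric $e^{-\varphi_{\min}}$ of $M$ with psh local weights such that for every singular Hermitian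 metric $e^{-\varphi}$ of $M$ with psh local weights there is a constant $C$ with $\varphi\le\varphi_{\min}+C$ globally. *)

theory Defs
  imports "HOL-Analysis.Analysis"
begin

section \<open>Functions on open subsets of complex n-space\<close>

text \<open>
  Points of complex n-space are sequences that vanish from index n on.  The dimension is thus a
  natural number, so that n = 0 is allowed and a manifold of dimension n + 1 (the projective bundle)
  can be treated together with one of dimension n.
\<close>

definition Cn :: "nat \<Rightarrow> (nat \<Rightarrow> complex) set" where
  "Cn n = {v. \<forall>m\<ge>n. v m = 0}"

abbreviation Cn_open :: "nat \<Rightarrow> (nat \<Rightarrow> complex) set \<Rightarrow> bool" where
  "Cn_open n S \<equiv> openin (top_of_set (Cn n)) S"

definition along :: "(nat \<Rightarrow> complex) \<Rightarrow> (nat \<Rightarrow> complex) \<Rightarrow> complex \<Rightarrow> nat \<Rightarrow> complex" where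
  "along a b \<zeta> = (\<lambda>m. a m + \<zeta> * b m)"

definition holo_on :: "nat \<Rightarrow> (nat \<Rightarrow> complex) set \<Rightarrow> ((nat \<Rightarrow> complex) \<Rightarrow> complex) \<Rightarrow> bool" where
  "holo_on n S f \<longleftrightarrow> continuous_on S f \<and>
     (\<forall>a\<in>S. \<forall>m<n. (\<lambda>\<zeta>. f (a(m := \<zeta>))) field_differentiable (at (a m)))"

text \<open>
  Real partial derivatives in the direction of e times the m-th unit vector: e = 1 gives the
  derivative by the real part and e = \<open>\<i>\<close> the derivative by the imaginary part of the m-th coordinate.
\<close>

definition line_fun ::
    "nat \<Rightarrow> complex \<Rightarrow> ((nat \<Rightarrow> complex) \<Rightarrow> complex) \<Rightarrow> (nat \<Rightarrow> complex) \<Rightarrow> real \<Rightarrow> complex" where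
  "line_fun m e f a = (\<lambda>t. f (a(m := a m + of_real t * e)))"

definition pd ::
    "nat \<Rightarrow> complex \<Rightarrow> ((nat \<Rightarrow> complex) \<Rightarrow> complex) \<Rightarrow> (nat \<Rightarrow> complex) \<Rightarrow> complex" where
  "pd m e f a = vector_derivative (line_fun m e f a) (at 0)"

primrec Ck_on ::
    "nat \<Rightarrow> (nat \<Rightarrow> complex) set \<Rightarrow> nat \<Rightarrow> ((nat \<Rightarrow> complex) \<Rightarrow> complex) \<Rightarrow> bool" where
  "Ck_on n S 0 = (\<lambda>f. continuous_on S f)"
| "Ck_on n S (Suc k) = (\<lambda>f. continuous_on S f \<and>
     (\<forall>m<n. \<forall>e\<in>{1, \<i>}. (\<forall>a\<in>S. line_fun m e f a differentiable (at 0)) \<and> Ck_on n S k (pd m e f)))"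

definition smooth_on :: "nat \<Rightarrow> (nat \<Rightarrow> complex) set \<Rightarrow> ((nat \<Rightarrow> complex) \<Rightarrow> complex) \<Rightarrow> bool" where
  "smooth_on n S f \<longleftrightarrow> (\<forall>k. Ck_on n S k f)"

definition wirtinger ::
    "nat \<Rightarrow> ((nat \<Rightarrow> complex) \<Rightarrow> complex) \<Rightarrow> (nat \<Rightarrow> complex) \<Rightarrow> complex" where
  "wirtinger m f a = (pd m 1 f a - \<i> * pd m \<i> f a) / 2"

definition wirtinger_bar ::
    "nat \<Rightarrow> ((nat \<Rightarrow> complex) \<Rightarrow> complex) \<Rightarrow> (nat \<Rightarrow> complex) \<Rightarrow> complex" where
  "wirtinger_bar m f a = (pd m 1 f a + \<i> * pd m \<i> f a) / 2"

text \<open>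
  In coordinates, \<open>dd\<^sup>c f\<close> is \<open>\<i> / (2 * pi)\<close> times the sum over j, k of
  \<open>wirtinger j (wirtinger_bar k f) dz\<^sub>j \<and> dz\<^sub>k\<close>-bar.  Such a form is positive iff
  its Hermitian coefficient matrix is positive definite.  For smooth real f the sum below is real.
\<close>

definition ddc_coeff ::
    "((nat \<Rightarrow> complex) \<Rightarrow> complex) \<Rightarrow> (nat \<Rightarrow> complex) \<Rightarrow> nat \<Rightarrow> nat \<Rightarrow> complex" where
  "ddc_coeff f a j k = of_real (1 / (2 * pi)) * wirtinger j (wirtinger_bar k f) a"

definition ddc_pos_on :: "nat \<Rightarrow> (nat \<Rightarrow> complex) set \<Rightarrow> ((nat \<Rightarrow> complex) \<Rightarrow> complex) \<Rightarrow> bool" where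
  "ddc_pos_on n S f \<longleftrightarrow> (\<forall>a\<in>S. \<forall>v\<in>Cn n. v \<noteq> (\<lambda>_. 0) \<longrightarrow>
     0 < Re (\<Sum>j<n. \<Sum>k<n. ddc_coeff f a j k * v j * cnj (v k)))"

text \<open>
  The Lebesgue integral of u over the circle of points \<open>a + cis \<theta> * b\<close>, as the difference of the
  integrals of the positive and the negative part (\<open>e2ennreal\<close> sends negative numbers to 0).
  If u is upper semicontinuous with values below \<open>\<infinity>\<close>, then the first integral is finite.
\<close>

definition circle_integral ::
    "((nat \<Rightarrow> complex) \<Rightarrow> ereal) \<Rightarrow> (nat \<Rightarrow> complex) \<Rightarrow> (nat \<Rightarrow> complex) \<Rightarrow> ereal" where
  "circle_integral u a b =
     enn2ereal (\<integral>\<^sup>+\<theta>\<in>{0..2*pi}. e2ennreal (u (along a b (cis \<theta>))) \<partial>lborel) -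
     enn2ereal (\<integral>\<^sup>+\<theta>\<in>{0..2*pi}. e2ennreal (- u (along a b (cis \<theta>))) \<partial>lborel)"

text \<open>The function that is constantly \<open>-\<infinity>\<close> counts as plurisubharmonic here.\<close>

definition psh_on :: "nat \<Rightarrow> (nat \<Rightarrow> complex) set \<Rightarrow> ((nat \<Rightarrow> complex) \<Rightarrow> ereal) \<Rightarrow> bool" where
  "psh_on n S u \<longleftrightarrow>
     (\<forall>a\<in>S. u a \<noteq> \<infinity>) \<and>
     (\<forall>c. openin (top_of_set S) {a\<in>S. u a < c}) \<and>
     (\<forall>a\<in>S. \<forall>b\<in>Cn n. (\<forall>\<zeta>. cmod \<zeta> \<le> 1 \<longrightarrow> along a b \<zeta> \<in> S) \<longrightarrow>
        ereal (2 * pi) * u a \<le> circle_integral u a b)"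


section \<open>Complex manifolds\<close>

text \<open>
  An atlas is a set of local parametrizations (S, p), that is, inverses of charts: p maps the open
  set S in complex n-space to the manifold.  The manifold carries the final topology.
\<close>

type_synonym 'x atlas = "((nat \<Rightarrow> complex) set \<times> ((nat \<Rightarrow> complex) \<Rightarrow> 'x)) set"

definition mcarrier :: "'x atlas \<Rightarrow> 'x set" where
  "mcarrier X = (\<Union>(S, p)\<in>X. p ` S)"

definition mopen :: "'x atlas \<Rightarrow> 'x set \<Rightarrow> bool" where
  "mopen X W \<longleftrightarrow> W \<subseteq> mcarrier X \<and> (\<forall>(S, p)\<in>X. openin (top_of_set S) {s\<in>S. p s \<in> W})"

definition mtop :: "'x atlas \<Rightarrow> 'x topology" where
  "mtop X = topology (mopen X)"

lemma istopology_mopen: "istopology (mopen X)"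
  unfolding istopology_def
proof (intro conjI allI impI)
  fix W V assume W: "mopen X W" and V: "mopen X V"
  have "openin (top_of_set S) {s\<in>S. p s \<in> W \<inter> V}" if "(S, p) \<in> X" for S p
  proof -
    have "{s\<in>S. p s \<in> W \<inter> V} = {s\<in>S. p s \<in> W} \<inter> {s\<in>S. p s \<in> V}" by blast
    moreover have "openin (top_of_set S) {s\<in>S. p s \<in> W}" "openin (top_of_set S) {s\<in>S. p s \<in> V}"
      using W V that unfolding mopen_def by blast+
    ultimately show ?thesis by (simp add: openin_Int)
  qed
  then show "mopen X (W \<inter> V)" using W by (auto simp: mopen_def)
next
  fix \<K> assume K: "\<forall>W\<in>\<K>. mopen X W"
  have "openin (top_of_set S) {s\<in>S. p s \<in> \<Union>\<K>}" if "(S, p) \<in> X" for S p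
  proof -
    have "{s\<in>S. p s \<in> \<Union>\<K>} = (\<Union>W\<in>\<K>. {s\<in>S. p s \<in> W})" by blast
    moreover have "openin (top_of_set S) {s\<in>S. p s \<in> W}" if "W \<in> \<K>" for W
      using K that \<open>(S, p) \<in> X\<close> unfolding mopen_def by blast
    then have "openin (top_of_set S) (\<Union>W\<in>\<K>. {s\<in>S. p s \<in> W})" by blast
    ultimately show ?thesis by simp
  qed
  then show "mopen X (\<Union>\<K>)" using K by (auto simp: mopen_def)
qed

lemma openin_mtop: "openin (mtop X) = mopen X"
  by (simp add: mtop_def istopology_mopen topology_inverse')

lemma topspace_mtop: "topspace (mtop X) = mcarrier X"
proof
  show "topspace (mtop X) \<subseteq> mcarrier X"
    by (auto simp: topspace_def openin_mtop mopen_def)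
  have "{s\<in>S. p s \<in> mcarrier X} = S" if "(S, p) \<in> X" for S p
    using that by (auto simp: mcarrier_def)
  then have "mopen X (mcarrier X)" by (auto simp: mopen_def)
  then show "mcarrier X \<subseteq> topspace (mtop X)"
    by (auto simp: topspace_def openin_mtop)
qed

definition complex_manifold :: "nat \<Rightarrow> 'x atlas \<Rightarrow> bool" where
  "complex_manifold n X \<longleftrightarrow>
     (\<forall>(S, p)\<in>X. Cn_open n S \<and> inj_on p S) \<and>
     (\<forall>(S, p)\<in>X. \<forall>(S', q)\<in>X. Cn_open n {s\<in>S. p s \<in> q ` S'} \<and>
        (\<forall>m<n. holo_on n {s\<in>S. p s \<in> q ` S'} (\<lambda>s. the_inv_into S' q (p s) m))) \<and>
     Hausdorff_space (mtop X) \<and> second_countable (mtop X)"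

definition mholo_on :: "nat \<Rightarrow> 'x atlas \<Rightarrow> 'x set \<Rightarrow> ('x \<Rightarrow> complex) \<Rightarrow> bool" where
  "mholo_on n X W f \<longleftrightarrow> (\<forall>(S, p)\<in>X. holo_on n {s\<in>S. p s \<in> W} (f \<circ> p))"

definition msmooth_on :: "nat \<Rightarrow> 'x atlas \<Rightarrow> 'x set \<Rightarrow> ('x \<Rightarrow> real) \<Rightarrow> bool" where
  "msmooth_on n X W f \<longleftrightarrow> (\<forall>(S, p)\<in>X. smooth_on n {s\<in>S. p s \<in> W} (\<lambda>s. of_real (f (p s))))"

definition mddc_pos_on :: "nat \<Rightarrow> 'x atlas \<Rightarrow> 'x set \<Rightarrow> ('x \<Rightarrow> real) \<Rightarrow> bool" where
  "mddc_pos_on n X W f \<longleftrightarrow> (\<forall>(S, p)\<in>X. ddc_pos_on n {s\<in>S. p s \<in> W} (\<lambda>s. of_real (f (p s))))"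

definition mpsh_on :: "nat \<Rightarrow> 'x atlas \<Rightarrow> 'x set \<Rightarrow> ('x \<Rightarrow> ereal) \<Rightarrow> bool" where
  "mpsh_on n X W u \<longleftrightarrow> (\<forall>(S, p)\<in>X. psh_on n {s\<in>S. p s \<in> W} (u \<circ> p))"

definition holomorphic_embedding ::
    "nat \<Rightarrow> 'x atlas \<Rightarrow> nat \<Rightarrow> 'y atlas \<Rightarrow> ('x \<Rightarrow> 'y) \<Rightarrow> bool" where
  "holomorphic_embedding n X m Y F \<longleftrightarrow>
     embedding_map (mtop X) (mtop Y) F \<and>
     (\<forall>(S, p)\<in>X. \<forall>(S', q)\<in>Y. let R = {s\<in>S. F (p s) \<in> q ` S'}; G = (\<lambda>s. the_inv_into S' q (F (p s))) in
        (\<forall>j<m. holo_on n R (\<lambda>s. G s j)) \<and>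
        (\<forall>s\<in>R. \<forall>v\<in>Cn n. v \<noteq> (\<lambda>_. 0) \<longrightarrow> (\<exists>j<m. deriv (\<lambda>\<zeta>. G (along s v \<zeta>) j) 0 \<noteq> 0)))"


section \<open>Projective space and projective varieties\<close>

definition cline :: "('k \<Rightarrow> complex) \<Rightarrow> ('k \<Rightarrow> complex) set" where
  "cline v = range (\<lambda>c k. c * v k)"

definition CP :: "nat \<Rightarrow> (nat \<Rightarrow> complex) set set" where
  "CP N = {cline v |v. v \<in> Cn (Suc N) \<and> v \<noteq> (\<lambda>_. 0)}"

text \<open>The m-th affine chart inserts the homogeneous coordinate 1 at position m.\<close>

definition CP_param :: "nat \<Rightarrow> (nat \<Rightarrow> complex) \<Rightarrow> (nat \<Rightarrow> complex) set" where
  "CP_param m w = cline (\<lambda>l. if l < m then w l else if l = m then 1 else w (l - 1))"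

definition CP_atlas :: "nat \<Rightarrow> (nat \<Rightarrow> complex) set atlas" where
  "CP_atlas N = {(Cn N, CP_param m) |m. m \<le> N}"

definition homogeneous_poly :: "nat \<Rightarrow> ((nat \<Rightarrow> complex) \<Rightarrow> complex) \<Rightarrow> bool" where
  "homogeneous_poly N f \<longleftrightarrow> (\<exists>d c. \<forall>v. f v =
     (\<Sum>\<alpha> | (\<forall>m>N. \<alpha> m = 0) \<and> (\<Sum>m\<le>N. \<alpha> m) = d. c \<alpha> * (\<Prod>m\<le>N. v m ^ \<alpha> m)))"

definition algebraic_subset :: "nat \<Rightarrow> (nat \<Rightarrow> complex) set set \<Rightarrow> bool" where
  "algebraic_subset N Z \<longleftrightarrow> (\<exists>\<P>. (\<forall>f\<in>\<P>. homogeneous_poly N f) \<and>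
     Z = {l \<in> CP N. \<forall>f\<in>\<P>. \<forall>v\<in>l. f v = 0})"

definition projective_variety :: "nat \<Rightarrow> (nat \<Rightarrow> complex) set set \<Rightarrow> bool" where
  "projective_variety N Z \<longleftrightarrow> algebraic_subset N Z \<and> Z \<noteq> {} \<and>
     (\<forall>Z1 Z2. algebraic_subset N Z1 \<longrightarrow> algebraic_subset N Z2 \<longrightarrow> Z = Z1 \<union> Z2 \<longrightarrow> Z = Z1 \<or> Z = Z2)"

text \<open>
  A smooth projective variety, seen as a complex manifold.  A projective variety Z is smooth iff it is
  a complex submanifold of projective space, and then a holomorphic embedding with image Z is a
  biholomorphic map onto Z.  Compactness follows from the existence of F.
\<close>

definition smooth_projective_variety :: "nat \<Rightarrow> 'x atlas \<Rightarrow> bool" where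
  "smooth_projective_variety n X \<longleftrightarrow> complex_manifold n X \<and> compact_space (mtop X) \<and>
     (\<exists>N F. holomorphic_embedding n X N (CP_atlas N) F \<and> projective_variety N (F ` mcarrier X))"


section \<open>Holomorphic line bundles\<close>

text \<open>
  A line bundle is given by an open cover (indexed by a type; members may be empty), a local frame
  \<open>e\<^sub>i\<close> on each \<open>triv B i\<close>, and the transition functions \<open>e\<^sub>j = transition B i j * e\<^sub>i\<close>.
  Accordingly, the coordinates of a section satisfy \<open>s\<^sub>i = transition B i j * s\<^sub>j\<close>.
\<close>

record ('x, 'i) line_bundle =
  triv :: "'i \<Rightarrow> 'x set"
  transition :: "'i \<Rightarrow> 'i \<Rightarrow> 'x \<Rightarrow> complex"

definition is_line_bundle :: "nat \<Rightarrow> 'x atlas \<Rightarrow> ('x, 'i) line_bundle \<Rightarrow> bool" where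
  "is_line_bundle n X B \<longleftrightarrow>
     (\<forall>i. openin (mtop X) (triv B i)) \<and> (\<Union>i. triv B i) = mcarrier X \<and>
     (\<forall>i j. mholo_on n X (triv B i \<inter> triv B j) (transition B i j)) \<and>
     (\<forall>i j. \<forall>x\<in>triv B i \<inter> triv B j. transition B i j x \<noteq> 0) \<and>
     (\<forall>i. \<forall>x\<in>triv B i. transition B i i x = 1) \<and>
     (\<forall>i j k. \<forall>x\<in>triv B i \<inter> triv B j \<inter> triv B k. transition B i j x * transition B j k x = transition B i k x)"

definition dual_bundle :: "('x, 'i) line_bundle \<Rightarrow> ('x, 'i) line_bundle" where
  "dual_bundle B = B\<lparr>transition := \<lambda>i j x. inverse (transition B i j x)\<rparr>"

definition tensor_power :: "('x, 'i) line_bundle \<Rightarrow> nat \<Rightarrow> ('x, 'i) line_bundle" where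
  "tensor_power B k = B\<lparr>transition := \<lambda>i j x. transition B i j x ^ k\<rparr>"

text \<open>
  The fiber at x: a vector is given by its coordinates with respect to all the frames defined at x.
\<close>

definition fiber :: "('x, 'i) line_bundle \<Rightarrow> 'x \<Rightarrow> ('i \<Rightarrow> complex) set" where
  "fiber B x = {v. (\<forall>i. x \<notin> triv B i \<longrightarrow> v i = 0) \<and>
     (\<forall>i j. x \<in> triv B i \<inter> triv B j \<longrightarrow> v i = transition B i j x * v j)}"

definition frame :: "('x, 'i) line_bundle \<Rightarrow> 'i \<Rightarrow> 'x \<Rightarrow> ('i \<Rightarrow> complex)" where
  "frame B i x = (\<lambda>k. if x \<in> triv B k then transition B k i x else 0)"

definition holomorphic_section ::
    "nat \<Rightarrow> 'x atlas \<Rightarrow> ('x, 'i) line_bundle \<Rightarrow> ('x \<Rightarrow> 'i \<Rightarrow> complex) \<Rightarrow> bool" where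
  "holomorphic_section n X B s \<longleftrightarrow> (\<forall>x\<in>mcarrier X. s x \<in> fiber B x) \<and>
     (\<forall>i. mholo_on n X (triv B i) (\<lambda>x. s x i))"

text \<open>Very ample: finitely many global sections define an embedding \<open>x \<mapsto> [s\<^sub>0(x) : \<dots> : s\<^sub>N(x)]\<close>.\<close>

definition very_ample :: "nat \<Rightarrow> 'x atlas \<Rightarrow> ('x, 'i) line_bundle \<Rightarrow> bool" where
  "very_ample n X B \<longleftrightarrow> (\<exists>N s F. (\<forall>m\<le>N. holomorphic_section n X B (s m)) \<and>
     (\<forall>i. \<forall>x\<in>triv B i. (\<exists>m\<le>N. s m x i \<noteq> 0) \<and> F x = cline (\<lambda>m. if m \<le> N then s m x i else 0)) \<and>
     holomorphic_embedding n X N (CP_atlas N) F)"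

definition ample :: "nat \<Rightarrow> 'x atlas \<Rightarrow> ('x, 'i) line_bundle \<Rightarrow> bool" where
  "ample n X B \<longleftrightarrow> (\<exists>k\<ge>1. very_ample n X (tensor_power B k))"


section \<open>Hermitian metrics\<close>

text \<open>
  A metric is given by its local weights: the frame \<open>e\<^sub>i\<close> has squared norm \<open>exp (- \<phi> i)\<close>, whence the
  transformation rule.
\<close>

definition smooth_metric ::
    "nat \<Rightarrow> 'x atlas \<Rightarrow> ('x, 'i) line_bundle \<Rightarrow> ('i \<Rightarrow> 'x \<Rightarrow> real) \<Rightarrow> bool" where
  "smooth_metric n X B \<phi> \<longleftrightarrow> (\<forall>i. msmooth_on n X (triv B i) (\<phi> i)) \<and>
     (\<forall>i j. \<forall>x\<in>triv B i \<inter> triv B j. \<phi> i x = \<phi> j x + 2 * ln (cmod (transition B i j x)))"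

definition positive_curvature ::
    "nat \<Rightarrow> 'x atlas \<Rightarrow> ('x, 'i) line_bundle \<Rightarrow> ('i \<Rightarrow> 'x \<Rightarrow> real) \<Rightarrow> bool" where
  "positive_curvature n X B \<phi> \<longleftrightarrow> (\<forall>i. mddc_pos_on n X (triv B i) (\<phi> i))"

text \<open>
  Singular Hermitian metrics with psh local weights.  The weights of a singular metric have to be
  locally integrable; for psh weights this means that they are not identically \<open>-\<infinity>\<close> on any
  nonempty open set.
\<close>

definition psh_metric ::
    "nat \<Rightarrow> 'x atlas \<Rightarrow> ('x, 'i) line_bundle \<Rightarrow> ('i \<Rightarrow> 'x \<Rightarrow> ereal) \<Rightarrow> bool" where
  "psh_metric n X B \<phi> \<longleftrightarrow> (\<forall>i. mpsh_on n X (triv B i) (\<phi> i)) \<and>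
     (\<forall>i j. \<forall>x\<in>triv B i \<inter> triv B j. \<phi> i x = \<phi> j x + ereal (2 * ln (cmod (transition B i j x)))) \<and>
     (\<forall>i W. openin (mtop X) W \<longrightarrow> W \<noteq> {} \<longrightarrow> W \<subseteq> triv B i \<longrightarrow> (\<exists>x\<in>W. \<phi> i x \<noteq> - \<infinity>))"

definition pseudo_effective :: "nat \<Rightarrow> 'x atlas \<Rightarrow> ('x, 'i) line_bundle \<Rightarrow> bool" where
  "pseudo_effective n X B \<longleftrightarrow> (\<exists>\<phi>. psh_metric n X B \<phi>)"

definition minimal_singular_metric ::
    "nat \<Rightarrow> 'x atlas \<Rightarrow> ('x, 'i) line_bundle \<Rightarrow> ('i \<Rightarrow> 'x \<Rightarrow> ereal) \<Rightarrow> bool" where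
  "minimal_singular_metric n X B \<phi> \<longleftrightarrow> psh_metric n X B \<phi> \<and>
     (\<forall>\<phi>'. psh_metric n X B \<phi>' \<longrightarrow> (\<exists>C::real. \<forall>i. \<forall>x\<in>triv B i. \<phi>' i x \<le> \<phi> i x + ereal C))"


section \<open>Equilibrium metrics\<close>

definition usc_regularization :: "'x topology \<Rightarrow> ('x \<Rightarrow> ereal) \<Rightarrow> 'x \<Rightarrow> ereal" where
  "usc_regularization T f x = (INF W\<in>{W. openin T W \<and> x \<in> W}. SUP y\<in>W. f y)"

text \<open>Here \<open>\<theta>\<close> is a family of smooth local weights on the members of the open cover V.\<close>

definition equilibrium_candidates ::
    "nat \<Rightarrow> 'x atlas \<Rightarrow> ('k \<Rightarrow> 'x set) \<Rightarrow> ('k \<Rightarrow> 'x \<Rightarrow> real) \<Rightarrow> ('x \<Rightarrow> ereal) set" where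
  "equilibrium_candidates n X V \<theta> = {\<psi>. (\<forall>x\<in>mcarrier X. \<psi> x \<noteq> \<infinity>) \<and>
     (\<forall>k. mpsh_on n X (V k) (\<lambda>x. ereal (\<theta> k x) + \<psi> x)) \<and> (\<forall>x\<in>mcarrier X. \<psi> x \<le> 0)}"

definition equilibrium_weight ::
    "nat \<Rightarrow> 'x atlas \<Rightarrow> ('k \<Rightarrow> 'x set) \<Rightarrow> ('k \<Rightarrow> 'x \<Rightarrow> real) \<Rightarrow> 'k \<Rightarrow> 'x \<Rightarrow> ereal" where
  "equilibrium_weight n X V \<theta> k x = ereal (\<theta> k x) +
     usc_regularization (mtop X) (\<lambda>y. SUP \<psi>\<in>equilibrium_candidates n X V \<theta>. \<psi> y) x"

definition equilibrium_AL :: "nat \<Rightarrow> 'x atlas \<Rightarrow> ('x, 'i) line_bundle \<Rightarrow> ('x, 'j) line_bundle \<Rightarrow>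
    ('i \<Rightarrow> 'x \<Rightarrow> real) \<Rightarrow> ('j \<Rightarrow> 'x \<Rightarrow> real) \<Rightarrow> real \<Rightarrow> 'i \<Rightarrow> 'j \<Rightarrow> 'x \<Rightarrow> ereal" where
  "equilibrium_AL n X A L \<phi>A \<phi>L t i j x =
     equilibrium_weight n X (\<lambda>(i, j). triv A i \<inter> triv L j)
       (\<lambda>(i, j) x. t * \<phi>A i x + (1 - t) * \<phi>L j x) (i, j) x"


section \<open>The projective bundle of a sum of two line bundles\<close>

text \<open>
  Write \<open>E = A \<oplus> L\<close>.  Vectors in the fibers of the dual of E are functions on the sum of the two index
  types, and a point of the bundle is a pair of a point x of X and a line in the fiber at x.
\<close>

definition dual_sum_fiber ::
    "('x, 'i) line_bundle \<Rightarrow> ('x, 'j) line_bundle \<Rightarrow> 'x \<Rightarrow> ('i + 'j \<Rightarrow> complex) set" where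
  "dual_sum_fiber A L x = {case_sum a b |a b. a \<in> fiber (dual_bundle A) x \<and> b \<in> fiber (dual_bundle L) x}"

definition proj_bundle :: "'x atlas \<Rightarrow> ('x, 'i) line_bundle \<Rightarrow> ('x, 'j) line_bundle \<Rightarrow>
    ('x \<times> ('i + 'j \<Rightarrow> complex) set) set" where
  "proj_bundle X A L =
     {(x, cline v) |x v. x \<in> mcarrier X \<and> v \<in> dual_sum_fiber A L x \<and> v \<noteq> (\<lambda>_. 0)}"

text \<open>
  \<open>NormL i j\<close> stands for the frame \<open>z s\<^sub>A\<^sup>* + s\<^sub>L\<^sup>*\<close> of the tautological bundle, where \<open>s\<^sub>A\<^sup>*\<close> and \<open>s\<^sub>L\<^sup>*\<close>
  are the i-th and j-th frames of the duals of A and L; \<open>NormA i j\<close> stands for the frame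
  \<open>s\<^sub>A\<^sup>* + w s\<^sub>L\<^sup>*\<close>, which is needed near the locus where z is infinite.
\<close>

datatype ('i, 'j) proj_index = NormL 'i 'j | NormA 'i 'j

primrec frame_vector :: "('x, 'i) line_bundle \<Rightarrow> ('x, 'j) line_bundle \<Rightarrow> ('i, 'j) proj_index \<Rightarrow>
    complex \<Rightarrow> 'x \<Rightarrow> ('i + 'j \<Rightarrow> complex)" where
  "frame_vector A L (NormL i j) z x =
     case_sum (\<lambda>k. z * frame (dual_bundle A) i x k) (frame (dual_bundle L) j x)"
| "frame_vector A L (NormA i j) w x =
     case_sum (frame (dual_bundle A) i x) (\<lambda>k. w * frame (dual_bundle L) j x k)"

primrec proj_base :: "('x, 'i) line_bundle \<Rightarrow> ('x, 'j) line_bundle \<Rightarrow> ('i, 'j) proj_index \<Rightarrow> 'x set" where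
  "proj_base A L (NormL i j) = triv A i \<inter> triv L j"
| "proj_base A L (NormA i j) = triv A i \<inter> triv L j"

definition proj_point :: "('x, 'i) line_bundle \<Rightarrow> ('x, 'j) line_bundle \<Rightarrow> ('i, 'j) proj_index \<Rightarrow>
    complex \<Rightarrow> 'x \<Rightarrow> 'x \<times> ('i + 'j \<Rightarrow> complex) set" where
  "proj_point A L \<alpha> z x = (x, cline (frame_vector A L \<alpha> z x))"

text \<open>
  The parametrizations \<open>(z, x) \<mapsto> [z s\<^sub>A\<^sup>*(x) + s\<^sub>L\<^sup>*(x)]\<close> and \<open>(w, x) \<mapsto> [s\<^sub>A\<^sup>*(x) + w s\<^sub>L\<^sup>*(x)]\<close>; the fiber
  coordinate is number 0 and the coordinates of X are shifted by one.
\<close>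

definition proj_atlas :: "'x atlas \<Rightarrow> ('x, 'i) line_bundle \<Rightarrow> ('x, 'j) line_bundle \<Rightarrow>
    ('x \<times> ('i + 'j \<Rightarrow> complex) set) atlas" where
  "proj_atlas X A L =
     {({u. (u \<circ> Suc) \<in> S \<and> p (u \<circ> Suc) \<in> proj_base A L \<alpha>},
       \<lambda>u. proj_point A L \<alpha> (u 0) (p (u \<circ> Suc))) |S p \<alpha>. (S, p) \<in> X}"

primrec taut_coord :: "('i, 'j) proj_index \<Rightarrow> ('i + 'j \<Rightarrow> complex) \<Rightarrow> complex" where
  "taut_coord (NormL i j) v = v (Inr j)"
| "taut_coord (NormA i j) v = v (Inl i)"

primrec fiber_coord :: "('i, 'j) proj_index \<Rightarrow> ('i + 'j \<Rightarrow> complex) \<Rightarrow> complex" where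
  "fiber_coord (NormL i j) v = v (Inl i)"
| "fiber_coord (NormA i j) v = v (Inr j)"

definition taut_frame :: "('i, 'j) proj_index \<Rightarrow> 'x \<times> ('i + 'j \<Rightarrow> complex) set \<Rightarrow> ('i + 'j \<Rightarrow> complex)" where
  "taut_frame \<alpha> P = (THE v. v \<in> snd P \<and> taut_coord \<alpha> v = 1)"

text \<open>
  The tautological line subbundle of the pull-back of the dual of E: its fiber at (x, l) is l.  The
  frame \<open>taut_frame \<alpha>\<close> is the vector of l of the form \<open>z s\<^sub>A\<^sup>* + s\<^sub>L\<^sup>*\<close> or \<open>s\<^sub>A\<^sup>* + w s\<^sub>L\<^sup>*\<close>
  (see \<open>taut_frame_proj_point\<close> below).
\<close>

definition tautological_bundle :: "'x atlas \<Rightarrow> ('x, 'i) line_bundle \<Rightarrow> ('x, 'j) line_bundle \<Rightarrow>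
    ('x \<times> ('i + 'j \<Rightarrow> complex) set, ('i, 'j) proj_index) line_bundle" where
  "tautological_bundle X A L =
     \<lparr>triv = \<lambda>\<alpha>. {P \<in> proj_bundle X A L. fst P \<in> proj_base A L \<alpha> \<and> (\<exists>v\<in>snd P. taut_coord \<alpha> v = 1)},
      transition = \<lambda>\<alpha> \<beta> P. taut_coord \<alpha> (taut_frame \<beta> P)\<rparr>"

definition hyperplane_bundle :: "'x atlas \<Rightarrow> ('x, 'i) line_bundle \<Rightarrow> ('x, 'j) line_bundle \<Rightarrow>
    ('x \<times> ('i + 'j \<Rightarrow> complex) set, ('i, 'j) proj_index) line_bundle" where
  "hyperplane_bundle X A L = dual_bundle (tautological_bundle X A L)"


section \<open>The metric\<close>

text \<open>The value at \<open>\<infinity>\<close> is irrelevant.\<close>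

definition exp_ereal :: "ereal \<Rightarrow> real" where
  "exp_ereal u = (if u = - \<infinity> then 0 else exp (real_of_ereal u))"

definition ln_ereal :: "real \<Rightarrow> ereal" where
  "ln_ereal r = (if r = 0 then - \<infinity> else ereal (ln r))"

text \<open>Unlike \<open>powr\<close>, this has \<open>0\<^sup>0 = 1\<close>.\<close>

definition rpow :: "real \<Rightarrow> real \<Rightarrow> real" where
  "rpow r s = (if s = 0 then 1 else r powr s)"

definition tilde_phi :: "nat \<Rightarrow> 'x atlas \<Rightarrow> ('x, 'i) line_bundle \<Rightarrow> ('x, 'j) line_bundle \<Rightarrow>
    ('i \<Rightarrow> 'x \<Rightarrow> real) \<Rightarrow> ('j \<Rightarrow> 'x \<Rightarrow> real) \<Rightarrow> 'i \<Rightarrow> 'j \<Rightarrow> complex \<Rightarrow> 'x \<Rightarrow> ereal" where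
  "tilde_phi n X A L \<phi>A \<phi>L i j z x =
     ln_ereal (GREATEST y. \<exists>t\<in>{0..1}.
       y = rpow (cmod z) (2 * t) * exp_ereal (equilibrium_AL n X A L \<phi>A \<phi>L t i j x))"

text \<open>
  The weights of the same metric with respect to the frames dual to \<open>s\<^sub>A\<^sup>* + w s\<^sub>L\<^sup>*\<close>.  For \<open>w \<noteq> 0\<close> the
  transformation rule with \<open>z = 1 / w\<close> forces this formula, and its values at \<open>w = 0\<close> are the only ones
  for which the weight can be psh.
\<close>

definition tilde_phi_inf :: "nat \<Rightarrow> 'x atlas \<Rightarrow> ('x, 'i) line_bundle \<Rightarrow> ('x, 'j) line_bundle \<Rightarrow>
    ('i \<Rightarrow> 'x \<Rightarrow> real) \<Rightarrow> ('j \<Rightarrow> 'x \<Rightarrow> real) \<Rightarrow> 'i \<Rightarrow> 'j \<Rightarrow> complex \<Rightarrow> 'x \<Rightarrow> ereal" where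
  "tilde_phi_inf n X A L \<phi>A \<phi>L i j w x =
     ln_ereal (GREATEST y. \<exists>t\<in>{0..1}.
       y = rpow (cmod w) (2 * (1 - t)) * exp_ereal (equilibrium_AL n X A L \<phi>A \<phi>L t i j x))"

primrec tilde_metric :: "nat \<Rightarrow> 'x atlas \<Rightarrow> ('x, 'i) line_bundle \<Rightarrow> ('x, 'j) line_bundle \<Rightarrow>
    ('i \<Rightarrow> 'x \<Rightarrow> real) \<Rightarrow> ('j \<Rightarrow> 'x \<Rightarrow> real) \<Rightarrow>
    ('i, 'j) proj_index \<Rightarrow> 'x \<times> ('i + 'j \<Rightarrow> complex) set \<Rightarrow> ereal" where
  "tilde_metric n X A L \<phi>A \<phi>L (NormL i j) P =
     tilde_phi n X A L \<phi>A \<phi>L i j (fiber_coord (NormL i j) (taut_frame (NormL i j) P)) (fst P)"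
| "tilde_metric n X A L \<phi>A \<phi>L (NormA i j) P =
     tilde_phi_inf n X A L \<phi>A \<phi>L i j (fiber_coord (NormA i j) (taut_frame (NormA i j) P)) (fst P)"


section \<open>The definitions in coordinates\<close>

lemma dual_bundle_sel:
  "triv (dual_bundle B) = triv B"
  "transition (dual_bundle B) i j x = inverse (transition B i j x)"
  by (simp_all add: dual_bundle_def)

lemma fiber_scale:
  assumes "v \<in> fiber B x"
  shows "(\<lambda>k. c * v k) \<in> fiber B x"
proof -
  have v: "\<And>i. x \<notin> triv B i \<Longrightarrow> v i = 0"
    "\<And>i j. x \<in> triv B i \<inter> triv B j \<Longrightarrow> v i = transition B i j x * v j"
    using assms unfolding fiber_def by blast+
  have "c * v i = transition B i j x * (c * v j)" if "x \<in> triv B i \<inter> triv B j" for i j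
    by (subst v(2)[OF that]) (rule mult.left_commute)
  then show ?thesis unfolding fiber_def using v(1) by simp
qed

lemma frame_in_fiber:
  assumes "is_line_bundle n X B" "x \<in> triv B i"
  shows "frame (dual_bundle B) i x \<in> fiber (dual_bundle B) x" "frame (dual_bundle B) i x i = 1"
proof -
  have "inverse (transition B k i x) =
      inverse (transition B k l x) * inverse (transition B l i x)"
    if "x \<in> triv B k" "x \<in> triv B l" for k l
  proof -
    have "transition B k l x * transition B l i x = transition B k i x"
      using assms that unfolding is_line_bundle_def by blast
    then show ?thesis by (metis inverse_mult_distrib)
  qed
  then show "frame (dual_bundle B) i x \<in> fiber (dual_bundle B) x"
    unfolding fiber_def frame_def dual_bundle_sel by simp
  show "frame (dual_bundle B) i x i = 1"
    using assms by (simp add: frame_def dual_bundle_sel is_line_bundle_def)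
qed

lemma fiber_eq_frame:
  assumes "x \<in> triv B i" "v \<in> fiber (dual_bundle B) x"
  shows "v = (\<lambda>k. v i * frame (dual_bundle B) i x k)"
proof
  fix k
  have v: "x \<notin> triv B k \<Longrightarrow> v k = 0"
    "x \<in> triv B k \<Longrightarrow> v k = inverse (transition B k i x) * v i"
    using assms unfolding fiber_def dual_bundle_sel by blast+
  show "v k = v i * frame (dual_bundle B) i x k"
  proof (cases "x \<in> triv B k")
    case True
    then show ?thesis using v(2) by (simp only: frame_def dual_bundle_sel if_True mult.commute)
  next
    case False
    then show ?thesis using v(1) by (simp add: frame_def dual_bundle_sel)
  qed
qed

lemma coord_frame_vector:
  assumes "is_line_bundle n X A" "is_line_bundle n X L" "x \<in> proj_base A L \<alpha>"
  shows "taut_coord \<alpha> (frame_vector A L \<alpha> z x) = 1" "fiber_coord \<alpha> (frame_vector A L \<alpha> z x) = z"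
  using assms frame_in_fiber(2)[OF assms(1)] frame_in_fiber(2)[OF assms(2)] by (cases \<alpha>; auto)+

lemma taut_coord_scale: "taut_coord \<alpha> (\<lambda>k. c * v k) = c * taut_coord \<alpha> v"
  by (cases \<alpha>) auto

lemma taut_frame_proj_point:
  assumes "is_line_bundle n X A" "is_line_bundle n X L" "x \<in> proj_base A L \<alpha>"
  shows "taut_frame \<alpha> (proj_point A L \<alpha> z x) = frame_vector A L \<alpha> z x"
proof -
  note c = coord_frame_vector[OF assms, of z]
  have "frame_vector A L \<alpha> z x \<in> cline (frame_vector A L \<alpha> z x)"
    by (force simp: cline_def intro: rev_image_eqI[of 1])
  moreover have "v = frame_vector A L \<alpha> z x"
    if "v \<in> cline (frame_vector A L \<alpha> z x)" "taut_coord \<alpha> v = 1" for v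
    using that c by (auto simp: cline_def taut_coord_scale)
  ultimately show ?thesis
    unfolding taut_frame_def proj_point_def using c by (intro the_equality) auto
qed

lemma tilde_metric_proj_point:
  assumes "is_line_bundle n X A" "is_line_bundle n X L" "x \<in> triv A i \<inter> triv L j"
  shows "tilde_metric n X A L \<phi>A \<phi>L (NormL i j) (proj_point A L (NormL i j) z x) =
           tilde_phi n X A L \<phi>A \<phi>L i j z x"
    and "tilde_metric n X A L \<phi>A \<phi>L (NormA i j) (proj_point A L (NormA i j) z x) =
           tilde_phi_inf n X A L \<phi>A \<phi>L i j z x"
  using assms taut_frame_proj_point[OF assms(1,2), of x "NormL i j" z]
    taut_frame_proj_point[OF assms(1,2), of x "NormA i j" z]
    coord_frame_vector[OF assms(1,2), of x "NormL i j" z]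
    coord_frame_vector[OF assms(1,2), of x "NormA i j" z]
  by (auto simp: proj_point_def simp del: fiber_coord.simps frame_vector.simps)

lemma cline_scale:
  assumes "c \<noteq> 0"
  shows "cline (\<lambda>k. c * v k) = cline v"
proof
  show "cline (\<lambda>k. c * v k) \<subseteq> cline v"
    by (auto simp: cline_def image_iff mult.assoc[symmetric])
  have "(\<lambda>k. d * v k) \<in> cline (\<lambda>k. c * v k)" for d
    unfolding cline_def using assms by (intro image_eqI[of _ _ "d / c"]) auto
  then show "cline v \<subseteq> cline (\<lambda>k. c * v k)" by (auto simp: cline_def[of v])
qed

lemma mcarrier_proj_atlas:
  fixes X :: "'a atlas" and A :: "('a, 'b) line_bundle" and L :: "('a, 'c) line_bundle"
  assumes "is_line_bundle n X A" "is_line_bundle n X L"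
  shows "mcarrier (proj_atlas X A L) = proj_bundle X A L"
proof
  show "mcarrier (proj_atlas X A L) \<subseteq> proj_bundle X A L"
  proof
    fix P assume "P \<in> mcarrier (proj_atlas X A L)"
    then obtain S p \<alpha> u where Sp: "(S, p) \<in> X" and u: "(u \<circ> Suc) \<in> S" "p (u \<circ> Suc) \<in> proj_base A L \<alpha>"
      and P: "P = proj_point A L \<alpha> (u 0) (p (u \<circ> Suc))"
      unfolding mcarrier_def proj_atlas_def by auto
    define x where "x = p (u \<circ> Suc)"
    have x: "x \<in> mcarrier X" using Sp u(1) unfolding mcarrier_def x_def by blast
    have xb: "x \<in> proj_base A L \<alpha>" using u(2) by (simp add: x_def)
    obtain i j where ij: "\<alpha> = NormL i j \<or> \<alpha> = NormA i j" by (cases \<alpha>) auto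
    then have xij: "x \<in> triv A i" "x \<in> triv L j" using xb by auto
    have "frame_vector A L \<alpha> (u 0) x \<in> dual_sum_fiber A L x"
      using ij frame_in_fiber(1)[OF assms(1) xij(1)] frame_in_fiber(1)[OF assms(2) xij(2)]
        fiber_scale[of _ "dual_bundle A"] fiber_scale[of _ "dual_bundle L"]
      unfolding dual_sum_fiber_def by (elim disjE; simp; blast)
    moreover have "frame_vector A L \<alpha> (u 0) x \<noteq> (\<lambda>_. 0)"
    proof
      assume "frame_vector A L \<alpha> (u 0) x = (\<lambda>_. 0)"
      moreover have "taut_coord \<alpha> (\<lambda>_. 0) = 0" by (cases \<alpha>) auto
      ultimately show False using coord_frame_vector(1)[OF assms xb, of "u 0"] by simp
    qed
    ultimately show "P \<in> proj_bundle X A L"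
      using x unfolding P x_def[symmetric] proj_bundle_def proj_point_def by blast
  qed
  show "proj_bundle X A L \<subseteq> mcarrier (proj_atlas X A L)"
  proof
    fix P assume "P \<in> proj_bundle X A L"
    then obtain x a b where x: "x \<in> mcarrier X" and a: "a \<in> fiber (dual_bundle A) x"
      and b: "b \<in> fiber (dual_bundle L) x" and ne: "case_sum a b \<noteq> (\<lambda>_. 0)"
      and P: "P = (x, cline (case_sum a b))"
      unfolding proj_bundle_def dual_sum_fiber_def by blast
    have "x \<in> (\<Union>i. triv A i)" "x \<in> (\<Union>j. triv L j)"
      using x assms by (auto simp: is_line_bundle_def)
    then obtain i j where ij: "x \<in> triv A i" "x \<in> triv L j" by auto
    let ?fa = "frame (dual_bundle A) i x" and ?fl = "frame (dual_bundle L) j x"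
    have a': "a = (\<lambda>k. a i * ?fa k)" by (rule fiber_eq_frame[OF ij(1) a])
    have b': "b = (\<lambda>k. b j * ?fl k)" by (rule fiber_eq_frame[OF ij(2) b])
    have "\<exists>\<alpha> z. x \<in> proj_base A L \<alpha> \<and> P = proj_point A L \<alpha> z x"
    proof (cases "b j = 0")
      case False
      have "case_sum a b = (\<lambda>k. b j * frame_vector A L (NormL i j) (a i / b j) x k)"
      proof
        fix k show "case_sum a b k = b j * frame_vector A L (NormL i j) (a i / b j) x k"
        proof (cases k)
          case (Inl m)
          have "b j * (a i / b j * c) = a i * c" for c using False by simp
          with Inl show ?thesis using fun_cong[OF a', of m] by (simp only: sum.case frame_vector.simps)
        next
          case (Inr m)
          then show ?thesis using fun_cong[OF b', of m] by (simp only: sum.case frame_vector.simps)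
        qed
      qed
      then have "cline (case_sum a b) = cline (frame_vector A L (NormL i j) (a i / b j) x)"
        by (simp only: cline_scale[OF False])
      then show ?thesis using ij unfolding P proj_point_def
        by (intro exI[of _ "NormL i j"] exI[of _ "a i / b j"]) simp
    next
      case True
      have b0: "b = (\<lambda>_. 0)" using b' by (simp only: True mult_zero_left)
      have ai: "a i \<noteq> 0"
      proof
        assume "a i = 0"
        then have "a = (\<lambda>_. 0)" using a' by (simp only: mult_zero_left)
        with b0 have "case_sum a b k = 0" for k by (cases k) simp_all
        with ne show False by (simp add: fun_eq_iff)
      qed
      have "case_sum a b = (\<lambda>k. a i * frame_vector A L (NormA i j) 0 x k)"
      proof
        fix k show "case_sum a b k = a i * frame_vector A L (NormA i j) 0 x k"
        proof (cases k)
          case (Inl m)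
          then show ?thesis using fun_cong[OF a', of m] by (simp only: sum.case frame_vector.simps)
        next
          case (Inr m)
          then show ?thesis using b0 by simp
        qed
      qed
      then have "cline (case_sum a b) = cline (frame_vector A L (NormA i j) 0 x)"
        by (simp only: cline_scale[OF ai])
      then show ?thesis using ij unfolding P proj_point_def
        by (intro exI[of _ "NormA i j"] exI[of _ 0]) simp
    qed
    then obtain \<alpha> z where az: "x \<in> proj_base A L \<alpha>" "P = proj_point A L \<alpha> z x" by blast
    obtain S p s where s: "(S, p) \<in> X" "s \<in> S" "x = p s" using x unfolding mcarrier_def by auto
    define u where "u = case_nat z s"
    have u: "u \<circ> Suc = s" "u 0 = z" by (auto simp: u_def)
    have mem: "({u. (u \<circ> Suc) \<in> S \<and> p (u \<circ> Suc) \<in> proj_base A L \<alpha>},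
       \<lambda>u. proj_point A L \<alpha> (u 0) (p (u \<circ> Suc))) \<in> proj_atlas X A L"
      using s(1) unfolding proj_atlas_def by blast
    have "P = (\<lambda>u. proj_point A L \<alpha> (u 0) (p (u \<circ> Suc))) u"
      "u \<in> {u. (u \<circ> Suc) \<in> S \<and> p (u \<circ> Suc) \<in> proj_base A L \<alpha>}"
      using u s az by simp_all
    then show "P \<in> mcarrier (proj_atlas X A L)"
      using mem unfolding mcarrier_def by blast
  qed
qed

end

theory Submission
  imports Defs "HOL-Complex_Analysis.Complex_Analysis"
begin

text \<open>
  Plurisubharmonicity is tested against real parts of holomorphic functions on discs.  In this form it
  passes to suprema and to relaxed upper limits, so regularizing the envelopes of the weights
  \<open>t * \<phi>A + (1 - t) * \<phi>L\<close> in x and t simultaneously produces candidates again.  Hence the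
  equilibrium weights are jointly upper semicontinuous in (t, x), the maximum over t is attained, and
  the resulting weight is psh.

  Conversely, let a psh metric of the hyperplane bundle be given.  Its maximum over the rotations of the
  fiber coordinate z is a convex function of \<open>s = ln \<bar>z\<bar>\<close> with slopes between 0 and 2, so by Legendre
  duality it is the maximum over t of \<open>2 * t * s + \<chi>\<^sub>t(x)\<close>, where \<open>\<chi>\<^sub>t\<close> is the infimum over s of the
  function minus \<open>2 * t * s\<close>.  By Kiselman's minimum principle \<open>\<chi>\<^sub>t\<close> is psh in x, and by compactness it
  exceeds \<open>t * \<phi>A + (1 - t) * \<phi>L\<close> by at most a constant independent of t.  So up to this constant it is
  bounded by the equilibrium weight.
\<close>

section \<open>Upper semicontinuous functions\<close>

text \<open>Two obstacles shape the argument. First, circle integrals behave badly under suprema,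
  which need be neither measurable nor upper semicontinuous. Majorants Re G avoid this, and nothing
  is lost: an upper semicontinuous function on the circle is a decreasing limit of continuous ones,
  and these are uniform limits of real parts of polynomials. Envelopes taken for each t separately
  give no control as t varies; but since the weights are continuous in t, candidates for nearby
  parameters are almost candidates at t. Second, an infimum of psh functions is in general not psh.
  Convexity in s lets almost minimizing s be chosen continuously, and a holomorphic h with real part
  close to this choice turns the infimum into a value along z = exp (h \<zeta>). This curve is not
  affine, so a separate argument has to lead from affine discs to it. The slopes come from the
  fiber: a weight of O(1) is bounded above near z = 0 and grows at most like 2 * s at infinity. The
  additive constant is a bound over the compact X for the weights on |z| \<le> 1 and on |1 / z|
  \<le> 1.\<close>

definition usc_on :: "'a::topological_space set \<Rightarrow> ('a \<Rightarrow> ereal) \<Rightarrow> bool" where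
  "usc_on S u \<longleftrightarrow> (\<forall>a\<in>S. \<forall>c. u a < c \<longrightarrow> (\<exists>N. open N \<and> a \<in> N \<and> (\<forall>x\<in>N \<inter> S. u x < c)))"

lemma usc_onD:
  assumes "usc_on S u" "a \<in> S" "u a < c"
  obtains N where "open N" "a \<in> N" "\<And>x. x \<in> N \<Longrightarrow> x \<in> S \<Longrightarrow> u x < c"
proof -
  have "\<exists>N. open N \<and> a \<in> N \<and> (\<forall>x\<in>N \<inter> S. u x < c)"
    using assms unfolding usc_on_def by simp
  then show ?thesis using that by (elim exE conjE) simp
qed

lemma usc_on_iff_openin:
  "usc_on S u \<longleftrightarrow> (\<forall>c. openin (top_of_set S) {a\<in>S. u a < c})"
proof
  assume u: "usc_on S u"
  show "\<forall>c. openin (top_of_set S) {a\<in>S. u a < c}"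
  proof
    fix c
    show "openin (top_of_set S) {a\<in>S. u a < c}"
    proof (subst openin_subopen, safe)
      fix a assume a: "a \<in> S" "u a < c"
      then obtain N where N: "open N" "a \<in> N" "\<And>x. x \<in> N \<Longrightarrow> x \<in> S \<Longrightarrow> u x < c"
        using u by (meson usc_onD)
      then show "\<exists>T. openin (top_of_set S) T \<and> a \<in> T \<and> T \<subseteq> {a\<in>S. u a < c}"
        using a by (intro exI[of _ "S \<inter> N"]) (auto simp: openin_open)
    qed
  qed
next
  assume r: "\<forall>c. openin (top_of_set S) {a\<in>S. u a < c}"
  show "usc_on S u"
    unfolding usc_on_def
  proof (intro ballI allI impI)
    fix a c assume a: "a \<in> S" "u a < c"
    obtain T where "open T" "{a\<in>S. u a < c} = S \<inter> T"
      using r openin_open by metis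
    with a show "\<exists>N. open N \<and> a \<in> N \<and> (\<forall>x\<in>N \<inter> S. u x < c)"
      by (intro exI[of _ T]) blast
  qed
qed

lemma usc_on_subset: "usc_on S u \<Longrightarrow> T \<subseteq> S \<Longrightarrow> usc_on T u"
  unfolding usc_on_iff_openin
proof
  fix c assume "\<forall>c. openin (top_of_set S) {a\<in>S. u a < c}" and "T \<subseteq> S"
  obtain O' where "open O'" "{a\<in>S. u a < c} = S \<inter> O'"
    using \<open>\<forall>c. _\<close> unfolding openin_open by blast
  moreover from this(2) have "{a\<in>T. u a < c} = T \<inter> O'" using \<open>T \<subseteq> S\<close> by blast
  ultimately show "openin (top_of_set T) {a\<in>T. u a < c}"
    unfolding openin_open by blast
qed

lemma usc_on_cong: "(\<And>x. x \<in> S \<Longrightarrow> u x = v x) \<Longrightarrow> usc_on S u \<longleftrightarrow> usc_on S v"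
  unfolding usc_on_def by (simp add: Ball_def)

lemma usc_on_compose:
  assumes "usc_on S u" "continuous_on T g" "g ` T \<subseteq> S"
  shows "usc_on T (\<lambda>x. u (g x))"
  unfolding usc_on_def
proof (intro ballI allI impI)
  fix a c assume a: "a \<in> T" "u (g a) < c"
  then obtain N where N: "open N" "g a \<in> N" "\<And>x. x \<in> N \<Longrightarrow> x \<in> S \<Longrightarrow> u x < c"
    using assms usc_onD by (metis image_subset_iff)
  obtain M where "open M" "M \<inter> T = g -` N \<inter> T"
    using assms(2) N(1) unfolding continuous_on_open_invariant by blast
  then show "\<exists>M. open M \<and> a \<in> M \<and> (\<forall>x\<in>M \<inter> T. u (g x) < c)"
    using N(2,3) a assms(3) by (intro exI[of _ M]) blast
qed

lemma usc_on_add_continuous: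
  fixes f :: "_ \<Rightarrow> real"
  assumes "usc_on S u" "continuous_on S f"
  shows "usc_on S (\<lambda>x. u x + ereal (f x))"
  unfolding usc_on_def
proof (intro ballI allI impI)
  fix a c assume a: "a \<in> S" "u a + ereal (f a) < c"
  have "u a < c - ereal (f a)"
    using a(2) by (simp add: ereal_less_minus)
  then obtain d where d: "u a < ereal d" "ereal d < c - ereal (f a)"
    using ereal_dense2 by metis
  obtain N where N: "open N" "a \<in> N" "\<And>x. x \<in> N \<Longrightarrow> x \<in> S \<Longrightarrow> u x < ereal d"
    using assms(1) a(1) d(1) usc_onD by metis
  have "ereal (d + f a) < c"
    using d(2) by (simp add: ereal_less_minus)
  then obtain e where e: "ereal (d + f a) < ereal e" "ereal e < c"
    using ereal_dense2 by metis
  have "open {..<e - d}" by simp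
  then obtain M where M: "open M" "M \<inter> S = f -` {..<e - d} \<inter> S"
    using assms(2) unfolding continuous_on_open_invariant by blast
  have "u x + ereal (f x) < c" if "x \<in> N \<inter> M \<inter> S" for x
  proof -
    have "u x < ereal d" "f x < e - d" using that N M by auto
    then have "u x + ereal (f x) < ereal e" by (cases "u x") auto
    with e(2) show ?thesis by order
  qed
  moreover have "a \<in> M" using M e(1) a(1) by auto
  ultimately show "\<exists>N. open N \<and> a \<in> N \<and> (\<forall>x\<in>N \<inter> S. u x + ereal (f x) < c)"
    using N M by (intro exI[of _ "N \<inter> M"]) auto
qed

lemma usc_on_add:
  assumes "usc_on S u" "usc_on S v" "\<And>x. x \<in> S \<Longrightarrow> u x \<noteq> \<infinity>" "\<And>x. x \<in> S \<Longrightarrow> v x \<noteq> \<infinity>"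
  shows "usc_on S (\<lambda>x. u x + v x)"
  unfolding usc_on_def
proof (intro ballI allI impI)
  fix a c assume a: "a \<in> S" "u a + v a < c"
  \<comment> \<open>c is split into bounds for the two summands. If one summand is -\<infinity>, its
    bound takes whatever the other leaves; otherwise the slack r - x - y is halved.\<close>
  have "\<exists>d e. u a < ereal d \<and> v a < ereal e \<and> ereal d + ereal e \<le> c"
  proof -
    obtain r where r: "u a + v a < ereal r" "ereal r < c" using a(2) ereal_dense2 by metis
    consider "u a = -\<infinity>" | "v a = -\<infinity>" | x y where "u a = ereal x" "v a = ereal y"
      using assms(3,4)[OF a(1)] by (cases "u a"; cases "v a") auto
    then show ?thesis
    proof cases
      case 1
      obtain e where "v a < ereal e" using assms(4)[OF a(1)] ereal_dense2[of "v a" \<infinity>]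
        by (auto simp: less_top[symmetric] top_ereal_def)
      then show ?thesis using 1 r by (intro exI[of _ "r - e"] exI[of _ e]) auto
    next
      case 2
      obtain e where "u a < ereal e" using assms(3)[OF a(1)] ereal_dense2[of "u a" \<infinity>]
        by (auto simp: less_top[symmetric] top_ereal_def)
      then show ?thesis using 2 r by (intro exI[of _ e] exI[of _ "r - e"]) auto
    next
      case 3
      then show ?thesis using r
        by (intro exI[of _ "x + (r - x - y) / 2"] exI[of _ "y + (r - x - y) / 2"]) (auto simp: field_simps)
    qed
  qed
  then obtain d e where de: "u a < ereal d" "v a < ereal e" "ereal d + ereal e \<le> c" by blast
  obtain N where N: "open N" "a \<in> N" "\<And>x. x \<in> N \<Longrightarrow> x \<in> S \<Longrightarrow> u x < ereal d"
    using assms(1) a(1) de(1) usc_onD by metis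
  obtain M where M: "open M" "a \<in> M" "\<And>x. x \<in> M \<Longrightarrow> x \<in> S \<Longrightarrow> v x < ereal e"
    using assms(2) a(1) de(2) usc_onD by metis
  have "u x + v x < c" if "x \<in> N \<inter> M \<inter> S" for x
  proof -
    have "u x < ereal d" "v x < ereal e" using that N M by auto
    then have "u x + v x < ereal d + ereal e" by (rule ereal_add_strict_mono2)
    with de(3) show ?thesis by order
  qed
  then show "\<exists>N. open N \<and> a \<in> N \<and> (\<forall>x\<in>N \<inter> S. u x + v x < c)"
    using N M by (intro exI[of _ "N \<inter> M"]) auto
qed

text \<open>If no point were maximal, the sets where u < u y, for y in K, would be a relatively open
  cover of K. In a finite subcover the index with the largest value would lie in one of the sets,
  hence have a value below that of another index.\<close>

lemma usc_on_attains_sup: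
  assumes "usc_on K u" "compact K" "K \<noteq> {}"
  obtains x where "x \<in> K" "\<And>y. y \<in> K \<Longrightarrow> u y \<le> u x"
proof (rule ccontr)
  assume contra: "\<not> thesis"
  have *: "\<forall>x\<in>K. \<exists>y\<in>K. u x < u y"
  proof (rule ccontr)
    assume "\<not> (\<forall>x\<in>K. \<exists>y\<in>K. u x < u y)"
    then obtain x where "x \<in> K" "\<forall>y\<in>K. u y \<le> u x" by (auto simp: not_less)
    then show False using contra that[of x] by blast
  qed
  have "\<exists>N. open N \<and> N \<inter> K = {x\<in>K. u x < u y}" for y
    using assms(1) unfolding usc_on_iff_openin openin_open by (metis Int_commute)
  then obtain W where W: "\<And>y. open (W y) \<and> W y \<inter> K = {x\<in>K. u x < u y}"
    by metis
  have "K \<subseteq> (\<Union>y\<in>K. W y)"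
    using * W by blast
  then obtain D where D: "D \<subseteq> K" "finite D" "K \<subseteq> (\<Union>y\<in>D. W y)"
    using compactE_image[OF assms(2), of K W] W by metis
  have "D \<noteq> {}" using D(3) assms(3) by auto
  then obtain m where m: "m \<in> D" "\<And>y. y \<in> D \<Longrightarrow> u y \<le> u m"
    using Max_in[of "u ` D"] Max_ge[of "u ` D"] D(2) by (metis (no_types, lifting) finite_imageI image_iff image_is_empty imageI)
  then obtain y where "y \<in> D" "m \<in> W y" using D by blast
  then have "u m < u y" using W[of y] m(1) D(1) by blast
  then show False using m(2)[OF \<open>y \<in> D\<close>] by order
qed

lemma usc_on_bounded_above:
  assumes "usc_on K u" "compact K" "\<And>x. x \<in> K \<Longrightarrow> u x \<noteq> \<infinity>"
  obtains M where "\<And>x. x \<in> K \<Longrightarrow> u x \<le> ereal M"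
proof (cases "K = {}")
  case False
  obtain x where x: "x \<in> K" "\<And>y. y \<in> K \<Longrightarrow> u y \<le> u x"
    using usc_on_attains_sup[OF assms(1,2) False] by metis
  then obtain M where "u x \<le> ereal M" using assms(3)[of x] by (cases "u x") auto
  then show ?thesis using x that by (meson order_trans)
qed (use that in blast)

text \<open>This is how compactness is used throughout: a strict bound that holds at a for all
  parameters in K persists near a, uniformly in K. The sublevel set is an open neighborhood of {a}
  \<times> K, and the tube lemma applies.\<close>

lemma usc_on_tube:
  assumes "usc_on (A \<times> K) u" "compact K" "a \<in> A" "\<And>k. k \<in> K \<Longrightarrow> u (a, k) < c"
  obtains N where "open N" "a \<in> N" "\<And>x k. x \<in> N \<Longrightarrow> x \<in> A \<Longrightarrow> k \<in> K \<Longrightarrow> u (x, k) < c"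
proof -
  have "openin (top_of_set (A \<times> K)) {p\<in>A \<times> K. u p < c}"
    using assms(1) unfolding usc_on_iff_openin by blast
  then obtain W where W: "open W" "{p\<in>A \<times> K. u p < c} = (A \<times> K) \<inter> W"
    unfolding openin_open by blast
  have "{a} \<times> K \<subseteq> W" using W(2) assms(3,4) by blast
  then obtain N where "a \<in> N" "open N" "N \<times> K \<subseteq> W"
    using Elementary_Topology.tube_lemma[OF assms(2) W(1)] by blast
  then show ?thesis using W(2) by (intro that[of N]) auto
qed

lemma usc_on_SUP_compact:
  assumes "usc_on (A \<times> K) u" "compact K" "K \<noteq> {}"
  shows "usc_on A (\<lambda>a. SUP k\<in>K. u (a, k))"
  unfolding usc_on_def
proof (intro ballI allI impI)
  fix a c assume a: "a \<in> A" "(SUP k\<in>K. u (a, k)) < c"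
  \<comment> \<open>A supremum of values below d is only known to be at most d, hence a number
    strictly below c in place of c itself.\<close>
  obtain d where d: "(SUP k\<in>K. u (a, k)) < d" "d < c" using dense[OF a(2)] by blast
  have *: "u (a, k) < d" if "k \<in> K" for k
    by (rule SUP_lessD[OF d(1) that])
  obtain N where N: "open N" "a \<in> N" "\<And>x k. x \<in> N \<Longrightarrow> x \<in> A \<Longrightarrow> k \<in> K \<Longrightarrow> u (x, k) < d"
    by (rule usc_on_tube[OF assms(1,2) a(1)]) (auto intro: *)
  have "(SUP k\<in>K. u (x, k)) \<le> d" if "x \<in> N \<inter> A" for x
    using N(3) that by (intro SUP_least) (simp add: order.strict_implies_order)
  with N d(2) show "\<exists>N. open N \<and> a \<in> N \<and> (\<forall>x\<in>N \<inter> A. (SUP k\<in>K. u (x, k)) < c)"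
    by (intro exI[of _ N]) (meson order_le_less_trans)
qed

lemma SUP_usc_compact_attained:
  assumes "usc_on K u" "compact K" "K \<noteq> {}"
  obtains k where "k \<in> K" "(SUP k\<in>K. u k) = u k"
proof -
  obtain x where x: "x \<in> K" "\<And>y. y \<in> K \<Longrightarrow> u y \<le> u x"
    using usc_on_attains_sup[OF assms] by metis
  then have "(SUP k\<in>K. u k) = u x"
    by (intro antisym SUP_least SUP_upper) auto
  with x(1) show ?thesis by (rule that)
qed

lemma usc_on_INF:
  assumes "\<And>i. i \<in> I \<Longrightarrow> usc_on S (u i)"
  shows "usc_on S (\<lambda>x. INF i\<in>I. u i x)"
  unfolding usc_on_def
proof (intro ballI allI impI)
  fix a c assume a: "a \<in> S" "(INF i\<in>I. u i a) < c"
  then obtain i where i: "i \<in> I" "u i a < c" by (auto simp: INF_less_iff)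
  then obtain N where "open N" "a \<in> N" "\<And>x. x \<in> N \<Longrightarrow> x \<in> S \<Longrightarrow> u i x < c"
    using assms a(1) usc_onD by metis
  then show "\<exists>N. open N \<and> a \<in> N \<and> (\<forall>x\<in>N \<inter> S. (INF i\<in>I. u i x) < c)"
    using i(1) by (intro exI[of _ N]) (auto simp: INF_less_iff)
qed

text \<open>The Lipschitz regularizations of a bounded truncation approximate from above.\<close>

lemma usc_on_continuous_approx:
  fixes w :: "'a::metric_space \<Rightarrow> ereal"
  assumes "usc_on K w" "compact K" "K \<noteq> {}" "\<And>x. x \<in> K \<Longrightarrow> w x \<noteq> \<infinity>"
  obtains q :: "nat \<Rightarrow> 'a \<Rightarrow> real" where
    "\<And>k. continuous_on UNIV (q k)" "\<And>k x. q (Suc k) x \<le> q k x"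
    "\<And>k x. x \<in> K \<Longrightarrow> w x \<le> ereal (q k x)"
    "\<And>x. x \<in> K \<Longrightarrow> (\<lambda>k. ereal (q k x)) \<longlonglongrightarrow> w x"
proof -
  obtain M0 where M0: "\<And>x. x \<in> K \<Longrightarrow> w x \<le> ereal M0"
    using usc_on_bounded_above[OF assms(1,2,4)] by metis
  define M where "M = max M0 0"
  have M: "M \<ge> 0" "\<And>x. x \<in> K \<Longrightarrow> w x \<le> ereal M"
    using M0 by (auto simp: M_def max_def intro: order_trans[of _ "ereal M0"])
  \<comment> \<open>Cutting off at -k makes w real-valued; the cut-off functions decrease to
    w.\<close>
  define v where "v k x = real_of_ereal (max (w x) (ereal (- real k)))" for k x
  have v: "ereal (v k x) = max (w x) (ereal (- real k))" if "x \<in> K" for k x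
    using assms(4)[OF that] unfolding v_def by (cases "w x") (auto simp: max_def)
  have vM: "v k x \<le> M" if "x \<in> K" for k x
  proof -
    have "ereal (v k x) \<le> ereal M" unfolding v[OF that] using M that by auto
    then show ?thesis by simp
  qed
  have vdec: "v (Suc k) x \<le> v k x" if "x \<in> K" for k x
  proof -
    have "ereal (v (Suc k) x) \<le> ereal (v k x)" unfolding v[OF that] by (intro max.mono) auto
    then show ?thesis by simp
  qed
  \<comment> \<open>Each function of x under the supremum is k-Lipschitz, so q k is too. Raising k
    lowers both terms, so the sequence decreases.\<close>
  define q where "q k x = (SUP y\<in>K. v k y - real k * dist x y)" for k x
  have bdd: "bdd_above ((\<lambda>y. v k y - real k * dist x y) ` K)" for k x
    using vM by (intro bdd_aboveI2[of _ _ M]) (smt (verit) mult_nonneg_nonneg of_nat_0_le_iff zero_le_dist)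
  have upper: "v k y - real k * dist x y \<le> q k x" if "y \<in> K" for k x y
    unfolding q_def using bdd that by (rule cSUP_upper2) simp
  have "q k x \<le> q k x' + real k * dist x x'" for k x x'
    unfolding q_def[of k x]
  proof (rule cSUP_least)
    fix y assume "y \<in> K"
    then have "v k y - real k * dist x' y \<le> q k x'" by (rule upper)
    moreover have "real k * dist x' y \<le> real k * (dist x y + dist x x')"
      by (intro mult_left_mono) (metis add.commute dist_commute dist_triangle, simp)
    ultimately show "v k y - real k * dist x y \<le> q k x' + real k * dist x x'"
      by (simp add: algebra_simps)
  qed (use assms in simp)
  then have lip: "\<bar>q k x - q k x'\<bar> \<le> real k * dist x x'" for k x x'
    by (smt (verit) dist_commute)
  have "(real k)-lipschitz_on UNIV (q k)" for k
    using lip by (intro lipschitz_onI) (auto simp: dist_real_def)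
  then have cont: "continuous_on UNIV (q k)" for k
    by (rule lipschitz_on_continuous_on)
  have dec: "q (Suc k) x \<le> q k x" for k x
    unfolding q_def[of "Suc k"]
  proof (rule cSUP_least)
    fix y assume y: "y \<in> K"
    have "real k * dist x y \<le> real (Suc k) * dist x y" by (intro mult_right_mono) auto
    then show "v (Suc k) y - real (Suc k) * dist x y \<le> q k x"
      using upper[OF y, of k x] vdec[OF y, of k] by linarith
  qed (use assms in simp)
  have ge: "w x \<le> ereal (q k x)" if "x \<in> K" for k x
  proof -
    have "w x \<le> ereal (v k x)" unfolding v[OF that] by simp
    also have "\<dots> \<le> ereal (q k x)" using upper[OF that, of k x] by simp
    finally show ?thesis .
  qed
  have "(\<lambda>k. ereal (q k x)) \<longlonglongrightarrow> w x" if x: "x \<in> K" for x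
  proof (rule order_tendstoI)
    fix c assume "c < w x"
    then show "\<forall>\<^sub>F k in sequentially. c < ereal (q k x)"
      using ge[OF x] by (intro always_eventually) (auto intro: order_less_le_trans)
  next
    fix c assume "w x < c"
    then obtain d where d: "w x < ereal d" "ereal d < c" using ereal_dense2 by metis
    obtain N where N: "open N" "x \<in> N" "\<And>y. y \<in> N \<Longrightarrow> y \<in> K \<Longrightarrow> w y < ereal d"
      using assms(1) x d(1) usc_onD by metis
    obtain \<delta> where \<delta>: "\<delta> > 0" "ball x \<delta> \<subseteq> N" using N openE by metis
    \<comment> \<open>The first condition makes the penalty outside the ball at least M - d, so far
      points contribute at most d. By the second the cut-off level -k is at most d, so near points
      contribute at most d as well.\<close>
    obtain k0 :: nat where k0: "real k0 \<ge> (M - d) / \<delta>" "real k0 \<ge> - d"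
      by (metis max.bounded_iff real_arch_simple)
    have "q k x \<le> d" if "k \<ge> k0" for k
      unfolding q_def
    proof (rule cSUP_least)
      fix y assume y: "y \<in> K"
      have k: "real k \<ge> (M - d) / \<delta>" "real k \<ge> - d" using k0 that by linarith+
      show "v k y - real k * dist x y \<le> d"
      proof (cases "y \<in> ball x \<delta>")
        case True
        then have "ereal (v k y) \<le> ereal d" unfolding v[OF y] using N(3) \<delta> y k(2) by force
        then show ?thesis by (smt (verit) ereal_less_eq(3) mult_nonneg_nonneg of_nat_0_le_iff zero_le_dist)
      next
        case False
        then have "real k * \<delta> \<le> real k * dist x y" by (intro mult_left_mono) auto
        moreover have "M - d \<le> real k * \<delta>" using k(1) \<delta>(1) by (simp add: field_simps)
        ultimately show ?thesis using vM[OF y, of k] by linarith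
      qed
    qed (use assms in simp)
    then show "\<forall>\<^sub>F k in sequentially. ereal (q k x) < c"
      using d(2) by (intro eventually_sequentiallyI[of k0]) (meson ereal_less_eq(3) order_le_less_trans)
  qed
  with cont dec ge show ?thesis by (rule that)
qed

section \<open>Plurisubharmonicity by holomorphic test functions\<close>

text \<open>The integral in \<open>circle_integral\<close> as a functional of the boundary values
  alone. Despite the name it is not divided by 2 * pi.\<close>

definition circle_mean :: "(real \<Rightarrow> ereal) \<Rightarrow> ereal" where
  "circle_mean v =
     enn2ereal (\<integral>\<^sup>+\<theta>\<in>{0..2*pi}. e2ennreal (v \<theta>) \<partial>lborel) -
     enn2ereal (\<integral>\<^sup>+\<theta>\<in>{0..2*pi}. e2ennreal (- v \<theta>) \<partial>lborel)"

lemma circle_integral_eq_mean: "circle_integral u a b = circle_mean (\<lambda>\<theta>. u (along a b (cis \<theta>)))"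
  by (simp add: circle_integral_def circle_mean_def)

text \<open>The second claim provides the integrable majorant when circle means pass to a decreasing
  limit.\<close>

lemma circle_mean_continuous:
  assumes "continuous_on {0..2*pi} q"
  shows "circle_mean (\<lambda>\<theta>. ereal (q \<theta>)) = ereal (integral {0..2*pi} q)"
    and "(\<integral>\<^sup>+\<theta>\<in>{0..2*pi}. e2ennreal (ereal (q \<theta>)) \<partial>lborel) < \<infinity>"
proof -
  define f where "f = (\<lambda>\<theta>. indicator {0..2*pi} \<theta> *\<^sub>R q \<theta>)"
  have si: "set_integrable lborel {0..2*pi} q"
    using assms by (rule borel_integrable_atLeastAtMost')
  then have f: "integrable lborel f" by (simp add: set_integrable_def f_def)
  have e1: "(\<integral>\<^sup>+\<theta>\<in>{0..2*pi}. e2ennreal (ereal (q \<theta>)) \<partial>lborel) = (\<integral>\<^sup>+\<theta>. ennreal (f \<theta>) \<partial>lborel)"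
    by (intro nn_integral_cong) (auto simp: f_def indicator_def)
  have e2: "(\<integral>\<^sup>+\<theta>\<in>{0..2*pi}. e2ennreal (- ereal (q \<theta>)) \<partial>lborel) = (\<integral>\<^sup>+\<theta>. ennreal (- f \<theta>) \<partial>lborel)"
    by (intro nn_integral_cong) (auto simp: f_def indicator_def)
  have fin: "(\<integral>\<^sup>+\<theta>. ennreal (f \<theta>) \<partial>lborel) \<noteq> \<infinity>" "(\<integral>\<^sup>+\<theta>. ennreal (- f \<theta>) \<partial>lborel) \<noteq> \<infinity>"
    using f unfolding real_integrable_def by auto
  then show "(\<integral>\<^sup>+\<theta>\<in>{0..2*pi}. e2ennreal (ereal (q \<theta>)) \<partial>lborel) < \<infinity>"
    unfolding e1 by (simp add: less_top)
  obtain r s where rs: "(\<integral>\<^sup>+\<theta>. ennreal (f \<theta>) \<partial>lborel) = ennreal r" "r \<ge> 0"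
      "(\<integral>\<^sup>+\<theta>. ennreal (- f \<theta>) \<partial>lborel) = ennreal s" "s \<ge> 0"
    using fin by (metis ennreal_cases infinity_ennreal_def)
  have "circle_mean (\<lambda>\<theta>. ereal (q \<theta>)) = ereal (integral\<^sup>L lborel f)"
    unfolding circle_mean_def e1 e2 real_lebesgue_integral_def[OF f] using rs by (simp add: enn2ereal_ennreal)
  also have "integral\<^sup>L lborel f = integral {0..2*pi} q"
    using set_borel_integral_eq_integral(2)[OF si] by (simp add: f_def set_lebesgue_integral_def)
  finally show "circle_mean (\<lambda>\<theta>. ereal (q \<theta>)) = ereal (integral {0..2*pi} q)" .
qed

lemma circle_mean_mono:
  assumes "\<And>\<theta>. \<theta> \<in> {0..2*pi} \<Longrightarrow> v \<theta> \<le> v' \<theta>"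
  shows "circle_mean v \<le> circle_mean v'"
  unfolding circle_mean_def using assms
  by (intro ereal_minus_mono nn_integral_mono less_eq_ennreal.rep_eq[THEN iffD1])
     (auto simp: indicator_def intro!: e2ennreal_mono)

text \<open>Cauchy's integral formula for the value at 0. In the parametrization by
  \<open>cis\<close> one has du / u = \<i> d\<theta>, which turns it into the mean value
  property.\<close>

lemma integral_circle_holomorphic:
  assumes "continuous_on (cball 0 1) G" "G holomorphic_on ball 0 1"
  shows "((\<lambda>\<theta>. Re (G (cis \<theta>))) has_integral 2 * pi * Re (G 0)) {0..2*pi}"
proof -
  have "((\<lambda>u. G u / (u - 0)) has_contour_integral (2 * of_real pi * \<i> * G 0)) (circlepath 0 1)"
    using assms by (intro Cauchy_integral_circlepath) auto
  then have "((\<lambda>t. G (cis t) / cis t * \<i> * cis t) has_integral (2 * of_real pi * \<i> * G 0)) {0..2*pi}"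
    by (simp add: circlepath_def has_contour_integral_part_circlepath_iff)
  then have "((\<lambda>t. - \<i> * (G (cis t) / cis t * \<i> * cis t)) has_integral (- \<i> * (2 * of_real pi * \<i> * G 0))) {0..2*pi}"
    by (rule has_integral_mult_right)
  moreover have "- \<i> * (G (cis t) / cis t * \<i> * cis t) = G (cis t)" for t
    by (simp add: field_simps)
  moreover have "- \<i> * (2 * of_real pi * \<i> * G 0) = of_real (2 * pi) * G 0"
    by (simp add: field_simps)
  ultimately have "((\<lambda>t. G (cis t)) has_integral of_real (2 * pi) * G 0) {0..2*pi}"
    by (simp only:)
  from has_integral_Re[OF this] show ?thesis by simp
qed

text \<open>Real parts of polynomials have to be closed under products on the circle, and mixed
  products are the difficulty. Since \<zeta> * cnj \<zeta> = 1 there, common factors cancel until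
  only holomorphic and antiholomorphic terms remain, and an antiholomorphic term has the same real
  part as its conjugate.\<close>

lemma Re_poly_mult_cnj_poly:
  "\<exists>t. \<forall>\<zeta>\<in>sphere 0 1. Re (poly p \<zeta> * cnj (poly q \<zeta>)) = Re (poly t \<zeta>)"
proof (induction q arbitrary: p)
  case 0
  show ?case by (intro exI[of _ 0]) simp
next
  case (pCons c q)
  obtain d p' where p: "p = pCons d p'" by (cases p)
  obtain t where t: "\<And>\<zeta>. \<zeta> \<in> sphere 0 1 \<Longrightarrow> Re (poly p' \<zeta> * cnj (poly q \<zeta>)) = Re (poly t \<zeta>)"
    using pCons.IH by blast
  have "Re (poly p \<zeta> * cnj (poly (pCons c q) \<zeta>)) =
      Re (poly (smult (cnj c) p + smult (cnj d) (pCons 0 q) + t) \<zeta>)" if z: "\<zeta> \<in> sphere 0 1" for \<zeta>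
  proof -
    have 1: "\<zeta> * cnj \<zeta> = 1" using z by (simp add: complex_norm_square[symmetric])
    have "poly p \<zeta> * cnj (poly (pCons c q) \<zeta>) =
        cnj c * poly p \<zeta> + cnj (cnj d * (\<zeta> * poly q \<zeta>)) + (\<zeta> * cnj \<zeta>) * (poly p' \<zeta> * cnj (poly q \<zeta>))"
      by (simp add: p algebra_simps)
    then have "Re (poly p \<zeta> * cnj (poly (pCons c q) \<zeta>)) =
        Re (cnj c * poly p \<zeta>) + Re (cnj d * (\<zeta> * poly q \<zeta>)) + Re (poly p' \<zeta> * cnj (poly q \<zeta>))"
      unfolding 1 by (metis complex_cnj complex_eq_iff mult_1 plus_complex.sel(1) cnj.sel(1))
    with t[OF z] show ?thesis by (simp add: algebra_simps)
  qed
  then show ?case by blast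
qed

text \<open>Stone-Weierstrass for trigonometric polynomials, written as real parts of polynomials so
  that each approximant comes with a holomorphic extension to the disc.\<close>

lemma circle_Re_poly_approx:
  fixes f :: "complex \<Rightarrow> real"
  assumes "continuous_on (sphere 0 1) f" "0 < e"
  obtains p where "\<And>\<zeta>. \<zeta> \<in> sphere 0 1 \<Longrightarrow> \<bar>f \<zeta> - Re (poly p \<zeta>)\<bar> < e"
proof -
  define P where "P g \<longleftrightarrow> (\<exists>p. \<forall>\<zeta>\<in>sphere 0 1. g \<zeta> = Re (poly p \<zeta>))" for g :: "complex \<Rightarrow> real"
  have "\<exists>g. P g \<and> (\<forall>x \<in> sphere 0 1. \<bar>f x - g x\<bar> < e)"
  proof (rule Stone_Weierstrass_HOL)
    show "compact (sphere (0::complex) 1)" by simp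
    show "P (\<lambda>x. c)" for c
      unfolding P_def by (intro exI[of _ "[:of_real c:]"]) simp
    show "continuous_on (sphere 0 1) g" if "P g" for g
    proof -
      from that obtain p where "\<And>\<zeta>. \<zeta> \<in> sphere 0 1 \<Longrightarrow> g \<zeta> = Re (poly p \<zeta>)"
        unfolding P_def by blast
      moreover have "continuous_on (sphere 0 1) (\<lambda>\<zeta>. Re (poly p \<zeta>))"
        by (intro continuous_intros)
      ultimately show ?thesis by (metis (no_types, lifting) continuous_on_cong)
    qed
    show "P (\<lambda>x. f x + g x)" if "P f \<and> P g" for f g
    proof -
      from that obtain p q where "\<And>\<zeta>. \<zeta> \<in> sphere 0 1 \<Longrightarrow> f \<zeta> = Re (poly p \<zeta>)"
        "\<And>\<zeta>. \<zeta> \<in> sphere 0 1 \<Longrightarrow> g \<zeta> = Re (poly q \<zeta>)" unfolding P_def by blast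
      then show ?thesis unfolding P_def by (intro exI[of _ "p + q"]) simp
    qed
    show "P (\<lambda>x. f x * g x)" if "P f \<and> P g" for f g
    proof -
      from that obtain p q where pq: "\<And>\<zeta>. \<zeta> \<in> sphere 0 1 \<Longrightarrow> f \<zeta> = Re (poly p \<zeta>)"
        "\<And>\<zeta>. \<zeta> \<in> sphere 0 1 \<Longrightarrow> g \<zeta> = Re (poly q \<zeta>)" unfolding P_def by blast
      obtain t where t: "\<And>\<zeta>. \<zeta> \<in> sphere 0 1 \<Longrightarrow> Re (poly p \<zeta> * cnj (poly q \<zeta>)) = Re (poly t \<zeta>)"
        using Re_poly_mult_cnj_poly by metis
      \<comment> \<open>Re a * Re b is half the real part of a * b + a * cnj b.\<close>
      have "f \<zeta> * g \<zeta> = Re (poly (smult (1/2) (p * q + t)) \<zeta>)" if "\<zeta> \<in> sphere 0 1" for \<zeta>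
        using pq[OF that] t[OF that] by simp
      then show ?thesis unfolding P_def by blast
    qed
    show "\<exists>f. P f \<and> f x \<noteq> f y" if "x \<in> sphere 0 1 \<and> y \<in> sphere 0 1 \<and> x \<noteq> y" for x y
    proof (cases "Re x = Re y")
      case False
      then show ?thesis unfolding P_def
        by (intro exI[of _ Re] conjI exI[of _ "[:0, 1:]"]) auto
    next
      case True
      then have "Im x \<noteq> Im y" using that complex_eq_iff by blast
      then show ?thesis unfolding P_def
        by (intro exI[of _ Im] conjI exI[of _ "[:0, - \<i>:]"]) auto
    qed
  qed (use assms in auto)
  then obtain g where "P g" "\<forall>x \<in> sphere 0 1. \<bar>f x - g x\<bar> < e" by blast
  then show ?thesis using that unfolding P_def by metis
qed

text \<open>Positive parts converge by dominated convergence with majorant \<open>q 0\<close>,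
  negative parts by monotone convergence. The limit of the negative parts may be infinite, but that
  of the positive parts is finite, so the difference converges.\<close>

lemma circle_mean_decreasing_limit:
  assumes q: "\<And>k::nat. continuous_on UNIV (q k)" "\<And>k \<theta>. q (Suc k) \<theta> \<le> q k \<theta>"
    and lim: "\<And>\<theta>. (\<lambda>k. ereal (q k \<theta>)) \<longlonglongrightarrow> v \<theta>"
  shows "(\<lambda>k. circle_mean (\<lambda>\<theta>. ereal (q k \<theta>))) \<longlonglongrightarrow> circle_mean v"
proof -
  define I where "I = {0..2*pi}"
  define f where "f k \<theta> = e2ennreal (ereal (q k \<theta>)) * indicator I \<theta>" for k \<theta>
  define g where "g k \<theta> = e2ennreal (- ereal (q k \<theta>)) * indicator I \<theta>" for k \<theta>
  have meas: "q k \<in> borel_measurable lborel" for k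
    using q(1)[of k] by (simp add: borel_measurable_continuous_onI)
  have mf: "f k \<in> borel_measurable lborel" and mg: "g k \<in> borel_measurable lborel" for k
    unfolding f_def g_def I_def using meas[of k] by (simp_all, measurable)
  have antimono: "q k \<theta> \<le> q 0 \<theta>" for k \<theta>
    by (induction k) (auto intro: order_trans[OF q(2)])
  have limf: "(\<lambda>k. f k \<theta>) \<longlonglongrightarrow> e2ennreal (v \<theta>) * indicator I \<theta>" for \<theta>
    unfolding f_def using continuous_on_tendsto_compose[OF continuous_on_e2ennreal[of UNIV] lim[of \<theta>]]
    by (cases "\<theta> \<in> I") auto
  have limg: "(\<lambda>k. g k \<theta>) \<longlonglongrightarrow> e2ennreal (- v \<theta>) * indicator I \<theta>" for \<theta>
    unfolding g_def using continuous_on_tendsto_compose[OF continuous_on_e2ennreal[of UNIV] tendsto_uminus_ereal[OF lim[of \<theta>]]]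
    by (cases "\<theta> \<in> I") auto
  have fin: "(\<integral>\<^sup>+\<theta>. f 0 \<theta> \<partial>lborel) < \<infinity>"
    using circle_mean_continuous(2)[of "q 0"] q(1)[of 0] continuous_on_subset
    unfolding f_def I_def by blast
  have le: "f k \<theta> \<le> f 0 \<theta>" for k \<theta>
    unfolding f_def using antimono by (intro mult_right_mono e2ennreal_mono) auto
  have meas_lim: "(\<lambda>\<theta>. e2ennreal (v \<theta>) * indicator I \<theta>) \<in> borel_measurable lborel"
    by (rule borel_measurable_LIMSEQ_order[OF limf mf])
  have cf: "(\<lambda>k. \<integral>\<^sup>+\<theta>. f k \<theta> \<partial>lborel) \<longlonglongrightarrow> (\<integral>\<^sup>+\<theta>. e2ennreal (v \<theta>) * indicator I \<theta> \<partial>lborel)"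
    using le limf fin by (intro nn_integral_dominated_convergence[where w = "f 0"] mf meas_lim) auto
  have "incseq g"
    unfolding g_def by (intro incseq_SucI le_funI mult_right_mono e2ennreal_mono) (use q(2) in auto)
  then have cg: "(\<lambda>k. \<integral>\<^sup>+\<theta>. g k \<theta> \<partial>lborel) \<longlonglongrightarrow> (\<integral>\<^sup>+\<theta>. e2ennreal (- v \<theta>) * indicator I \<theta> \<partial>lborel)"
    by (intro nn_integral_LIMSEQ mg limg)
  have "(\<integral>\<^sup>+\<theta>. e2ennreal (v \<theta>) * indicator I \<theta> \<partial>lborel) \<le> (\<integral>\<^sup>+\<theta>. f 0 \<theta> \<partial>lborel)"
    by (rule LIMSEQ_le_const2[OF cf]) (auto intro: nn_integral_mono le)
  then have "(\<integral>\<^sup>+\<theta>. e2ennreal (v \<theta>) * indicator I \<theta> \<partial>lborel) \<noteq> \<infinity>"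
    using fin by (metis infinity_ennreal_def linorder_not_le top.not_eq_extremum)
  then have "enn2ereal (\<integral>\<^sup>+\<theta>. e2ennreal (v \<theta>) * indicator I \<theta> \<partial>lborel) \<noteq> \<infinity>"
    by (metis e2ennreal_enn2ereal e2ennreal_infty infinity_ennreal_def)
  moreover have "enn2ereal (\<integral>\<^sup>+\<theta>. e2ennreal (v \<theta>) * indicator I \<theta> \<partial>lborel) \<noteq> - \<infinity>"
    by (metis enn2ereal_nonneg ereal_infty_less_eq(2) MInfty_neq_ereal(1) zero_ereal_def)
  ultimately show ?thesis
    unfolding circle_mean_def I_def[symmetric] f_def[symmetric] g_def[symmetric]
    using cf cg by (intro tendsto_diff_ereal_general) auto
qed

text \<open>The sub-mean-value inequality at 0, phrased through harmonic majorants instead of an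
  integral. It makes sense without measurability of w, and only the values on the unit circle and at
  0 enter.\<close>

definition disc_test :: "(complex \<Rightarrow> ereal) \<Rightarrow> bool" where
  "disc_test w \<longleftrightarrow> (\<forall>G. continuous_on (cball 0 1) G \<longrightarrow> G holomorphic_on ball 0 1 \<longrightarrow>
     (\<forall>\<zeta>\<in>sphere 0 1. w \<zeta> \<le> ereal (Re (G \<zeta>))) \<longrightarrow> w 0 \<le> ereal (Re (G 0)))"

lemma disc_testD:
  assumes "disc_test w" "continuous_on (cball 0 1) G" "G holomorphic_on ball 0 1"
    "\<And>\<zeta>. \<zeta> \<in> sphere 0 1 \<Longrightarrow> w \<zeta> \<le> ereal (Re (G \<zeta>))"
  shows "w 0 \<le> ereal (Re (G 0))"
  using assms unfolding disc_test_def by blast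

lemma disc_test_poly:
  assumes "disc_test w" "\<And>\<zeta>. \<zeta> \<in> sphere 0 1 \<Longrightarrow> w \<zeta> \<le> ereal (Re (poly p \<zeta>))"
  shows "w 0 \<le> ereal (Re (poly p 0))"
  using assms(2) by (intro disc_testD[OF assms(1)] continuous_intros holomorphic_intros) auto

lemma disc_test_if_mean:
  assumes "ereal (2 * pi) * w 0 \<le> circle_mean (\<lambda>\<theta>. w (cis \<theta>))"
  shows "disc_test w"
  unfolding disc_test_def
proof (intro allI impI)
  fix G assume G: "continuous_on (cball 0 1) G" "G holomorphic_on ball 0 1"
    "\<forall>\<zeta>\<in>sphere 0 1. w \<zeta> \<le> ereal (Re (G \<zeta>))"
  have cont: "continuous_on {0..2*pi} (\<lambda>\<theta>. Re (G (cis \<theta>)))"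
    by (intro continuous_intros continuous_on_compose2[OF G(1)]) auto
  have "ereal (2 * pi) * w 0 \<le> circle_mean (\<lambda>\<theta>. ereal (Re (G (cis \<theta>))))"
    using G(3) by (intro order_trans[OF assms] circle_mean_mono) auto
  also have "\<dots> = ereal (2 * pi * Re (G 0))"
    using circle_mean_continuous(1)[OF cont] integral_unique[OF integral_circle_holomorphic[OF G(1,2)]] by simp
  finally show "w 0 \<le> ereal (Re (G 0))"
    by (cases "w 0") auto
qed

text \<open>On the circle w is a decreasing limit of continuous functions, each of which lies just
  below the real part of a polynomial, and the value of that at 0 is its mean.\<close>

lemma mean_if_poly_test:
  assumes usc: "usc_on (sphere 0 1) w" "\<And>\<zeta>. \<zeta> \<in> sphere 0 1 \<Longrightarrow> w \<zeta> \<noteq> \<infinity>"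
    and test: "\<And>p. (\<And>\<zeta>. \<zeta> \<in> sphere 0 1 \<Longrightarrow> w \<zeta> \<le> ereal (Re (poly p \<zeta>))) \<Longrightarrow> w0 \<le> ereal (Re (poly p 0))"
  shows "ereal (2 * pi) * w0 \<le> circle_mean (\<lambda>\<theta>. w (cis \<theta>))"
proof -
  obtain q :: "nat \<Rightarrow> complex \<Rightarrow> real" where q:
    "\<And>k. continuous_on UNIV (q k)" "\<And>k x. q (Suc k) x \<le> q k x"
    "\<And>k x. x \<in> sphere 0 1 \<Longrightarrow> w x \<le> ereal (q k x)"
    "\<And>x. x \<in> sphere 0 1 \<Longrightarrow> (\<lambda>k. ereal (q k x)) \<longlonglongrightarrow> w x"
    using usc_on_continuous_approx[OF usc(1) compact_sphere _ usc(2)] by auto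
  have cc: "continuous_on UNIV (\<lambda>\<theta>. q k (cis \<theta>))" for k
    by (intro continuous_on_compose2[OF q(1)] continuous_intros) auto
  have bound: "ereal (2 * pi) * w0 \<le> circle_mean (\<lambda>\<theta>. ereal (q k (cis \<theta>))) + ereal (4 * pi / (real k + 1))" for k
  proof -
    define e where "e = 1 / (real k + 1)"
    have e: "e > 0" by (simp add: e_def)
    \<comment> \<open>Approximating q k + e within e gives a majorant: q k \<le> Re p \<le> q k + 2
      * e. Integrated over the circle, the excess is at most 4 * pi * e, the error term of the
      bound.\<close>
    have "continuous_on (sphere 0 1) (\<lambda>x. q k x + e)"
      by (intro continuous_intros continuous_on_subset[OF q(1)]) auto
    then obtain p where p: "\<And>\<zeta>. \<zeta> \<in> sphere 0 1 \<Longrightarrow> \<bar>q k \<zeta> + e - Re (poly p \<zeta>)\<bar> < e"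
      using circle_Re_poly_approx e by metis
    have p': "q k \<zeta> \<le> Re (poly p \<zeta>)" "Re (poly p \<zeta>) \<le> q k \<zeta> + 2 * e" if "\<zeta> \<in> sphere 0 1" for \<zeta>
      using p[OF that] by linarith+
    have "w0 \<le> ereal (Re (poly p 0))"
      using q(3)[of _ k] p'(1) by (intro test) (meson ereal_less_eq(3) order_trans)
    moreover have "2 * pi * Re (poly p 0) \<le> integral {0..2*pi} (\<lambda>\<theta>. q k (cis \<theta>)) + 4 * pi * e"
    proof -
      have i1: "((\<lambda>\<theta>. Re (poly p (cis \<theta>))) has_integral 2 * pi * Re (poly p 0)) {0..2*pi}"
        by (intro integral_circle_holomorphic continuous_intros holomorphic_intros)
      have "((\<lambda>\<theta>. q k (cis \<theta>)) has_integral integral {0..2*pi} (\<lambda>\<theta>. q k (cis \<theta>))) {0..2*pi}"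
        using cc[of k] by (intro integrable_integral integrable_continuous_interval) (rule continuous_on_subset, auto)
      moreover have "((\<lambda>\<theta>. 2 * e) has_integral (2*pi - 0) *\<^sub>R (2 * e)) {0..2*pi}"
        using has_integral_const_real[of "2 * e" 0 "2*pi"] by simp
      ultimately have i2: "((\<lambda>\<theta>. q k (cis \<theta>) + 2 * e) has_integral
          integral {0..2*pi} (\<lambda>\<theta>. q k (cis \<theta>)) + (2*pi - 0) *\<^sub>R (2 * e)) {0..2*pi}"
        by (rule has_integral_add)
      have "2 * pi * Re (poly p 0) \<le> integral {0..2*pi} (\<lambda>\<theta>. q k (cis \<theta>)) + (2*pi - 0) *\<^sub>R (2 * e)"
        using p'(2) by (intro has_integral_le[OF i1 i2]) auto
      then show ?thesis by simp
    qed
    moreover have "circle_mean (\<lambda>\<theta>. ereal (q k (cis \<theta>))) = ereal (integral {0..2*pi} (\<lambda>\<theta>. q k (cis \<theta>)))"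
      using cc[of k] by (intro circle_mean_continuous(1)) (rule continuous_on_subset, auto)
    ultimately show ?thesis
      unfolding e_def by (cases w0) (auto intro: order_trans[OF mult_left_mono[where c = "2 * pi"]])
  qed
  have "(\<lambda>k. circle_mean (\<lambda>\<theta>. ereal (q k (cis \<theta>)))) \<longlonglongrightarrow> circle_mean (\<lambda>\<theta>. w (cis \<theta>))"
    by (intro circle_mean_decreasing_limit cc q(2) q(4)) auto
  moreover have "(\<lambda>k. ereal (4 * pi / (real k + 1))) \<longlonglongrightarrow> ereal 0"
    using tendsto_mult_right_zero[OF LIMSEQ_inverse_real_of_nat, of "4 * pi"]
    by (simp add: divide_inverse add.commute)
  ultimately have "(\<lambda>k. circle_mean (\<lambda>\<theta>. ereal (q k (cis \<theta>))) + ereal (4 * pi / (real k + 1)))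
      \<longlonglongrightarrow> circle_mean (\<lambda>\<theta>. w (cis \<theta>)) + ereal 0"
    by (intro tendsto_add_ereal_general) auto
  then show ?thesis
    using bound by (intro LIMSEQ_le_const) auto
qed

lemma continuous_on_along: "continuous_on UNIV (\<lambda>p. along (fst p) b (snd p))"
  unfolding along_def
  by (intro continuous_on_coordinatewise_then_product continuous_intros
      continuous_on_product_then_coordinatewise[OF continuous_on_fst[OF continuous_on_id]])

lemma continuous_on_along_disc: "continuous_on S (along a b)"
  unfolding along_def by (intro continuous_on_coordinatewise_then_product continuous_intros)

lemma along_0 [simp]: "along a b 0 = a"
  by (simp add: along_def)

text \<open>Later arguments about psh functions use this form instead of circle integrals.
  Semicontinuity and finiteness stay as separate conditions, because recovering the integral
  inequality requires approximating u from above by continuous functions.\<close>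

lemma psh_on_iff:
  "psh_on n S u \<longleftrightarrow> (\<forall>a\<in>S. u a \<noteq> \<infinity>) \<and> usc_on S u \<and>
     (\<forall>a\<in>S. \<forall>b\<in>Cn n. along a b ` cball 0 1 \<subseteq> S \<longrightarrow> disc_test (\<lambda>\<zeta>. u (along a b \<zeta>)))"
proof -
  have disc: "(\<forall>\<zeta>. cmod \<zeta> \<le> 1 \<longrightarrow> along a b \<zeta> \<in> S) \<longleftrightarrow> along a b ` cball 0 1 \<subseteq> S" for a b
    by auto
  have "ereal (2 * pi) * u a \<le> circle_integral u a b \<longleftrightarrow> disc_test (\<lambda>\<zeta>. u (along a b \<zeta>))"
    if "usc_on S u" "\<forall>a\<in>S. u a \<noteq> \<infinity>" "along a b ` cball 0 1 \<subseteq> S" for a b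
  proof
    assume "ereal (2 * pi) * u a \<le> circle_integral u a b"
    then show "disc_test (\<lambda>\<zeta>. u (along a b \<zeta>))"
      by (intro disc_test_if_mean) (simp add: circle_integral_eq_mean)
  next
    assume t: "disc_test (\<lambda>\<zeta>. u (along a b \<zeta>))"
    have sub: "along a b ` sphere 0 1 \<subseteq> S" using that(3) by auto
    then have "usc_on (sphere 0 1) (\<lambda>\<zeta>. u (along a b \<zeta>))"
      by (intro usc_on_compose[OF that(1)] continuous_on_along_disc)
    moreover have "u (along a b \<zeta>) \<noteq> \<infinity>" if "\<zeta> \<in> sphere 0 1" for \<zeta>
      using sub that \<open>\<forall>a\<in>S. u a \<noteq> \<infinity>\<close> by blast
    ultimately show "ereal (2 * pi) * u a \<le> circle_integral u a b"
      unfolding circle_integral_eq_mean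
      using disc_test_poly[OF t] by (intro mean_if_poly_test) auto
  qed
  then show ?thesis
    unfolding psh_on_def usc_on_iff_openin[symmetric] disc by blast
qed

lemma psh_onI:
  assumes "\<And>a. a \<in> S \<Longrightarrow> u a \<noteq> \<infinity>" "usc_on S u"
    "\<And>a b. a \<in> S \<Longrightarrow> b \<in> Cn n \<Longrightarrow> along a b ` cball 0 1 \<subseteq> S \<Longrightarrow> disc_test (\<lambda>\<zeta>. u (along a b \<zeta>))"
  shows "psh_on n S u"
  using assms unfolding psh_on_iff by blast

lemma psh_onD:
  assumes "psh_on n S u"
  shows "a \<in> S \<Longrightarrow> u a \<noteq> \<infinity>" "usc_on S u"
    "a \<in> S \<Longrightarrow> b \<in> Cn n \<Longrightarrow> along a b ` cball 0 1 \<subseteq> S \<Longrightarrow> disc_test (\<lambda>\<zeta>. u (along a b \<zeta>))"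
  using assms unfolding psh_on_iff by blast+

section \<open>Kiselman's minimum principle for radial functions\<close>

text \<open>A majorant Re G of the sum yields the majorant Re (G - F) of w.\<close>

lemma disc_test_add_Re:
  assumes "disc_test w" "continuous_on (cball 0 1) F" "F holomorphic_on ball 0 1"
  shows "disc_test (\<lambda>\<zeta>. w \<zeta> + ereal (Re (F \<zeta>)))"
  unfolding disc_test_def
proof (intro allI impI)
  fix G assume G: "continuous_on (cball 0 1) G" "G holomorphic_on ball 0 1"
    "\<forall>\<zeta>\<in>sphere 0 1. w \<zeta> + ereal (Re (F \<zeta>)) \<le> ereal (Re (G \<zeta>))"
  have "w 0 \<le> ereal (Re (G 0 - F 0))"
  proof (rule disc_testD[OF assms(1)])
    show "w \<zeta> \<le> ereal (Re (G \<zeta> - F \<zeta>))" if "\<zeta> \<in> sphere 0 1" for \<zeta>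
      using G(3) that by (cases "w \<zeta>") force+
  qed (intro continuous_intros holomorphic_intros assms G)+
  then show "w 0 + ereal (Re (F 0)) \<le> ereal (Re (G 0))"
    by (cases "w 0") auto
qed

text \<open>A majorant of the supremum is a majorant of every member. This is the advantage over
  circle integrals, where the supremum would first have to be regularized.\<close>

lemma disc_test_SUP:
  assumes "\<And>i. i \<in> I \<Longrightarrow> disc_test (w i)"
  shows "disc_test (\<lambda>\<zeta>. SUP i\<in>I. w i \<zeta>)"
  unfolding disc_test_def
proof (intro allI impI SUP_least)
  fix G i assume G: "continuous_on (cball 0 1) G" "G holomorphic_on ball 0 1"
    "\<forall>\<zeta>\<in>sphere 0 1. (SUP i\<in>I. w i \<zeta>) \<le> ereal (Re (G \<zeta>))" and i: "i \<in> I"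
  then show "w i 0 \<le> ereal (Re (G 0))"
    by (intro disc_testD[OF assms[OF i] G(1,2)]) (auto simp: SUP_le_iff)
qed

text \<open>The slices of a psh function of (z, \<zeta>) on the product of the plane and the closed
  unit disc. The test concerns affine discs in both variables, of which only the \<zeta>-component
  has to stay in the disc.\<close>

locale subharmonic_family =
  fixes U :: "complex \<Rightarrow> complex \<Rightarrow> ereal"
  assumes usc: "usc_on (UNIV \<times> cball 0 1) (\<lambda>p. U (fst p) (snd p))"
    and finite_above: "\<zeta> \<in> cball 0 1 \<Longrightarrow> U z \<zeta> \<noteq> \<infinity>"
    and test: "(\<And>\<tau>. \<tau> \<in> cball 0 1 \<Longrightarrow> \<zeta> + \<tau> * e \<in> cball 0 1) \<Longrightarrow>
      disc_test (\<lambda>\<tau>. U (z + \<tau> * v) (\<zeta> + \<tau> * e))"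
begin

text \<open>
  Subharmonicity along curves follows from subharmonicity along affine discs by a penalization: at a
  maximum of \<open>U z \<zeta> - Re (G \<zeta>) + c * \<bar>\<zeta>\<bar>\<^sup>2 - K * \<bar>z - E \<zeta>\<bar>\<^sup>2\<close>, the inequality for small affine discs in the
  direction of the curve is violated, since the penalty term is pluriharmonic up to \<open>o(r\<^sup>2)\<close> there.
\<close>

lemma curve_test:
  assumes E: "E holomorphic_on UNIV"
    and G: "continuous_on (cball 0 1) G" "G holomorphic_on ball 0 1"
    and bd: "\<And>\<zeta>. \<zeta> \<in> sphere 0 1 \<Longrightarrow> U (E \<zeta>) \<zeta> \<le> ereal (Re (G \<zeta>))"
  shows "U (E 0) 0 \<le> ereal (Re (G 0))"
proof (rule ccontr)
  assume "\<not> ?thesis"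
  then obtain A where A: "U (E 0) 0 = ereal A" "A > Re (G 0)"
    using finite_above[of 0 "E 0"] by (cases "U (E 0) 0") auto
  \<comment> \<open>Half of the assumed excess at 0. The term c * (|\<zeta>|^2 - 1) costs exactly c
    there, so the penalized function P still has the value c.\<close>
  define c where "c = (A - Re (G 0)) / 2"
  have c: "c > 0" using A by (simp add: c_def)
  have contE: "continuous_on S E" for S
    using E holomorphic_on_imp_continuous_on holomorphic_on_subset by blast
  have "bounded (E ` cball 0 1)"
    by (intro compact_imp_bounded compact_continuous_image contE) simp
  then obtain R0 where R0: "\<And>\<zeta>. \<zeta> \<in> cball 0 1 \<Longrightarrow> cmod (E \<zeta>) \<le> R0"
    unfolding bounded_iff by blast
  define R where "R = R0 + 1"
  define W where "W p = U (fst p) (snd p) + ereal (- Re (G (snd p)))" for p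
  have uscW: "usc_on (UNIV \<times> cball 0 1) W"
    unfolding W_def
    by (intro usc_on_add_continuous usc continuous_intros continuous_on_compose2[OF G(1)]) auto
  have Wfin: "W p \<noteq> \<infinity>" if "p \<in> UNIV \<times> cball 0 1" for p
    using finite_above[of "snd p" "fst p"] that by (cases "U (fst p) (snd p)") (auto simp: W_def)
  define K where "K = (cball 0 R \<times> cball 0 1 :: (complex \<times> complex) set)"
  have K: "compact K" "K \<subseteq> UNIV \<times> cball 0 1"
    by (auto simp: K_def intro: compact_Times)
  obtain M where M: "\<And>p. p \<in> K \<Longrightarrow> W p \<le> ereal M"
    using usc_on_bounded_above[OF usc_on_subset[OF uscW K(2)] K(1)] Wfin K(2) by (metis subsetD)
  \<comment> \<open>Over the boundary circle W is at most 0 on the curve, hence below c in a uniform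
    neighborhood of it.\<close>
  obtain N where N: "open N" "0 \<in> N"
    "\<And>x \<zeta>. x \<in> N \<Longrightarrow> x \<in> UNIV \<Longrightarrow> \<zeta> \<in> sphere 0 1 \<Longrightarrow> W (E (snd (x, \<zeta>)) + fst (x, \<zeta>), snd (x, \<zeta>)) < ereal c"
  proof (rule usc_on_tube)
    show "usc_on (UNIV \<times> sphere 0 1) (\<lambda>p. W (E (snd p) + fst p, snd p))"
      by (intro usc_on_compose[OF uscW] continuous_intros continuous_on_compose2[OF contE]) auto
    show "W (E (snd (0, \<zeta>)) + fst (0, \<zeta>), snd (0, \<zeta>)) < ereal c" if "\<zeta> \<in> sphere 0 1" for \<zeta>
      using bd[OF that] c by (cases "U (E \<zeta>) \<zeta>") (auto simp: W_def)
  qed auto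
  obtain \<delta>0 where "\<delta>0 > 0" "ball 0 \<delta>0 \<subseteq> N" using N(1,2) openE by metis
  define \<delta> where "\<delta> = min \<delta>0 1"
  have \<delta>: "0 < \<delta>" "\<delta> \<le> 1" "ball 0 \<delta> \<subseteq> N"
    using \<open>\<delta>0 > 0\<close> \<open>ball 0 \<delta>0 \<subseteq> N\<close> by (auto simp: \<delta>_def)
  \<comment> \<open>At distance \<delta> from the curve the penalty exceeds the upper bound M of W,
    so a maximum with value at least c lies closer to the curve.\<close>
  define k where "k = (\<bar>M\<bar> + 1) / \<delta>\<^sup>2"
  have k: "k > 0" "k * \<delta>\<^sup>2 = \<bar>M\<bar> + 1" using \<delta>(1) by (auto simp: k_def)
  define P where "P p = W p + ereal (c * ((cmod (snd p))\<^sup>2 - 1) - k * (cmod (fst p - E (snd p)))\<^sup>2)" for p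
  have "usc_on K P"
    unfolding P_def
    by (intro usc_on_add_continuous usc_on_subset[OF uscW K(2)] continuous_intros
        continuous_on_compose2[OF contE[of UNIV]]) auto
  moreover have K0: "(E 0, 0) \<in> K" using R0[of 0] by (simp add: K_def R_def)
  ultimately obtain q where q: "q \<in> K" "\<And>p. p \<in> K \<Longrightarrow> P p \<le> P q"
    using usc_on_attains_sup[OF _ K(1), of P] by (metis empty_iff)
  define z where "z = fst q"
  define \<zeta> where "\<zeta> = snd q"
  have qz: "q = (z, \<zeta>)" by (simp add: z_def \<zeta>_def)
  have z\<zeta>: "cmod z \<le> R" "cmod \<zeta> \<le> 1" using q(1) by (auto simp: qz K_def)
  have "P (E 0, 0) = ereal c" using A(1) by (simp add: P_def W_def c_def field_simps)
  then have Pq: "ereal c \<le> P q" using q(2)[OF K0] by simp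
  then obtain u where u: "U z \<zeta> = ereal u"
    using finite_above[of \<zeta> z] z\<zeta>(2) by (cases "U z \<zeta>") (auto simp: P_def W_def qz)
  have Wq: "W q = ereal (u - Re (G \<zeta>))" using u by (simp add: W_def qz)
  have Pq': "c \<le> u - Re (G \<zeta>) + (c * ((cmod \<zeta>)\<^sup>2 - 1) - k * (cmod (z - E \<zeta>))\<^sup>2)"
    using Pq unfolding P_def Wq by (simp add: qz)
  have c\<zeta>: "c * ((cmod \<zeta>)\<^sup>2 - 1) \<le> 0"
    using c z\<zeta>(2) by (intro mult_nonneg_nonpos) (auto simp: power_le_one)
  have d\<delta>: "cmod (z - E \<zeta>) < \<delta>"
  proof (rule ccontr)
    assume "\<not> cmod (z - E \<zeta>) < \<delta>"
    then have "k * \<delta>\<^sup>2 \<le> k * (cmod (z - E \<zeta>))\<^sup>2"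
      using k(1) \<delta>(1) by (intro mult_left_mono power_mono) auto
    moreover have "u - Re (G \<zeta>) \<le> M" using M[OF q(1)] unfolding Wq by simp
    ultimately show False using Pq' c\<zeta> c k(2) by linarith
  qed
  have \<zeta>1: "cmod \<zeta> < 1"
  proof (rule ccontr)
    assume "\<not> cmod \<zeta> < 1"
    then have s: "\<zeta> \<in> sphere 0 1" using z\<zeta>(2) by auto
    have "z - E \<zeta> \<in> N" using d\<delta> \<delta>(3) by auto
    then have "W q < ereal c" using N(3)[OF _ _ s, of "z - E \<zeta>"] by (simp add: qz)
    then have "u - Re (G \<zeta>) < c" unfolding Wq by simp
    moreover have "0 \<le> k * (cmod (z - E \<zeta>))\<^sup>2" using k by simp
    ultimately show False using Pq' c\<zeta> by linarith
  qed
  have zR: "cmod z < R"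
  proof -
    have "cmod z \<le> cmod (E \<zeta>) + cmod (z - E \<zeta>)" by norm
    then show ?thesis using R0[of \<zeta>] z\<zeta>(2) d\<delta> \<delta>(2) by (auto simp: R_def)
  qed
  define v where "v = deriv E \<zeta>"
  define Rm where "Rm t = E (\<zeta> + t) - E \<zeta> - v * t" for t
  \<comment> \<open>The remainder of E then contributes at most k * \<eta>^2 * r^2 = (c / 2) * r^2,
    half of the gain c * r^2 from |\<zeta>|^2.\<close>
  define \<eta> where "\<eta> = sqrt (c / (2 * k))"
  have \<eta>: "\<eta> > 0" "k * \<eta>\<^sup>2 = c / 2" using c k(1) by (auto simp: \<eta>_def)
  have "(E has_field_derivative v) (at \<zeta>)"
    unfolding v_def using E by (simp add: holomorphic_derivI[of E UNIV])
  then obtain d0 where d0: "d0 > 0" "\<And>y. cmod (y - \<zeta>) < d0 \<Longrightarrow> cmod (E y - E \<zeta> - v * (y - \<zeta>)) \<le> \<eta> * cmod (y - \<zeta>)"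
    using \<eta>(1) unfolding has_field_derivative_def has_derivative_at_alt by metis
  \<comment> \<open>Keeps the disc within the range of the derivative estimate, its
    \<zeta>-component in the unit disc and its z-component in the ball of radius R.\<close>
  define r where "r = min (d0 / 2) (min ((1 - cmod \<zeta>) / 2) ((R - cmod z) / (2 * (cmod v + 1))))"
  have v1: "cmod v + 1 > 0" by (simp add: add_nonneg_pos)
  have r: "r > 0" "r < d0" "r < 1 - cmod \<zeta>" "r * (cmod v + 1) \<le> R - cmod z"
  proof -
    show "r > 0" using d0(1) \<zeta>1 zR v1 by (simp add: r_def)
    show "r < d0" using d0(1) by (auto simp: r_def)
    show "r < 1 - cmod \<zeta>" using \<zeta>1 by (auto simp: r_def min_less_iff_disj)
    have "r * (cmod v + 1) \<le> (R - cmod z) / (2 * (cmod v + 1)) * (cmod v + 1)"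
      using v1 by (intro mult_right_mono) (auto simp: r_def)
    also have "\<dots> = (R - cmod z) / 2"
    proof -
      have "x / (2 * y) * y = x / 2" if "y > 0" for x y :: real using that by simp
      then show ?thesis using v1 by blast
    qed
    also have "\<dots> \<le> R - cmod z" using zR by simp
    finally show "r * (cmod v + 1) \<le> R - cmod z" .
  qed
  define d where "d = z - E \<zeta>"
  \<comment> \<open>The inequality P \<le> P q, expanded around q. The cross terms of both squares
    are real parts of holomorphic functions of \<tau>; what remains of the squares is r^2 and |Rm|^2
    \<le> \<eta>^2 * r^2. At \<tau> = 0 this leaves u - (c / 2) * r^2, which is below u: the
    contradiction.\<close>
  define H where "H \<tau> = of_real u + (G (\<zeta> + \<tau> * of_real r) - G \<zeta>) - of_real (2 * c * r) * cnj \<zeta> * \<tau>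
      - of_real (2 * k) * cnj d * Rm (\<tau> * of_real r) + of_real (k * \<eta>\<^sup>2 * r\<^sup>2 - c * r\<^sup>2)" for \<tau>
  have in_ball: "\<zeta> + \<tau> * of_real r \<in> ball 0 1" if "\<tau> \<in> cball 0 1" for \<tau>
  proof -
    have "cmod (\<zeta> + \<tau> * of_real r) \<le> cmod \<zeta> + cmod \<tau> * r"
      using r(1) norm_triangle_ineq[of \<zeta> "\<tau> * of_real r"] by (simp add: norm_mult)
    also have "\<dots> \<le> cmod \<zeta> + 1 * r" using that r(1) by (intro add_mono mult_right_mono) auto
    finally show ?thesis using r(3) by simp
  qed
  have in_R: "z + \<tau> * (of_real r * v) \<in> cball 0 R" if "\<tau> \<in> cball 0 1" for \<tau>
  proof -
    have "cmod (z + \<tau> * (of_real r * v)) \<le> cmod z + cmod \<tau> * (r * cmod v)"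
      using r(1) norm_triangle_ineq[of z "\<tau> * (of_real r * v)"] by (simp add: norm_mult)
    also have "\<dots> \<le> cmod z + 1 * (r * cmod v)" using that r(1) by (intro add_mono mult_right_mono) auto
    also have "\<dots> \<le> R" using r(1,4) by (simp add: algebra_simps)
    finally show ?thesis by simp
  qed
  have "U (z + 0 * (of_real r * v)) (\<zeta> + 0 * of_real r) \<le> ereal (Re (H 0))"
  proof (rule disc_testD[OF test[of \<zeta> "of_real r" z "of_real r * v"]])
    show "\<zeta> + \<tau> * of_real r \<in> cball 0 1" if "\<tau> \<in> cball 0 1" for \<tau>
      using in_ball[OF that] by auto
    have "continuous_on (cball 0 1) (\<lambda>\<tau>. G (\<zeta> + \<tau> * of_real r))"
      using in_ball by (intro continuous_on_compose2[OF G(1)] continuous_intros) force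
    moreover have "continuous_on (cball 0 1) (\<lambda>\<tau>. E (\<zeta> + \<tau> * of_real r))"
      by (intro continuous_on_compose2[OF contE[of UNIV]] continuous_intros) simp
    ultimately show "continuous_on (cball 0 1) H"
      unfolding H_def Rm_def by (intro continuous_on_add continuous_on_diff continuous_on_mult continuous_on_const continuous_on_id)
    have "(\<lambda>\<tau>. G (\<zeta> + \<tau> * of_real r)) holomorphic_on ball 0 1"
      using in_ball by (intro holomorphic_on_compose_gen[OF _ G(2), unfolded o_def] holomorphic_intros) auto
    moreover have "(\<lambda>\<tau>. E (\<zeta> + \<tau> * of_real r)) holomorphic_on ball 0 1"
      by (intro holomorphic_on_compose_gen[OF _ E, unfolded o_def] holomorphic_intros) auto
    ultimately show "H holomorphic_on ball 0 1"
      unfolding H_def Rm_def by (intro holomorphic_on_add holomorphic_on_diff holomorphic_on_mult holomorphic_on_const holomorphic_on_ident)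
    show "U (z + \<tau> * (of_real r * v)) (\<zeta> + \<tau> * of_real r) \<le> ereal (Re (H \<tau>))" if \<tau>: "\<tau> \<in> sphere 0 1" for \<tau>
    proof -
      define t where "t = \<tau> * of_real r"
      have t: "cmod t = r" using \<tau> r(1) by (simp add: t_def norm_mult)
      have tc: "\<tau> \<in> cball 0 1" using \<tau> by simp
      have e: "z + \<tau> * (of_real r * v) = z + t * v" "\<zeta> + \<tau> * of_real r = \<zeta> + t"
        by (simp_all add: t_def)
      have "(z + t * v, \<zeta> + t) \<in> K"
        using in_R[OF tc] in_ball[OF tc] unfolding K_def e by auto
      from q(2)[OF this] have PP: "P (z + t * v, \<zeta> + t) \<le> P q" .
      have *: "z + t * v - E (\<zeta> + t) = d - Rm t" by (simp add: d_def Rm_def algebra_simps)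
      have sq: "(cmod (x + y))\<^sup>2 = (cmod x)\<^sup>2 + 2 * Re (cnj x * y) + (cmod y)\<^sup>2" for x y
        by (simp only: cmod_power2) (simp add: power2_eq_square algebra_simps)
      have "cmod (Rm t) \<le> \<eta> * r"
        using d0(2)[of "\<zeta> + t"] t r(2) by (simp add: Rm_def)
      then have "(cmod (Rm t))\<^sup>2 \<le> (\<eta> * r)\<^sup>2" by (intro power_mono) auto
      then have Rm2: "k * (cmod (Rm t))\<^sup>2 \<le> k * \<eta>\<^sup>2 * r\<^sup>2"
        using k(1) by (simp add: power_mult_distrib mult.assoc)
      have s1: "(cmod (\<zeta> + t))\<^sup>2 = (cmod \<zeta>)\<^sup>2 + 2 * Re (cnj \<zeta> * t) + r\<^sup>2"
        unfolding sq t ..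
      have s2: "(cmod (d - Rm t))\<^sup>2 = (cmod d)\<^sup>2 - 2 * Re (cnj d * Rm t) + (cmod (Rm t))\<^sup>2"
        using sq[of d "- Rm t"] by simp
      have ReH: "Re (H \<tau>) = u + (Re (G (\<zeta> + t)) - Re (G \<zeta>)) - 2 * c * Re (cnj \<zeta> * t)
          - 2 * k * Re (cnj d * Rm t) + (k * \<eta>\<^sup>2 * r\<^sup>2 - c * r\<^sup>2)"
        unfolding H_def t_def by (simp add: algebra_simps)
      show ?thesis
      proof (cases "U (z + t * v) (\<zeta> + t)")
        case (real x)
        have "x - Re (G (\<zeta> + t)) + (c * ((cmod (\<zeta> + t))\<^sup>2 - 1) - k * (cmod (d - Rm t))\<^sup>2)
            \<le> u - Re (G \<zeta>) + (c * ((cmod \<zeta>)\<^sup>2 - 1) - k * (cmod d)\<^sup>2)"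
          using PP real u unfolding P_def W_def qz by (simp add: * d_def[symmetric])
        then have "x \<le> Re (H \<tau>)"
          using Rm2 unfolding s1 s2 ReH by (simp add: algebra_simps)
        then show ?thesis unfolding e real by simp
      next
        case PInf
        then show ?thesis using finite_above[of "\<zeta> + t" "z + t * v"] in_ball[OF tc] unfolding e by auto
      next
        case MInf
        then show ?thesis unfolding e by simp
      qed
    qed
  qed
  then have "u \<le> Re (H 0)" using u by simp
  moreover have "Re (H 0) = u + (k * \<eta>\<^sup>2 * r\<^sup>2 - c * r\<^sup>2)"
    by (simp add: H_def Rm_def)
  moreover have "k * \<eta>\<^sup>2 * r\<^sup>2 - c * r\<^sup>2 = - (c / 2) * r\<^sup>2" unfolding \<eta>(2) by (simp add: algebra_simps)
  moreover have "c / 2 * r\<^sup>2 > 0" using c r(1) by simp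
  ultimately show False by linarith
qed

end

locale radial_subharmonic_family = subharmonic_family +
  assumes radial: "\<zeta> \<in> cball 0 1 \<Longrightarrow> U z \<zeta> = U (of_real (cmod z)) \<zeta>"
begin

lemma slice_usc:
  assumes "\<zeta> \<in> cball 0 1"
  shows "usc_on S (\<lambda>z. U z \<zeta>)"
proof -
  have "continuous_on S (\<lambda>z. (z, \<zeta>))" by (intro continuous_intros)
  moreover have "(\<lambda>z. (z, \<zeta>)) ` S \<subseteq> UNIV \<times> cball 0 1" using assms by auto
  ultimately show ?thesis using usc_on_compose[OF usc] by force
qed

lemma slice_test: "\<zeta> \<in> cball 0 1 \<Longrightarrow> disc_test (\<lambda>\<tau>. U (z + \<tau> * v) \<zeta>)"
  using test[of \<zeta> 0 z v] by simp

text \<open>On the circle of radius |z| around 0 the function is constant, so constants serve as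
  test functions.\<close>

lemma at_zero_le:
  assumes "\<zeta> \<in> cball 0 1"
  shows "U 0 \<zeta> \<le> U z \<zeta>"
proof (rule ereal_le_real)
  fix M assume M: "U z \<zeta> \<le> ereal M"
  have "U (0 + 0 * z) \<zeta> \<le> ereal (Re (of_real M))"
  proof (rule disc_testD[OF slice_test[OF assms]])
    show "U (0 + \<tau> * z) \<zeta> \<le> ereal (Re (of_real M))" if "\<tau> \<in> sphere 0 1" for \<tau>
      using M radial[OF assms, of z] radial[OF assms, of "\<tau> * z"] that by (simp add: norm_mult)
  qed (auto intro: continuous_intros)
  then show "U 0 \<zeta> \<le> ereal M" by simp
qed

text \<open>Hadamard's three circles theorem: convexity in s, expressed by comparison with affine
  functions. Subtracting the affine function of ln |w| and adding \<epsilon> * |w|^2 gives a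
  function without a maximum inside the annulus.\<close>

lemma three_circles:
  assumes \<zeta>: "\<zeta> \<in> cball 0 1" and s: "s1 \<le> s" "s \<le> s2"
    and bd: "U (of_real (exp s1)) \<zeta> \<le> ereal (\<alpha> * s1 + \<beta>)" "U (of_real (exp s2)) \<zeta> \<le> ereal (\<alpha> * s2 + \<beta>)"
  shows "U (of_real (exp s)) \<zeta> \<le> ereal (\<alpha> * s + \<beta>)"
proof (rule ccontr)
  assume "\<not> ?thesis"
  then obtain A where A: "U (of_real (exp s)) \<zeta> = ereal A" "A > \<alpha> * s + \<beta>"
    using finite_above[OF \<zeta>, of "of_real (exp s)"] by (cases "U (of_real (exp s)) \<zeta>") auto
  define R where "R = exp s2"
  define g where "g = A - (\<alpha> * s + \<beta>)"
  \<comment> \<open>\<epsilon> * R^2 is half of the gap g. After normalization by R^2 the function P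
    is at most 0 on both boundary circles but still positive on the circle of radius exp s.\<close>
  define \<epsilon> where "\<epsilon> = g / (2 * R\<^sup>2)"
  have pos: "g > 0" "R > 0" "\<epsilon> > 0" "\<epsilon> * R\<^sup>2 = g / 2"
    using A(2) by (auto simp: g_def R_def \<epsilon>_def)
  define K where "K = cball (0::complex) R - ball 0 (exp s1)"
  have K: "compact K" unfolding K_def by (intro compact_diff) auto
  have memK: "w \<in> K \<longleftrightarrow> exp s1 \<le> cmod w \<and> cmod w \<le> R" for w by (auto simp: K_def)
  have K0: "w \<noteq> 0" if "w \<in> K" for w using that by (auto simp: memK)
  define P where "P w = U w \<zeta> + ereal (\<epsilon> * ((cmod w)\<^sup>2 - R\<^sup>2) - \<alpha> * ln (cmod w) - \<beta>)" for w
  have "usc_on K P"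
    unfolding P_def using K0 by (intro usc_on_add_continuous slice_usc[OF \<zeta>] continuous_intros) auto
  moreover have w0: "of_real (exp s) \<in> K" using s by (simp add: memK R_def)
  ultimately obtain w where w: "w \<in> K" "\<And>y. y \<in> K \<Longrightarrow> P y \<le> P w"
    using usc_on_attains_sup[OF _ K, of P] by (metis empty_iff)
  have "P (of_real (exp s)) = ereal (g + \<epsilon> * (exp s)\<^sup>2 - g / 2)"
    using A(1) pos(4) by (simp add: P_def g_def algebra_simps)
  then have "ereal 0 < P (of_real (exp s))" using pos by (simp add: add_pos_nonneg)
  then have Pw: "0 < P w" using w(2)[OF w0] by (metis order_less_le_trans zero_ereal_def)
  then obtain u where u: "U w \<zeta> = ereal u"
    using finite_above[OF \<zeta>, of w] by (cases "U w \<zeta>") (auto simp: P_def)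
  have Pw': "0 < u + (\<epsilon> * ((cmod w)\<^sup>2 - R\<^sup>2) - \<alpha> * ln (cmod w) - \<beta>)"
    using Pw u by (simp add: P_def)
  have eps: "\<epsilon> * ((cmod w)\<^sup>2 - R\<^sup>2) \<le> 0"
    using w(1) pos by (intro mult_nonneg_nonpos) (auto simp: memK power_mono)
  have bnd: "exp s1 < cmod w \<and> cmod w < R"
  proof (rule ccontr)
    assume "\<not> ?thesis"
    then have "cmod w = exp s1 \<or> cmod w = exp s2" using w(1) by (auto simp: memK R_def)
    then obtain s' where s': "cmod w = exp s'" "s' = s1 \<or> s' = s2" by blast
    then have "U w \<zeta> \<le> ereal (\<alpha> * s' + \<beta>)" using bd radial[OF \<zeta>, of w] by auto
    then show False using Pw' eps u s'(1) by simp
  qed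
  have wnz: "w \<noteq> 0" using K0 w(1) by blast
  \<comment> \<open>The disc has to stay in the annulus and thereby away from 0, so that ln |w + t|
    - ln |w| is the real part of a holomorphic function of t.\<close>
  define r where "r = min ((cmod w - exp s1) / 2) ((R - cmod w) / 2)"
  have r: "r > 0" "r < cmod w - exp s1" "r < R - cmod w"
    using bnd by (auto simp: r_def min_less_iff_disj)
  have rw: "r < cmod w" using r(2) exp_gt_zero[of s1] by linarith
  have small: "cmod (\<tau> * of_real r / w) < 1" if "\<tau> \<in> cball 0 1" for \<tau>
  proof -
    have "cmod \<tau> * r \<le> 1 * r" using that r(1) by (intro mult_right_mono) auto
    then have "cmod \<tau> * r < cmod w" using rw by linarith
    then show ?thesis using wnz r(1) by (simp add: norm_mult norm_divide)
  qed
  then have Re_pos: "0 < Re (1 + \<tau> * of_real r / w)" if "\<tau> \<in> cball 0 1" for \<tau>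
    using that abs_Re_le_cmod[of "\<tau> * of_real r / w"] by (smt (verit) one_complex.sel(1) plus_complex.sel(1))
  then have nonpos: "1 + \<tau> * of_real r / w \<notin> \<real>\<^sub>\<le>\<^sub>0" if "\<tau> \<in> cball 0 1" for \<tau>
    using that by (force simp: complex_nonpos_Reals_iff)
  \<comment> \<open>As in \<open>curve_test\<close>, maximality of P at w gives a majorant of U on
    the small circle; its value at the center is u - \<epsilon> * r^2.\<close>
  define H where "H \<tau> = of_real u + of_real \<alpha> * Ln (1 + \<tau> * of_real r / w)
      - of_real (2 * \<epsilon> * r) * cnj w * \<tau> - of_real (\<epsilon> * r\<^sup>2)" for \<tau>
  have "U (w + 0 * of_real r) \<zeta> \<le> ereal (Re (H 0))"
  proof (rule disc_testD[OF slice_test[OF \<zeta>]])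
    show "continuous_on (cball 0 1) H"
      unfolding H_def using nonpos by (intro continuous_intros) (auto simp: wnz)
    show "H holomorphic_on ball 0 1"
      unfolding H_def using nonpos by (intro holomorphic_intros) (auto simp: wnz)
    show "U (w + \<tau> * of_real r) \<zeta> \<le> ereal (Re (H \<tau>))" if \<tau>: "\<tau> \<in> sphere 0 1" for \<tau>
    proof -
      define t where "t = \<tau> * of_real r"
      have t: "cmod t = r" using \<tau> r(1) by (simp add: t_def norm_mult)
      have tc: "\<tau> \<in> cball 0 1" using \<tau> by simp
      have "cmod w \<le> cmod (w + t) + cmod t" "cmod (w + t) \<le> cmod w + cmod t" by norm+
      then have inK: "w + t \<in> K" using r t by (auto simp: memK)
      have sq: "(cmod (w + t))\<^sup>2 = (cmod w)\<^sup>2 + 2 * Re (cnj w * t) + r\<^sup>2"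
        unfolding t[symmetric] by (simp only: cmod_power2) (simp add: power2_eq_square algebra_simps)
      have "0 < Re (1 + t / w)" unfolding t_def by (rule Re_pos[OF tc])
      then have nz: "1 + t / w \<noteq> 0" by (metis less_irrefl zero_complex.sel(1))
      have "w + t = w * (1 + t / w)" using wnz by (simp add: field_simps)
      then have "ln (cmod (w + t)) = ln (cmod w) + ln (cmod (1 + t / w))"
        using wnz nz by (metis ln_mult norm_mult norm_eq_zero zero_less_norm_iff)
      then have lnt: "ln (cmod (w + t)) = ln (cmod w) + Re (Ln (1 + t / w))"
        using nz by simp
      have ReH: "Re (H \<tau>) = u + \<alpha> * Re (Ln (1 + t / w)) - 2 * \<epsilon> * Re (cnj w * t) - \<epsilon> * r\<^sup>2"
        unfolding H_def t_def by (simp add: algebra_simps)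
      show ?thesis
      proof (cases "U (w + t) \<zeta>")
        case (real x)
        then have "x \<le> Re (H \<tau>)"
          using w(2)[OF inK] u unfolding ReH P_def lnt sq by (simp add: algebra_simps)
        then show ?thesis using real by (simp add: t_def)
      next
        case PInf
        then show ?thesis using finite_above[OF \<zeta>] by simp
      next
        case MInf
        then show ?thesis by (simp add: t_def)
      qed
    qed
  qed
  then have "u \<le> u - \<epsilon> * r\<^sup>2" using u by (simp add: H_def)
  moreover have "\<epsilon> * r\<^sup>2 > 0" using pos r(1) by simp
  ultimately show False by linarith
qed

text \<open>Almost minimizing parameters form an interval, so their averages are again almost
  minimizing. \<open>three_circles\<close> compares weakly; a margin k at both ends restores the
  strict inequality.\<close>

lemma convex_sublevel:
  assumes \<zeta>: "\<zeta> \<in> cball 0 1"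
  shows "convex {s. U (of_real (exp s)) \<zeta> < ereal (\<alpha> * s + c)}"
proof (rule is_interval_convex, unfold is_interval_1, clarify)
  fix s1 s2 s
  assume s12: "U (of_real (exp s1)) \<zeta> < ereal (\<alpha> * s1 + c)" "U (of_real (exp s2)) \<zeta> < ereal (\<alpha> * s2 + c)"
    and s: "s1 \<le> s" "s \<le> s2"
  have gap: "\<exists>k>0. U (of_real (exp s')) \<zeta> \<le> ereal (\<alpha> * s' + c - k)"
    if less: "U (of_real (exp s')) \<zeta> < ereal (\<alpha> * s' + c)" for s'
  proof -
    obtain y where y: "U (of_real (exp s')) \<zeta> < ereal y" "ereal y < ereal (\<alpha> * s' + c)"
      using ereal_dense2[OF less] by blast
    then show ?thesis
      by (intro exI[of _ "\<alpha> * s' + c - y"]) (auto intro: order.strict_implies_order)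
  qed
  obtain k1 k2 where k: "k1 > 0" "U (of_real (exp s1)) \<zeta> \<le> ereal (\<alpha> * s1 + c - k1)"
    "k2 > 0" "U (of_real (exp s2)) \<zeta> \<le> ereal (\<alpha> * s2 + c - k2)"
    using gap[OF s12(1)] gap[OF s12(2)] by blast
  have "U (of_real (exp s)) \<zeta> \<le> ereal (\<alpha> * s + (c - min k1 k2))"
    by (rule three_circles[OF \<zeta> s]) (use k(2,4) in \<open>auto elim!: order_trans\<close>)
  also have "\<dots> < ereal (\<alpha> * s + c)" using k(1,3) by simp
  finally show "U (of_real (exp s)) \<zeta> < ereal (\<alpha> * s + c)" .
qed

text \<open>
  By convexity, almost minimizing parameters can be chosen continuously on the circle, hence as the
  real part of a polynomial h, and the infimum is tested along the curve \<open>\<zeta> \<mapsto> exp (h \<zeta>)\<close>.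
\<close>

theorem minimum_principle:
  "disc_test (\<lambda>\<zeta>. INF s. U (of_real (exp s)) \<zeta> - ereal (\<alpha> * s))"
  unfolding disc_test_def
proof (intro allI impI, rule ereal_le_epsilon2)
  fix G and e :: real
  assume G: "continuous_on (cball 0 1) G" "G holomorphic_on ball 0 1"
    "\<forall>\<zeta>\<in>sphere 0 1. (INF s. U (of_real (exp s)) \<zeta> - ereal (\<alpha> * s)) \<le> ereal (Re (G \<zeta>))" and e: "0 < e"
  have contG: "continuous_on (sphere 0 1) G" using G(1) by (rule continuous_on_subset) auto
  \<comment> \<open>F s \<zeta> < e says that s is almost minimizing at \<zeta>, measured against
    the majorant Re G.\<close>
  define F where "F s \<zeta> = U (of_real (exp s)) \<zeta> + ereal (- \<alpha> * s - Re (G \<zeta>))" for s \<zeta>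
  have F_iff: "F s \<zeta> < ereal e \<longleftrightarrow> U (of_real (exp s)) \<zeta> < ereal (\<alpha> * s + (Re (G \<zeta>) + e))" for s \<zeta>
    by (cases "U (of_real (exp s)) \<zeta>") (auto simp: F_def)
  have uscF: "usc_on (UNIV \<times> sphere 0 1) (\<lambda>p. F (f p) (snd p))"
    if "continuous_on (UNIV \<times> sphere 0 1) f" for f :: "real \<times> complex \<Rightarrow> real"
  proof -
    have "usc_on (UNIV \<times> sphere 0 1) (\<lambda>p. U (fst (complex_of_real (exp (f p)), snd p)) (snd (complex_of_real (exp (f p)), snd p)))"
      by (rule usc_on_compose[OF usc]) (use that in \<open>auto intro!: continuous_intros\<close>)
    then show ?thesis
      unfolding F_def using that
      by (intro usc_on_add_continuous) (auto intro!: continuous_intros continuous_on_compose2[OF contG])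
  qed
  \<comment> \<open>By upper semicontinuity one parameter serves a whole neighborhood of
    \<zeta>0.\<close>
  have "\<exists>s \<rho>. \<rho> > 0 \<and> (\<forall>\<zeta>\<in>sphere 0 1 \<inter> ball \<zeta>0 \<rho>. F s \<zeta> < ereal e)" if \<zeta>0: "\<zeta>0 \<in> sphere 0 1" for \<zeta>0
  proof -
    have "(INF s. U (of_real (exp s)) \<zeta>0 - ereal (\<alpha> * s)) \<le> ereal (Re (G \<zeta>0))"
      by (rule bspec[OF G(3) \<zeta>0])
    also have "\<dots> < ereal (Re (G \<zeta>0) + e)" using e by simp
    finally obtain s where "U (of_real (exp s)) \<zeta>0 - ereal (\<alpha> * s) < ereal (Re (G \<zeta>0) + e)"
      unfolding INF_less_iff by blast
    then have s: "F s \<zeta>0 < ereal e"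
      unfolding F_iff by (cases "U (of_real (exp s)) \<zeta>0") auto
    have "continuous_on (sphere 0 1) (\<lambda>\<zeta>::complex. (0::real, \<zeta>))" by (intro continuous_intros)
    moreover have "(\<lambda>\<zeta>. (0::real, \<zeta>)) ` sphere 0 1 \<subseteq> UNIV \<times> sphere (0::complex) 1" by auto
    ultimately have us: "usc_on (sphere 0 1) (F s)"
      using usc_on_compose[OF uscF[OF continuous_on_const]] by force
    then obtain N where N: "open N" "\<zeta>0 \<in> N" "\<And>\<zeta>. \<zeta> \<in> N \<Longrightarrow> \<zeta> \<in> sphere 0 1 \<Longrightarrow> F s \<zeta> < ereal e"
      using usc_onD[where u = "F s", OF us \<zeta>0 s] by metis
    obtain \<rho> where "\<rho> > 0" "ball \<zeta>0 \<rho> \<subseteq> N" using openE[OF N(1,2)] by blast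
    then show ?thesis using N(3) by (intro exI[of _ s] exI[of _ \<rho>]) blast
  qed
  then obtain s \<rho> where s\<rho>: "\<And>\<zeta>0. \<zeta>0 \<in> sphere 0 1 \<Longrightarrow> \<rho> \<zeta>0 > 0"
    "\<And>\<zeta>0 \<zeta>. \<zeta>0 \<in> sphere 0 1 \<Longrightarrow> \<zeta> \<in> sphere 0 1 \<Longrightarrow> \<zeta> \<in> ball \<zeta>0 (\<rho> \<zeta>0) \<Longrightarrow> F (s \<zeta>0) \<zeta> < ereal e"
    by (metis IntI)
  have "sphere 0 1 \<subseteq> (\<Union>\<zeta>\<in>sphere 0 1. ball \<zeta> (\<rho> \<zeta>))" using s\<rho>(1) by force
  then obtain D where D: "D \<subseteq> sphere 0 1" "finite D" "sphere 0 1 \<subseteq> (\<Union>\<zeta>\<in>D. ball \<zeta> (\<rho> \<zeta>))"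
    using compactE_image[OF compact_sphere, of "sphere 0 1" "\<lambda>\<zeta>. ball \<zeta> (\<rho> \<zeta>)"] by (metis open_ball)
  \<comment> \<open>Tent functions on the balls of the finite cover. Divided by their sum T they
    form a partition of unity, and r averages the local choices.\<close>
  define \<omega> where "\<omega> d \<zeta> = max 0 (\<rho> d - dist d \<zeta>)" for d \<zeta>
  define T where "T \<zeta> = (\<Sum>d\<in>D. \<omega> d \<zeta>)" for \<zeta>
  define r where "r \<zeta> = (\<Sum>d\<in>D. (\<omega> d \<zeta> / T \<zeta>) *\<^sub>R s d)" for \<zeta>
  have T: "T \<zeta> > 0" if \<zeta>: "\<zeta> \<in> sphere 0 1" for \<zeta>
  proof -
    obtain d where d: "d \<in> D" "\<zeta> \<in> ball d (\<rho> d)" using D(3) \<zeta> by blast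
    then have "0 < \<omega> d \<zeta>" by (simp add: \<omega>_def)
    also have "\<omega> d \<zeta> \<le> T \<zeta>"
      unfolding T_def using d D(2) by (intro member_le_sum) (auto simp: \<omega>_def)
    finally show ?thesis .
  qed
  have cont_r: "continuous_on (sphere 0 1) r"
    unfolding r_def
  proof (intro continuous_intros)
    show "continuous_on (sphere 0 1) (\<omega> d)" "continuous_on (sphere 0 1) T" for d
      unfolding T_def \<omega>_def by (intro continuous_intros)+
    show "\<forall>\<zeta>\<in>sphere 0 1. T \<zeta> \<noteq> 0" using T by force
  qed
  have Fr: "F (r \<zeta>) \<zeta> < ereal e" if \<zeta>: "\<zeta> \<in> sphere 0 1" for \<zeta>
  proof -
    define C where "C = {s. F s \<zeta> < ereal e}"
    have "convex C" unfolding C_def F_iff using \<zeta> by (intro convex_sublevel) auto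
    have in_C: "s d \<in> C" if "d \<in> D" "\<omega> d \<zeta> \<noteq> 0" for d
      using s\<rho>(2)[of d \<zeta>] that D(1) \<zeta> by (auto simp: C_def \<omega>_def max_def split: if_splits)
    obtain d0 where d0: "d0 \<in> D" "\<omega> d0 \<zeta> \<noteq> 0"
      using T[OF \<zeta>] unfolding T_def by (metis less_numeral_extra(3) sum.neutral)
    \<comment> \<open>Centers of weight 0 may have s d outside C; replacing these by the admissible
      s d0 does not change the sum.\<close>
    define y where "y d = (if \<omega> d \<zeta> = 0 then s d0 else s d)" for d
    have "r \<zeta> = (\<Sum>d\<in>D. (\<omega> d \<zeta> / T \<zeta>) *\<^sub>R y d)"
      unfolding r_def y_def by (intro sum.cong) auto
    also have "\<dots> \<in> C"
    proof (rule convex_sum[OF D(2) \<open>convex C\<close>])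
      show "(\<Sum>d\<in>D. \<omega> d \<zeta> / T \<zeta>) = 1"
        using T[OF \<zeta>] by (simp add: sum_divide_distrib[symmetric] T_def)
      show "0 \<le> \<omega> d \<zeta> / T \<zeta>" for d using T[OF \<zeta>] by (simp add: \<omega>_def)
      show "y d \<in> C" if "d \<in> D" for d using in_C d0 that by (simp add: y_def)
    qed
    finally show ?thesis by (simp add: C_def)
  qed
  have cont_rs: "continuous_on (UNIV \<times> sphere 0 1) (\<lambda>p::real \<times> complex. r (snd p) + fst p)"
    by (intro continuous_intros continuous_on_compose2[OF cont_r]) auto
  \<comment> \<open>Room for approximation: parameters close to r \<zeta> are still almost
    minimizing, uniformly in \<zeta>.\<close>
  obtain N where N: "open N" "0 \<in> N"
    "\<And>x \<zeta>. x \<in> N \<Longrightarrow> x \<in> UNIV \<Longrightarrow> \<zeta> \<in> sphere 0 1 \<Longrightarrow> F (r (snd (x, \<zeta>)) + fst (x, \<zeta>)) (snd (x, \<zeta>)) < ereal e"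
    by (rule usc_on_tube[OF uscF[OF cont_rs]]) (use Fr in auto)
  obtain \<delta> where \<delta>: "\<delta> > 0" "ball 0 \<delta> \<subseteq> N" using N(1,2) openE by metis
  obtain h where h: "\<And>\<zeta>. \<zeta> \<in> sphere 0 1 \<Longrightarrow> \<bar>r \<zeta> - Re (poly h \<zeta>)\<bar> < \<delta>"
    using circle_Re_poly_approx[OF cont_r \<delta>(1)] by metis
  have Eh: "U (exp (poly h \<zeta>)) \<zeta> = U (of_real (exp (Re (poly h \<zeta>)))) \<zeta>" if "\<zeta> \<in> cball 0 1" for \<zeta>
    using radial[OF that, of "exp (poly h \<zeta>)"] by simp
  \<comment> \<open>Along the curve the parameter is s = Re h, so the subtracted term \<alpha> * s
    is itself the real part of a holomorphic function and moves into the test function.\<close>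
  have "U (exp (poly h 0)) 0 \<le> ereal (Re (G 0 + of_real \<alpha> * poly h 0 + of_real e))"
  proof (rule curve_test[where E = "\<lambda>\<zeta>. exp (poly h \<zeta>)"])
    show "U (exp (poly h \<zeta>)) \<zeta> \<le> ereal (Re (G \<zeta> + of_real \<alpha> * poly h \<zeta> + of_real e))" if \<zeta>: "\<zeta> \<in> sphere 0 1" for \<zeta>
    proof -
      have "Re (poly h \<zeta>) - r \<zeta> \<in> N" using h[OF \<zeta>] \<delta>(2) by (auto simp: dist_real_def abs_minus_commute)
      then have "F (Re (poly h \<zeta>)) \<zeta> < ereal e" using N(3)[OF _ _ \<zeta>] by fastforce
      then show ?thesis using Eh[of \<zeta>] \<zeta> unfolding F_iff by (simp add: algebra_simps)
    qed
  qed (intro holomorphic_intros continuous_intros G)+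
  then have "U (of_real (exp (Re (poly h 0)))) 0 - ereal (\<alpha> * Re (poly h 0)) \<le> ereal (Re (G 0)) + ereal e"
    using Eh[of 0] by (cases "U (of_real (exp (Re (poly h 0)))) 0") auto
  then show "(INF s. U (of_real (exp s)) 0 - ereal (\<alpha> * s)) \<le> ereal (Re (G 0)) + ereal e"
    by (rule INF_lower2[OF UNIV_I])
qed

text \<open>The growth condition forces the slope \<open>2 * t\<close> of a supporting line to lie between 0 and 2.\<close>

lemma supporting_line:
  assumes \<zeta>: "\<zeta> \<in> cball 0 1"
    and growth: "\<And>s. U (of_real (exp s)) \<zeta> \<le> ereal (max (2 * s) 0 + M)"
  obtains t where "t \<in> {0..1}"
    "U (of_real (exp s0)) \<zeta> - ereal (2 * t * s0) \<le> (INF s. U (of_real (exp s)) \<zeta> - ereal (2 * t * s))"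
proof (cases "U (of_real (exp s0)) \<zeta>")
  case MInf
  then show ?thesis using that[of 0] by simp
next
  case PInf
  then show ?thesis using finite_above[OF \<zeta>] by simp
next
  case (real f0)
  define f where "f s = U (of_real (exp s)) \<zeta>" for s
  have f0: "f s0 = ereal f0" using real by (simp add: f_def)
  have three: "f0 \<le> \<alpha> * s0 + \<beta>" if "s1 \<le> s0" "s0 \<le> s2" "f s1 \<le> ereal (\<alpha> * s1 + \<beta>)" "f s2 \<le> ereal (\<alpha> * s2 + \<beta>)"
    for s1 s2 \<alpha> \<beta>
    using three_circles[OF \<zeta> that(1,2) that(3,4)[unfolded f_def]] f0 by (simp add: f_def)
  \<comment> \<open>Chords to the left of s0 are no steeper than chords to the right. The numbers y
    are upper bounds for f instead of values, since f might a priori be -\<infinity> away from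
    s0.\<close>
  have slope: "(f0 - y1) / (s0 - s1) \<le> (y2 - f0) / (s2 - s0)"
    if "s1 < s0" "s0 < s2" "f s1 \<le> ereal y1" "f s2 \<le> ereal y2" for s1 s2 y1 y2
  proof -
    define \<alpha> where "\<alpha> = (y2 - y1) / (s2 - s1)"
    have a: "\<alpha> * (s2 - s1) = y2 - y1" using that(1,2) by (simp add: \<alpha>_def)
    have "f0 \<le> \<alpha> * s0 + (y1 - \<alpha> * s1)"
      using that a by (intro three[of s1 s2]) (auto simp: algebra_simps)
    then have le1: "f0 - y1 \<le> \<alpha> * (s0 - s1)" by (simp add: algebra_simps)
    then have le2: "\<alpha> * (s2 - s0) \<le> y2 - f0" using a by (simp add: algebra_simps)
    have "(f0 - y1) / (s0 - s1) \<le> \<alpha>" using le1 that(1) by (simp add: divide_le_eq)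
    also have "\<alpha> \<le> (y2 - f0) / (s2 - s0)" using le2 that(2) by (simp add: le_divide_eq)
    finally show ?thesis .
  qed
  \<comment> \<open>The slopes of chords ending at s0. Their supremum p is the left derivative of f
    there, hence the slope of a supporting line.\<close>
  define B where "B = {(f0 - y) / (s0 - s) |s y. s < s0 \<and> f s \<le> ereal y}"
  have growth': "f s \<le> ereal (max (2 * s) 0 + M)" for s using growth by (simp add: f_def)
  have B_ne: "B \<noteq> {}"
  proof -
    have "(f0 - (max (2 * (s0 - 1)) 0 + M)) / (s0 - (s0 - 1)) \<in> B"
      unfolding B_def using growth'[of "s0 - 1"] by (intro CollectI exI conjI refl) auto
    then show ?thesis by blast
  qed
  have B_le: "b \<le> (y2 - f0) / (s2 - s0)" if "b \<in> B" "s0 < s2" "f s2 \<le> ereal y2" for b s2 y2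
    using that slope unfolding B_def by blast
  have bdd: "bdd_above B"
    using B_le[OF _ _ growth', of _ "s0 + 1"] by (intro bdd_aboveI) auto
  define p where "p = Sup B"
  have p_right: "p \<le> (y2 - f0) / (s2 - s0)" if "s0 < s2" "f s2 \<le> ereal y2" for s2 y2
    unfolding p_def using B_ne B_le that by (intro cSup_least) auto
  have p_left: "(f0 - y) / (s0 - s) \<le> p" if "s < s0" "f s \<le> ereal y" for s y
    unfolding p_def using that by (intro cSup_upper bdd) (auto simp: B_def)
  have line: "f0 + p * (s - s0) \<le> y" if "f s \<le> ereal y" for s y
  proof (cases s s0 rule: linorder_cases)
    case less
    then have "f0 - y \<le> p * (s0 - s)" using p_left[OF less that] by (simp add: divide_le_eq)
    then show ?thesis by (simp add: algebra_simps)
  next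
    case equal
    then show ?thesis using that f0 by simp
  next
    case greater
    then show ?thesis using p_right[OF greater that] by (simp add: le_divide_eq algebra_simps)
  qed
  have "0 \<le> p"
  proof (rule ccontr)
    assume "\<not> 0 \<le> p"
    \<comment> \<open>So far to the left that max (2 * s) 0 vanishes while a negative slope lifts
      the line above M.\<close>
    define s where "s = min 0 (s0 - (\<bar>M - f0\<bar> + 1) / (- p))"
    have "f0 + p * (s - s0) \<le> max (2 * s) 0 + M" by (rule line[OF growth'])
    then have "p * (s - s0) \<le> M - f0" by (simp add: s_def)
    moreover have "p * (s - s0) \<ge> \<bar>M - f0\<bar> + 1"
    proof -
      have "s - s0 \<le> - ((\<bar>M - f0\<bar> + 1) / (- p))" by (simp add: s_def)
      then have "p * (s - s0) \<ge> p * (- ((\<bar>M - f0\<bar> + 1) / (- p)))"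
        using \<open>\<not> 0 \<le> p\<close> by (intro mult_left_mono_neg) auto
      then show ?thesis using \<open>\<not> 0 \<le> p\<close> by simp
    qed
    ultimately show False by linarith
  qed
  have "p \<le> 2"
  proof (rule ccontr)
    assume "\<not> p \<le> 2"
    \<comment> \<open>So far to the right that a line of slope p > 2 outgrows 2 * s + M.\<close>
    define s where "s = max 0 ((\<bar>M - f0 + p * s0\<bar> + 1) / (p - 2))"
    have "f0 + p * (s - s0) \<le> max (2 * s) 0 + M" by (rule line[OF growth'])
    moreover have "max (2 * s) 0 = 2 * s" by (simp add: s_def)
    ultimately have "(p - 2) * s \<le> M - f0 + p * s0" by (simp add: algebra_simps)
    moreover have "(p - 2) * s \<ge> \<bar>M - f0 + p * s0\<bar> + 1"
    proof -
      have "(p - 2) * s \<ge> (p - 2) * ((\<bar>M - f0 + p * s0\<bar> + 1) / (p - 2))"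
        using \<open>\<not> p \<le> 2\<close> by (intro mult_left_mono) (auto simp: s_def)
      then show ?thesis using \<open>\<not> p \<le> 2\<close> by simp
    qed
    ultimately show False by linarith
  qed
  define t where "t = p / 2"
  have "ereal (f0 - 2 * t * s0) \<le> f s - ereal (2 * t * s)" for s
  proof (cases "f s")
    case (real y)
    then show ?thesis using line[of s y] by (simp add: t_def algebra_simps)
  next
    case MInf
    \<comment> \<open>If f s were -\<infinity>, every real number would bound it, in particular the
      one a unit below the line.\<close>
    then have "f0 + p * (s - s0) \<le> f0 + p * (s - s0) - 1" by (intro line) simp
    then show ?thesis by simp
  qed simp
  then have "U (of_real (exp s0)) \<zeta> - ereal (2 * t * s0) \<le> (INF s. U (of_real (exp s)) \<zeta> - ereal (2 * t * s))"
    using real by (intro INF_greatest) (simp add: f_def)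
  moreover have "t \<in> {0..1}" using \<open>0 \<le> p\<close> \<open>p \<le> 2\<close> by (simp add: t_def)
  ultimately show ?thesis using that by blast
qed

end

section \<open>Adding logarithms of holomorphic functions\<close>

lemma disc_test_cong:
  assumes "\<And>\<zeta>. \<zeta> \<in> cball 0 1 \<Longrightarrow> w \<zeta> = w' \<zeta>"
  shows "disc_test w \<longleftrightarrow> disc_test w'"
proof -
  have "w 0 = w' 0" "\<And>\<zeta>. \<zeta> \<in> sphere 0 1 \<Longrightarrow> w \<zeta> = w' \<zeta>" using assms by auto
  then show ?thesis unfolding disc_test_def by simp
qed

text \<open>\<open>log_weight c z\<close> is the logarithm of \<open>\<bar>z\<bar>\<close> to the power 2c, where the zeroth power is 1 also at z = 0.\<close>

definition log_weight :: "real \<Rightarrow> complex \<Rightarrow> ereal" where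
  "log_weight c z = (if c = 0 then 0 else if z = 0 then - \<infinity> else ereal (2 * c * ln (cmod z)))"

lemma log_weight_nonzero: "z \<noteq> 0 \<Longrightarrow> log_weight c z = ereal (2 * c * ln (cmod z))"
  by (simp add: log_weight_def zero_ereal_def)

lemma log_weight_not_inf [simp]: "log_weight c z \<noteq> \<infinity>"
  by (simp add: log_weight_def)

text \<open>The delicate points have z = 0. For c > 0 the values nearby tend to -\<infinity>. For c
  = 0 the value is 0 by the convention on the zeroth power, and nearby values are at most 0 because
  c' \<ge> 0 and |z'| < 1.\<close>

lemma usc_log_weight: "usc_on ({0..} \<times> UNIV) (\<lambda>p. log_weight (fst p) (snd p))"
  unfolding usc_on_def
proof (safe, simp)
  fix c z e assume c: "0 \<le> (c::real)" and less: "log_weight c z < e"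
  show "\<exists>N. open N \<and> (c, z) \<in> N \<and> (\<forall>x\<in>N \<inter> {0..} \<times> UNIV. log_weight (fst x) (snd x) < e)"
  proof (cases "z = 0")
    case False
    have "continuous_on (UNIV \<times> - {0}) (\<lambda>p::real \<times> complex. 2 * fst p * ln (cmod (snd p)))"
      by (intro continuous_intros) auto
    then have "usc_on (UNIV \<times> - {0}) (\<lambda>p::real \<times> complex. 0 + ereal (2 * fst p * ln (cmod (snd p))))"
      by (intro usc_on_add_continuous) (auto simp: usc_on_def intro!: exI[of _ UNIV])
    moreover have "(c, z) \<in> UNIV \<times> - {0}" using False by simp
    moreover have "0 + ereal (2 * fst (c, z) * ln (cmod (snd (c, z)))) < e"
      using less False by (simp add: log_weight_nonzero)
    ultimately have "\<exists>N. open N \<and> (c, z) \<in> N \<and>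
        (\<forall>p\<in>N \<inter> UNIV \<times> - {0}. 0 + ereal (2 * fst p * ln (cmod (snd p))) < e)"
      unfolding usc_on_def by blast
    then obtain N where N: "open N" "(c, z) \<in> N"
      "\<And>p. p \<in> N \<inter> UNIV \<times> - {0} \<Longrightarrow> ereal (2 * fst p * ln (cmod (snd p))) < e"
      by auto
    have *: "log_weight (fst p) (snd p) < e" if "p \<in> N \<inter> UNIV \<times> - {0}" for p
    proof -
      have "snd p \<noteq> 0" using that by auto
      then show ?thesis using N(3)[OF that] by (simp add: log_weight_nonzero)
    qed
    have "open (N \<inter> UNIV \<times> - {0})" using N(1) by (intro open_Int open_Times) auto
    then show ?thesis
      using N(2) False * by (intro exI[of _ "N \<inter> UNIV \<times> - {0}"]) blast
  next
    case True
    show ?thesis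
    proof (cases "c = 0")
      case True
      have "0 < e" using less True by (simp add: log_weight_def)
      moreover have "log_weight c' z' \<le> 0" if "c' \<ge> 0" "cmod z' < 1" for c' z'
        using that by (auto simp: log_weight_def mult_nonneg_nonpos)
      ultimately have "log_weight c' z' < e" if "c' \<ge> 0" "cmod z' < 1" for c' z'
        using that order_le_less_trans by blast
      then show ?thesis
        using \<open>z = 0\<close> by (intro exI[of _ "UNIV \<times> ball 0 1"]) (auto intro!: open_Times)
    next
      case False
      then have c: "c > 0" using c by simp
      obtain d where d: "ereal d < e" "d < 0"
      proof -
        have "- \<infinity> < min e 0" using less True False by (simp add: log_weight_def)
        then obtain d where "ereal d < min e 0" using ereal_dense2 by blast
        then show ?thesis by (intro that[of d]) auto
      qed
      \<comment> \<open>Since ln |z'| < d / c < 0 and 2 * c' > c, the value 2 * c' * ln |z'| is at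
        most c * (d / c) = d.\<close>
      have "log_weight c' z' < e" if "c' > c / 2" "cmod z' < exp (d / c)" for c' z'
      proof (cases "z' = 0")
        case True
        then show ?thesis using that c d by (auto simp: log_weight_def)
      next
        case False
        then have l: "ln (cmod z') < d / c"
          using that(2) by (metis ln_exp ln_less_cancel_iff exp_gt_zero zero_less_norm_iff)
        moreover have "d / c < 0" using c d by (simp add: divide_neg_pos)
        ultimately have l0: "ln (cmod z') < 0" by linarith
        have "2 * c' * ln (cmod z') \<le> c * ln (cmod z')"
          using that(1) l0 by (intro mult_right_mono_neg) auto
        also have "\<dots> \<le> c * (d / c)" using l c by (intro mult_left_mono) auto
        also have "\<dots> = d" using c by simp
        finally have "ereal (2 * c' * ln (cmod z')) \<le> ereal d" by simp
        then show ?thesis using d(1) False by (metis log_weight_nonzero order_le_less_trans)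
      qed
      then show ?thesis
        using \<open>z = 0\<close> c by (intro exI[of _ "{c / 2<..} \<times> ball 0 (exp (d / c))"]) (auto intro!: open_Times)
    qed
  qed
qed

text \<open>
  On a circle not passing through the zero of \<open>a + \<zeta> * b\<close>, \<open>ln \<bar>a + \<zeta> * b\<bar>\<close> is the real part of a
  holomorphic function with larger or equal value at 0; for \<open>\<bar>a\<bar> < \<bar>b\<bar>\<close> this is a logarithm of
  the reflected function \<open>cnj b + \<zeta> * cnj a\<close>.  The remaining circles are limits of smaller ones.
\<close>

lemma disc_test_add_log_weight:
  assumes v: "usc_on (cball 0 1) v" "\<And>\<zeta>. \<zeta> \<in> cball 0 1 \<Longrightarrow> v \<zeta> \<noteq> \<infinity>"
    and test: "\<And>r. 0 < r \<Longrightarrow> r \<le> 1 \<Longrightarrow> disc_test (\<lambda>\<zeta>. v (of_real r * \<zeta>))"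
    and c: "c \<ge> 0"
  shows "disc_test (\<lambda>\<zeta>. log_weight c (a + \<zeta> * b) + v \<zeta>)"
proof -
  \<comment> \<open>For |q| < 1 the function 1 + q * \<zeta> has positive real part on the closed
    disc, so its principal logarithm is available up to the boundary.\<close>
  have log: "continuous_on (cball 0 1) (\<lambda>\<zeta>. Ln (1 + q * \<zeta>))" "(\<lambda>\<zeta>. Ln (1 + q * \<zeta>)) holomorphic_on ball 0 1"
    "\<And>\<zeta>. \<zeta> \<in> cball 0 1 \<Longrightarrow> 1 + q * \<zeta> \<noteq> 0"
    if q: "cmod q < 1" for q
  proof -
    have pos: "0 < Re (1 + q * \<zeta>)" if "\<zeta> \<in> cball 0 1" for \<zeta>
    proof -
      have "cmod (q * \<zeta>) \<le> cmod q * 1" using that unfolding norm_mult by (intro mult_left_mono) auto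
      then show ?thesis using q abs_Re_le_cmod[of "q * \<zeta>"] by (simp add: abs_le_iff)
    qed
    then have nn: "1 + q * \<zeta> \<notin> \<real>\<^sub>\<le>\<^sub>0" if "\<zeta> \<in> cball 0 1" for \<zeta>
      using that by (force simp: complex_nonpos_Reals_iff)
    show "continuous_on (cball 0 1) (\<lambda>\<zeta>. Ln (1 + q * \<zeta>))" using nn by (intro continuous_intros) auto
    show "(\<lambda>\<zeta>. Ln (1 + q * \<zeta>)) holomorphic_on ball 0 1" using nn by (intro holomorphic_intros) auto
    show "1 + q * \<zeta> \<noteq> 0" if "\<zeta> \<in> cball 0 1" for \<zeta> using pos[OF that] by (metis less_irrefl zero_complex.sel(1))
  qed
  have core: "log_weight c a + v 0 \<le> ereal (Re (G 0))"
    if r: "0 < r" "r \<le> 1" and ab: "cmod a \<noteq> cmod (of_real r * b)"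
      and G: "continuous_on (cball 0 1) G" "G holomorphic_on ball 0 1"
      and bd: "\<And>\<zeta>. \<zeta> \<in> sphere 0 1 \<Longrightarrow> log_weight c (a + of_real r * \<zeta> * b) + v (of_real r * \<zeta>) \<le> ereal (Re (G \<zeta>))"
    for r G
  proof -
    define b' where "b' = of_real r * b"
    \<comment> \<open>x and q describe |a + \<zeta> * b'| on the circle as the modulus of a function
      without zeros in the disc; a multiple of its logarithm is subtracted from the test
      function.\<close>
    have *: "v 0 \<le> ereal (Re (G 0) - 2 * c * ln (cmod x))"
      if x: "x \<noteq> 0" "cmod q < 1" and mod: "\<And>\<zeta>. \<zeta> \<in> sphere 0 1 \<Longrightarrow> cmod (a + \<zeta> * b') = cmod x * cmod (1 + q * \<zeta>)" for x q
    proof -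
      have "v (of_real r * 0) \<le> ereal (Re (G 0 - of_real (2 * c) * (of_real (ln (cmod x)) + Ln (1 + q * 0))))"
      proof (rule disc_testD[OF test[OF r]])
        show "v (of_real r * \<zeta>) \<le> ereal (Re (G \<zeta> - of_real (2 * c) * (of_real (ln (cmod x)) + Ln (1 + q * \<zeta>))))"
          if \<zeta>: "\<zeta> \<in> sphere 0 1" for \<zeta>
        proof -
          have nz: "1 + q * \<zeta> \<noteq> 0" using log(3)[OF x(2), of \<zeta>] \<zeta> by simp
          then have "a + \<zeta> * b' \<noteq> 0" using mod[OF \<zeta>] x(1) by auto
          moreover have "ln (cmod (a + \<zeta> * b')) = ln (cmod x) + Re (Ln (1 + q * \<zeta>))"
            unfolding mod[OF \<zeta>] using nz x(1) by (simp add: ln_mult)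
          moreover have "a + \<zeta> * b' = a + of_real r * \<zeta> * b" by (simp add: b'_def algebra_simps)
          ultimately have "log_weight c (a + of_real r * \<zeta> * b) = ereal (2 * c * (ln (cmod x) + Re (Ln (1 + q * \<zeta>))))"
            by (metis log_weight_nonzero)
          then show ?thesis using bd[OF \<zeta>] by (cases "v (of_real r * \<zeta>)") (auto simp: algebra_simps)
        qed
      qed (intro continuous_intros holomorphic_intros G log(1,2)[OF x(2)])+
      then show ?thesis by simp
    qed
    show ?thesis
    proof (cases "a = 0 \<and> c \<noteq> 0")
      case True
      then show ?thesis using v(2)[of 0] by (cases "v 0") (auto simp: log_weight_def)
    next
      case a: False
      show ?thesis
      proof (cases "c = 0")
        case True
        have "v (of_real r * 0) \<le> ereal (Re (G 0))"
          using bd True by (intro disc_testD[OF test[OF r] G]) (auto simp: log_weight_def)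
        then show ?thesis using True by (simp add: log_weight_def)
      next
        case False
        then have an: "a \<noteq> 0" using a by simp
        have "v 0 \<le> ereal (Re (G 0) - 2 * c * ln (cmod a))"
        proof (cases "cmod b' < cmod a")
          case True
          then show ?thesis
          proof (intro *[of a "b' / a"])
            show "cmod (a + \<zeta> * b') = cmod a * cmod (1 + b' / a * \<zeta>)" for \<zeta>
            proof -
              have "a + \<zeta> * b' = a * (1 + b' / a * \<zeta>)" using an by (simp add: field_simps)
              then show ?thesis by (simp only: norm_mult)
            qed
          qed (use an in \<open>auto simp: norm_divide\<close>)
        next
          case False
          then have ab': "cmod a < cmod b'" using ab unfolding b'_def by simp
          then have bn: "b' \<noteq> 0" using an by auto
          have "v 0 \<le> ereal (Re (G 0) - 2 * c * ln (cmod b'))"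
          proof (rule *)
            show "b' \<noteq> 0" by (rule bn)
            show "cmod (cnj a / cnj b') < 1" using ab' bn by (simp add: norm_divide)
            show "cmod (a + \<zeta> * b') = cmod b' * cmod (1 + cnj a / cnj b' * \<zeta>)" if \<zeta>: "\<zeta> \<in> sphere 0 1" for \<zeta>
            proof -
              have "cmod b' * cmod (1 + cnj a / cnj b' * \<zeta>) = cmod (cnj b' * (1 + cnj a / cnj b' * \<zeta>))"
                by (simp add: norm_mult)
              also have "cnj b' * (1 + cnj a / cnj b' * \<zeta>) = cnj (b' + a * cnj \<zeta>)"
                using bn by (simp add: field_simps)
              also have "cmod \<dots> = cmod (\<zeta> * (b' + a * cnj \<zeta>))"
                using \<zeta> unfolding complex_mod_cnj by (simp add: norm_mult)
              also have "\<zeta> * (b' + a * cnj \<zeta>) = a + \<zeta> * b'"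
                using \<zeta> complex_norm_square[of \<zeta>] by (simp add: algebra_simps)
              finally show ?thesis by simp
            qed
          qed
          \<comment> \<open>Reflection has raised the modulus at 0 from |a| to |b'|. As c \<ge> 0,
            this is the direction that subharmonicity allows.\<close>
          also have "\<dots> \<le> ereal (Re (G 0) - 2 * c * ln (cmod a))"
          proof -
            have "ln (cmod a) \<le> ln (cmod b')" using ab' an bn by simp
            then have "2 * c * ln (cmod a) \<le> 2 * c * ln (cmod b')" using c by (intro mult_left_mono) auto
            then show ?thesis by simp
          qed
          finally show ?thesis .
        qed
        then show ?thesis
          using an by (cases "v 0") (auto simp: log_weight_nonzero)
      qed
    qed
  qed
  show ?thesis
    unfolding disc_test_def
  proof (intro allI impI, rule ereal_le_epsilon2)
    fix G and e :: real
    assume G: "continuous_on (cball 0 1) G" "G holomorphic_on ball 0 1"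
      "\<forall>\<zeta>\<in>sphere 0 1. log_weight c (a + \<zeta> * b) + v \<zeta> \<le> ereal (Re (G \<zeta>))" and e: "0 < e"
    define w where "w \<zeta> = log_weight c (a + \<zeta> * b) + v \<zeta>" for \<zeta>
    have w_usc: "usc_on (cball 0 1) w"
      unfolding w_def
    proof (intro usc_on_add v)
      have "continuous_on (cball 0 1) (\<lambda>\<zeta>::complex. (c, a + \<zeta> * b))" by (intro continuous_intros)
      then show "usc_on (cball 0 1) (\<lambda>\<zeta>. log_weight c (a + \<zeta> * b))"
        using usc_on_compose[OF usc_log_weight, of "cball 0 1" "\<lambda>\<zeta>. (c, a + \<zeta> * b)"] c by fastforce
    qed auto
    \<comment> \<open>The radius becomes a parameter: at radius 1 the function is below e, and
      semicontinuity preserves this for radii near 1.\<close>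
    define F where "F p = w (of_real (fst p) * snd p) + ereal (- Re (G (of_real (fst p) * snd p)))" for p :: "real \<times> complex"
    have in_cball: "of_real r * \<zeta> \<in> cball 0 1" if "r \<in> {0..1}" "\<zeta> \<in> cball 0 1" for r and \<zeta> :: complex
      using that by (auto simp: norm_mult mult_le_one)
    have contm: "continuous_on ({0..1} \<times> sphere 0 1) (\<lambda>p::real \<times> complex. of_real (fst p) * snd p)"
      by (intro continuous_intros)
    have imm: "(\<lambda>p::real \<times> complex. of_real (fst p) * snd p) ` ({0..1} \<times> sphere 0 1) \<subseteq> cball 0 1"
      using in_cball by force
    have "usc_on ({0..1} \<times> sphere 0 1) F"
      unfolding F_def
      by (intro usc_on_add_continuous usc_on_compose[OF w_usc contm imm] continuous_intros
          continuous_on_compose2[OF G(1) contm imm])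
    moreover have "F (1, \<zeta>) < ereal e" if "\<zeta> \<in> sphere 0 1" for \<zeta>
      using G(3)[rule_format, OF that] e by (cases "w \<zeta>") (auto simp: F_def w_def[symmetric])
    ultimately obtain N where N: "open N" "1 \<in> N"
      "\<And>r \<zeta>. r \<in> N \<Longrightarrow> r \<in> {0..1} \<Longrightarrow> \<zeta> \<in> sphere 0 1 \<Longrightarrow> F (r, \<zeta>) < ereal e"
      using usc_on_tube[of "{0..1}" "sphere 0 1" F 1 "ereal e"] by (metis atLeastAtMost_iff compact_sphere le_numeral_extra(4) zero_le_one)
    obtain \<delta> where \<delta>: "\<delta> > 0" "ball 1 \<delta> \<subseteq> N" using openE[OF N(1,2)] by blast
    \<comment> \<open>The radius shrinks only if the zero lies on the unit circle, that is |a| = |b|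
      with b nonzero; r < 1 then takes the zero off the circle. The minimum with 1 / 2 keeps r
      positive.\<close>
    define r where "r = (if cmod a = cmod b \<and> b \<noteq> 0 then 1 - min (\<delta> / 2) (1 / 2) else 1)"
    have r: "0 < r" "r \<le> 1" "r \<in> N"
      using \<delta> N(2) by (auto simp: r_def dist_real_def subset_iff min_def)
    show "log_weight c (a + 0 * b) + v 0 \<le> ereal (Re (G 0)) + ereal e"
    proof (cases "a = 0 \<and> b = 0")
      case True
      show ?thesis
      proof (cases "c = 0")
        case True
        have "v (of_real 1 * 0) \<le> ereal (Re (G 0))"
          using G True by (intro disc_testD[OF test] G) (auto simp: log_weight_def)
        also have "\<dots> \<le> ereal (Re (G 0)) + ereal e" using e by simp
        finally show ?thesis using True by (simp add: log_weight_def)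
      next
        case False
        then show ?thesis using True v(2)[of 0] by (cases "v 0") (auto simp: log_weight_def)
      qed
    next
      case False
      have "log_weight c a + v 0 \<le> ereal (Re (G (of_real r * 0) + of_real e))"
      proof (rule core[OF r(1,2), where G = "\<lambda>\<zeta>. G (of_real r * \<zeta>) + of_real e"])
        show "cmod a \<noteq> cmod (of_real r * b)"
        proof (cases "cmod a = cmod b")
          case True
          then have "b \<noteq> 0" using False by auto
          then have "r < 1" using True \<delta>(1) by (simp add: r_def)
          then show ?thesis using True \<open>b \<noteq> 0\<close> r(1) by (simp add: norm_mult)
        next
          case False
          then show ?thesis by (simp add: r_def)
        qed
        show "continuous_on (cball 0 1) (\<lambda>\<zeta>. G (of_real r * \<zeta>) + of_real e)"
          using in_cball[of r] r by (intro continuous_intros continuous_on_compose2[OF G(1)]) auto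
        have "of_real r * \<zeta> \<in> ball 0 1" if "\<zeta> \<in> ball 0 1" for \<zeta> :: complex
        proof -
          have "r * cmod \<zeta> \<le> 1 * cmod \<zeta>" using r by (intro mult_right_mono) auto
          then show ?thesis using that r(1) by (simp add: norm_mult)
        qed
        then show "(\<lambda>\<zeta>. G (of_real r * \<zeta>) + of_real e) holomorphic_on ball 0 1"
          by (intro holomorphic_intros holomorphic_on_compose_gen[OF _ G(2), unfolded o_def]) auto
        show "log_weight c (a + of_real r * \<zeta> * b) + v (of_real r * \<zeta>) \<le> ereal (Re (G (of_real r * \<zeta>) + of_real e))"
          if "\<zeta> \<in> sphere 0 1" for \<zeta>
        proof -
          have "F (r, \<zeta>) < ereal e" using N(3)[OF r(3) _ that] r by simp
          then have less: "log_weight c (a + of_real r * \<zeta> * b) + v (of_real r * \<zeta>) + ereal (- Re (G (of_real r * \<zeta>))) < ereal e"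
            by (simp add: F_def w_def)
          have "x \<le> ereal (y + e)" if "x + ereal (- y) < ereal e" for x y
            using that by (cases x) auto
          from this[OF less] show ?thesis by simp
        qed
      qed
      then show ?thesis by simp
    qed
  qed
qed

text \<open>The partial derivatives are continuous by Cauchy's inequality, so F is totally differentiable.\<close>

lemma osgood_two_variables:
  fixes F :: "complex \<Rightarrow> complex \<Rightarrow> complex"
  assumes r: "r > 0"
    and cont: "continuous_on (ball 0 r \<times> ball 0 r) (\<lambda>p. F (fst p) (snd p))"
    and h1: "\<And>q. q \<in> ball 0 r \<Longrightarrow> (\<lambda>p. F p q) holomorphic_on ball 0 r"
    and h2: "\<And>p. p \<in> ball 0 r \<Longrightarrow> F p holomorphic_on ball 0 r"
  shows "(\<lambda>\<zeta>. F (\<zeta> * \<alpha>) (\<zeta> * \<beta>)) field_differentiable (at 0)"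
proof -
  define D where "D p q = deriv (F p) q" for p q
  have D: "(F p has_field_derivative D p q) (at q)" if "p \<in> ball 0 r" "q \<in> ball 0 r" for p q
    unfolding D_def using h2[OF that(1)] that(2) by (intro holomorphic_derivI[OF _ open_ball])
  have contD: "continuous (at (0, 0) within ball 0 r \<times> ball 0 r) (\<lambda>(p, q). D p q)"
    unfolding continuous_within_eps_delta
  proof (intro allI impI)
    fix e :: real assume e: "e > 0"
    \<comment> \<open>Circles of radius \<rho> around points within \<rho> of 0 stay in the ball of
      radius 2 * \<rho> < r.\<close>
    define \<rho> where "\<rho> = r / 4"
    have \<rho>: "\<rho> > 0" using r by (simp add: \<rho>_def)
    have "D 0 holomorphic_on ball 0 r"
      using holomorphic_deriv[OF h2[of 0] open_ball] r by (simp add: D_def[abs_def])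
    then have "isCont (D 0) 0"
      using r by (meson centre_in_ball continuous_on_eq_continuous_at holomorphic_on_imp_continuous_on open_ball)
    then obtain d1 where d1: "d1 > 0" "\<And>q. dist q 0 < d1 \<Longrightarrow> dist (D 0 q) (D 0 0) < e / 2"
      using e unfolding continuous_at_eps_delta by (meson half_gt_zero)
    have "uniformly_continuous_on (cball 0 (2 * \<rho>) \<times> cball 0 (2 * \<rho>)) (\<lambda>p. F (fst p) (snd p))"
      using r by (intro compact_uniformly_continuous continuous_on_subset[OF cont] compact_Times) (auto simp: \<rho>_def)
    then obtain d2 where d2: "d2 > 0" "\<And>x y. x \<in> cball 0 (2 * \<rho>) \<times> cball 0 (2 * \<rho>) \<Longrightarrow> y \<in> cball 0 (2 * \<rho>) \<times> cball 0 (2 * \<rho>) \<Longrightarrow>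
        dist y x < d2 \<Longrightarrow> dist (F (fst y) (snd y)) (F (fst x) (snd x)) < e * \<rho> / 4"
      using e \<rho> unfolding uniformly_continuous_on_def
      by (metis (no_types, lifting) divide_pos_pos mult_pos_pos zero_less_numeral)
    define d where "d = min \<rho> (min d1 d2)"
    have "dist (D p q) (D 0 0) < e" if pq: "dist (p, q) (0, 0) < d" for p q
    proof -
      have p: "cmod p < d" "cmod q < d"
        using pq dist_fst_le[of "(p, q)" "(0, 0)"] dist_snd_le[of "(p, q)" "(0, 0)"] by auto
      have inq: "cmod \<xi> \<le> 2 * \<rho>" if "cmod (q - \<xi>) \<le> \<rho>" for \<xi>
        using norm_triangle_ineq2[of \<xi> q] that p(2) by (auto simp: d_def norm_minus_commute)
      have sub: "cball q \<rho> \<subseteq> ball 0 r" using inq r by (force simp: \<rho>_def dist_norm)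
      have pin: "p \<in> ball 0 r" "0 \<in> ball 0 r" using p(1) r by (auto simp: d_def \<rho>_def)
      \<comment> \<open>Cauchy's inequality turns uniform closeness of F p and F 0 on a circle
        around q into closeness of their derivatives at q.\<close>
      define g where "g \<xi> = F p \<xi> - F 0 \<xi>" for \<xi>
      have hg: "g holomorphic_on ball 0 r" unfolding g_def by (intro holomorphic_intros h2 pin)
      have "cmod ((deriv ^^ 1) g q) \<le> fact 1 * (e * \<rho> / 4) / \<rho> ^ 1"
      proof (rule Cauchy_inequality)
        show "g holomorphic_on ball q \<rho>" using hg sub by (meson ball_subset_cball holomorphic_on_subset order_trans)
        show "continuous_on (cball q \<rho>) g" using hg sub holomorphic_on_imp_continuous_on holomorphic_on_subset by blast
        show "cmod (g \<xi>) \<le> e * \<rho> / 4" if "cmod (q - \<xi>) = \<rho>" for \<xi>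
        proof -
          have "dist (p, \<xi>) (0, \<xi>) < d2" using p(1) by (simp add: dist_prod_def d_def)
          moreover have "cmod \<xi> \<le> 2 * \<rho>" using inq that by simp
          moreover have "cmod p \<le> 2 * \<rho>" using p(1) \<rho> by (simp add: d_def)
          ultimately have "dist (F p \<xi>) (F 0 \<xi>) < e * \<rho> / 4"
            using d2(2)[of "(0, \<xi>)" "(p, \<xi>)"] \<rho> by simp
          then show ?thesis by (simp add: g_def dist_norm)
        qed
      qed (use \<rho> in auto)
      moreover have "deriv g q = D p q - D 0 q"
      proof (rule DERIV_imp_deriv)
        have "q \<in> ball 0 r" using subsetD[OF sub, of q] \<rho> by simp
        then show "(g has_field_derivative D p q - D 0 q) (at q)"
          unfolding g_def using D pin by (intro derivative_intros) auto
      qed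
      ultimately have "dist (D p q) (D 0 q) \<le> e / 4" using \<rho> by (simp add: dist_norm)
      moreover have "dist (D 0 q) (D 0 0) < e / 2" using d1(2)[of q] p(2) by (simp add: d_def)
      ultimately show ?thesis using dist_triangle[of "D p q" "D 0 0" "D 0 q"] e by linarith
    qed
    moreover have "d > 0" using \<rho> d1 d2 by (simp add: d_def)
    ultimately show "\<exists>d>0. \<forall>x\<in>ball 0 r \<times> ball 0 r. dist x (0, 0) < d \<longrightarrow>
        dist (case x of (p, q) \<Rightarrow> D p q) (case (0, 0) of (p, q) \<Rightarrow> D p q) < e"
      by (intro exI[of _ d]) auto
  qed
  have contB: "continuous (at (0, 0) within ball 0 r \<times> ball 0 r) (\<lambda>(p, q). blinfun_mult_right (D p q))"
    using bounded_linear.continuous[OF bounded_linear_blinfun_mult_right contD]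
    by (simp add: case_prod_unfold)
  define A where "A = deriv (\<lambda>p. F p 0) 0"
  have A: "((\<lambda>p. F p 0) has_derivative (\<lambda>h. A * h)) (at 0 within ball 0 r)"
    using holomorphic_derivI[OF h1[of 0] open_ball, of 0] r
    by (auto simp: A_def has_field_derivative_def intro: has_derivative_at_withinI)
  \<comment> \<open>One partial derivative at the point together with continuity of the other there
    gives the total derivative.\<close>
  have "((\<lambda>(p, q). F p q) has_derivative (\<lambda>(tx, ty). A * tx + blinfun_mult_right (D 0 0) ty)) (at (0, 0) within ball 0 r \<times> ball 0 r)"
  proof (rule has_derivative_partialsI[where f = F and fy = "\<lambda>p q. blinfun_mult_right (D p q)", OF A _ contB])
    show "(F p has_derivative blinfun_apply (blinfun_mult_right (D p q))) (at q within ball 0 r)"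
      if "p \<in> ball 0 r" "q \<in> ball 0 r" for p q
      using D[OF that] by (auto simp: has_field_derivative_def blinfun_mult_right.rep_eq intro: has_derivative_at_withinI)
  qed (use r in auto)
  then have total: "((\<lambda>(p, q). F p q) has_derivative (\<lambda>(tx, ty). A * tx + D 0 0 * ty)) (at (0, 0))"
    using r by (subst (asm) at_within_open) (auto simp: open_Times blinfun_mult_right.rep_eq)
  have "((\<lambda>\<zeta>. (\<zeta> * \<alpha>, \<zeta> * \<beta>)) has_derivative (\<lambda>h. (h * \<alpha>, h * \<beta>))) (at 0)"
    by (intro derivative_eq_intros) auto
  from has_derivative_compose[OF this, of "\<lambda>(p, q). F p q" "\<lambda>(tx, ty). A * tx + D 0 0 * ty"] total
  have "((\<lambda>\<zeta>. F (\<zeta> * \<alpha>) (\<zeta> * \<beta>)) has_derivative (\<lambda>h. A * (h * \<alpha>) + D 0 0 * (h * \<beta>))) (at 0)"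
    by simp
  moreover have "(\<lambda>h. A * (h * \<alpha>) + D 0 0 * (h * \<beta>)) = (*) (A * \<alpha> + D 0 0 * \<beta>)"
    by (auto simp: algebra_simps)
  ultimately show ?thesis
    unfolding field_differentiable_def has_field_derivative_def by metis
qed

section \<open>Holomorphic functions along complex lines\<close>

lemma along_shift: "along a b \<zeta> = along (along a b \<zeta>0) b (\<zeta> - \<zeta>0)"
  by (auto simp: along_def algebra_simps)

lemma along_in_Cn: "a \<in> Cn n \<Longrightarrow> b \<in> Cn n \<Longrightarrow> along a b \<zeta> \<in> Cn n"
  by (simp add: along_def Cn_def)

text \<open>A nonempty open subset of \<open>Cn n\<close> is not open among all sequences, hence the
  condition on the range of g.\<close>

lemma openin_Cn_preimage:
  assumes "Cn_open n S" "continuous_on UNIV g" "range g \<subseteq> Cn n"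
  shows "open (g -` S)"
proof -
  obtain T where T: "open T" "S = Cn n \<inter> T" using assms(1) unfolding openin_open by blast
  have "g -` S = g -` T" using T(2) assms(3) by blast
  then show ?thesis using open_vimage[OF T(1) assms(2)] by simp
qed

text \<open>\<open>holo_on\<close> gives differentiability in coordinate directions only. Induction
  on the number of coordinates in which b may be nonzero: b splits into a part b' with one
  coordinate fewer and a multiple of a unit vector. Osgood's lemma in these two directions combines
  the induction hypothesis with the definition.\<close>

lemma holo_on_along_at_0:
  assumes f: "holo_on n S f" and S: "Cn_open n S" and "k \<le> n" "\<forall>m\<ge>k. b m = 0" "a \<in> S"
  shows "(\<lambda>\<zeta>. f (along a b \<zeta>)) field_differentiable (at 0)"
  using assms(3-5)
proof (induction k arbitrary: a b)
  case 0
  then have "along a b \<zeta> = a" for \<zeta> by (simp add: along_def)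
  then show ?case by simp
next
  case (Suc k)
  have SC: "S \<subseteq> Cn n" by (rule openin_imp_subset[OF S])
  define b' where "b' = b(k := 0)"
  define e :: "nat \<Rightarrow> complex" where "e = (\<lambda>_. 0)(k := 1)"
  have b'k: "\<forall>m\<ge>k. b' m = 0"
  proof (intro allI impI)
    fix m assume "k \<le> m"
    then show "b' m = 0" using Suc.prems(2) by (cases "m = k") (auto simp: b'_def)
  qed
  have b'n: "b' \<in> Cn n" "e \<in> Cn n" using b'k Suc.prems(1) by (auto simp: Cn_def e_def)
  \<comment> \<open>The complex plane through a spanned by b' and the k-th unit vector. f is
    separately holomorphic on it near a, and b is the direction (1, b k).\<close>
  define g where "g x = along (along a b' (fst x)) e (snd x)" for x
  have g_cont: "continuous_on UNIV g"
    unfolding g_def along_def by (intro continuous_on_coordinatewise_then_product continuous_intros)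
  have g_ran: "range g \<subseteq> Cn n"
    unfolding g_def using along_in_Cn b'n Suc.prems(3) SC by blast
  have "open (g -` S)" by (rule openin_Cn_preimage[OF S g_cont g_ran])
  moreover have "(0, 0) \<in> g -` S" using Suc.prems(3) by (simp add: g_def)
  ultimately obtain U V where UV: "open U" "open V" "(0, 0) \<in> U \<times> V" "U \<times> V \<subseteq> g -` S"
    by (rule open_prod_elim) auto
  obtain r1 r2 where r12: "r1 > 0" "ball 0 r1 \<subseteq> U" "r2 > 0" "ball 0 r2 \<subseteq> V"
    using UV(1-3) by (metis SigmaE2 openE)
  define r where "r = min r1 r2"
  have r: "r > 0" "g x \<in> S" if "x \<in> ball 0 r \<times> ball 0 r" for x
    using r12 UV(4) that by (auto simp: r_def subset_iff)
  have r0: "r > 0" using r12 by (simp add: r_def)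
  define F where "F p q = f (g (p, q))" for p q
  have "(\<lambda>\<zeta>. F (\<zeta> * 1) (\<zeta> * b k)) field_differentiable (at 0)"
  proof (rule osgood_two_variables[OF r0])
    have cf: "continuous_on S f" using f by (simp add: holo_on_def)
    show "continuous_on (ball 0 r \<times> ball 0 r) (\<lambda>p. F (fst p) (snd p))"
      unfolding F_def using r(2) continuous_on_subset[OF g_cont, of "ball 0 r \<times> ball 0 r"]
      by (intro continuous_on_compose2[OF cf]) auto
    show "(\<lambda>p. F p q) holomorphic_on ball 0 r" if q: "q \<in> ball 0 r" for q
      unfolding holomorphic_on_def
    proof
      fix p0 :: complex assume p0: "p0 \<in> ball 0 r"
      have "g (p0, q) \<in> S" using r(2) p0 q by blast
      then have d: "(\<lambda>\<zeta>. f (along (g (p0, q)) b' \<zeta>)) field_differentiable (at 0)"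
        using Suc.IH[OF _ b'k] Suc.prems(1) by simp
      have "F p q = f (along (g (p0, q)) b' (p - p0))" for p
        unfolding F_def g_def along_def by (simp add: algebra_simps)
      moreover have "(\<lambda>p. f (along (g (p0, q)) b' (p - p0))) field_differentiable (at p0)"
        using field_differentiable_compose[of "\<lambda>p. p - p0" p0 "\<lambda>\<zeta>. f (along (g (p0, q)) b' \<zeta>)"] d
        by (simp add: o_def field_differentiable_diff)
      ultimately show "(\<lambda>p. F p q) field_differentiable at p0 within ball 0 r"
        by (simp add: field_differentiable_at_within)
    qed
    show "F p holomorphic_on ball 0 r" if p: "p \<in> ball 0 r" for p
      unfolding holomorphic_on_def
    proof
      fix q0 :: complex assume q0: "q0 \<in> ball 0 r"
      define a' where "a' = g (p, q0)"
      have "a' \<in> S" using r(2) p q0 unfolding a'_def by blast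
      then have d: "(\<lambda>\<zeta>. f (a'(k := \<zeta>))) field_differentiable (at (a' k))"
        using f Suc.prems(1) by (simp add: holo_on_def)
      have "F p q = f (a'(k := a' k + (q - q0)))" for q
      proof -
        have "g (p, q) = a'(k := a' k + (q - q0))"
          unfolding a'_def g_def along_def e_def by (auto simp: fun_eq_iff)
        then show ?thesis by (simp add: F_def)
      qed
      moreover have "(\<lambda>q. f (a'(k := a' k + (q - q0)))) field_differentiable (at q0)"
        using field_differentiable_compose[of "\<lambda>q. a' k + (q - q0)" q0 "\<lambda>\<zeta>. f (a'(k := \<zeta>))"] d
        by (simp add: o_def field_differentiable_diff field_differentiable_add)
      ultimately show "F p field_differentiable at q0 within ball 0 r"
        by (metis (no_types, lifting) ext field_differentiable_at_within)
    qed
  qed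
  moreover have "F (\<zeta> * 1) (\<zeta> * b k) = f (along a b \<zeta>)" for \<zeta>
    unfolding F_def g_def along_def b'_def e_def by (rule arg_cong[of _ _ f]) (auto simp: fun_eq_iff)
  ultimately show ?case by simp
qed

lemma holo_on_along:
  assumes "holo_on n S f" "Cn_open n S" "b \<in> Cn n"
  shows "(\<lambda>\<zeta>. f (along a b \<zeta>)) holomorphic_on {\<zeta>. along a b \<zeta> \<in> S}"
  unfolding holomorphic_on_def
proof
  fix \<zeta>0 assume "\<zeta>0 \<in> {\<zeta>. along a b \<zeta> \<in> S}"
  then have "(\<lambda>\<zeta>. f (along (along a b \<zeta>0) b \<zeta>)) field_differentiable (at 0)"
    using holo_on_along_at_0[OF assms(1,2), of n] assms(3) by (simp add: Cn_def)
  then have "(\<lambda>\<zeta>. f (along (along a b \<zeta>0) b (\<zeta> - \<zeta>0))) field_differentiable (at \<zeta>0)"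
    using field_differentiable_compose[of "\<lambda>\<zeta>. \<zeta> - \<zeta>0" \<zeta>0 "\<lambda>\<zeta>. f (along (along a b \<zeta>0) b \<zeta>)"]
    by (simp add: o_def field_differentiable_diff)
  then show "(\<lambda>\<zeta>. f (along a b \<zeta>)) field_differentiable at \<zeta>0 within {\<zeta>. along a b \<zeta> \<in> S}"
    by (subst along_shift[of a b _ \<zeta>0]) (rule field_differentiable_at_within)
qed

text \<open>Rescaling a frame by a holomorphic function without zeros changes the weight by such a
  term. On each disc k has a holomorphic logarithm, so the term is the real part of a holomorphic
  function and c may have either sign.\<close>

lemma psh_on_add_log:
  assumes v: "psh_on n D v" and D: "Cn_open n D"
    and k: "continuous_on D k" "\<And>a. a \<in> D \<Longrightarrow> k a \<noteq> 0"
    and hol: "\<And>a b. a \<in> D \<Longrightarrow> b \<in> Cn n \<Longrightarrow> (\<lambda>\<zeta>. k (along a b \<zeta>)) holomorphic_on {\<zeta>. along a b \<zeta> \<in> D}"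
  shows "psh_on n D (\<lambda>a. v a + ereal (c * ln (cmod (k a))))"
proof (rule psh_onI)
  show "v a + ereal (c * ln (cmod (k a))) \<noteq> \<infinity>" if "a \<in> D" for a
    using psh_onD(1)[OF v that] by (cases "v a") auto
  show "usc_on D (\<lambda>a. v a + ereal (c * ln (cmod (k a))))"
    using k by (intro usc_on_add_continuous psh_onD(2)[OF v] continuous_intros) auto
  fix a b assume ab: "a \<in> D" "b \<in> Cn n" "along a b ` cball 0 1 \<subseteq> D"
  have DC: "D \<subseteq> Cn n" by (rule openin_imp_subset[OF D])
  define \<Omega> where "\<Omega> = {\<zeta>. along a b \<zeta> \<in> D}"
  have "range (along a b) \<subseteq> Cn n" using along_in_Cn ab(1,2) DC by blast
  then have "open \<Omega>"
    using openin_Cn_preimage[OF D continuous_on_along_disc[of UNIV a b]] by (simp add: \<Omega>_def vimage_def)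
  moreover have "cball 0 1 \<subseteq> \<Omega>" using ab(3) by (auto simp: \<Omega>_def)
  ultimately obtain e where e: "e > 0" "(\<Union>x\<in>cball 0 1. cball x e) \<subseteq> \<Omega>"
    using compact_subset_open_imp_cball_epsilon_subset[of "cball 0 1" \<Omega>] by auto
  \<comment> \<open>The logarithm is taken on a slightly larger open disc, which makes it continuous
    up to the unit circle.\<close>
  have sub: "ball 0 (1 + e) \<subseteq> \<Omega>"
  proof
    fix z :: complex assume z: "z \<in> ball 0 (1 + e)"
    show "z \<in> \<Omega>"
    proof (cases "cmod z \<le> 1")
      case True
      then show ?thesis using \<open>cball 0 1 \<subseteq> \<Omega>\<close> by auto
    next
      case False
      define x where "x = z / of_real (cmod z)"
      have "cmod x = 1" using False by (auto simp: x_def norm_divide)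
      have "z = of_real (cmod z) * x" using False by (auto simp: x_def)
      then have "z - x = of_real (cmod z - 1) * x"
        by (metis left_diff_distrib mult_1 of_real_1 of_real_diff)
      then have "cmod (z - x) = \<bar>cmod z - 1\<bar>"
        using \<open>cmod x = 1\<close> by (metis mult.right_neutral norm_mult norm_of_real)
      then have "dist x z = cmod z - 1"
        using False by (simp add: dist_norm norm_minus_commute)
      then have "z \<in> cball x e" using z by simp
      moreover have "x \<in> cball 0 1" using \<open>cmod x = 1\<close> by simp
      ultimately show ?thesis using e(2) by blast
    qed
  qed
  have "(\<lambda>\<zeta>. k (along a b \<zeta>)) holomorphic_on ball 0 (1 + e)"
    using hol[OF ab(1,2)] sub holomorphic_on_subset unfolding \<Omega>_def by blast
  moreover have "k (along a b \<zeta>) \<noteq> 0" if "\<zeta> \<in> ball 0 (1 + e)" for \<zeta>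
    using k(2) sub that by (auto simp: \<Omega>_def)
  ultimately obtain g where g: "g holomorphic_on ball 0 (1 + e)"
    "\<And>\<zeta>. \<zeta> \<in> ball 0 (1 + e) \<Longrightarrow> exp (g \<zeta>) = k (along a b \<zeta>)"
    using holomorphic_logarithm_exists[of "ball 0 (1 + e)" "\<lambda>\<zeta>. k (along a b \<zeta>)" 0] e(1) by auto
  define h where "h \<zeta> = of_real c * g \<zeta>" for \<zeta>
  have sb: "cball 0 1 \<subseteq> ball 0 (1 + e)" "ball 0 1 \<subseteq> ball 0 (1 + e)" using e(1) by auto
  have "h holomorphic_on ball 0 (1 + e)"
    unfolding h_def using g(1) by (intro holomorphic_intros)
  then have h: "continuous_on (cball 0 1) h" "h holomorphic_on ball 0 1"
    using holomorphic_on_imp_continuous_on continuous_on_subset holomorphic_on_subset sb by blast+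
  have t: "disc_test (\<lambda>\<zeta>. v (along a b \<zeta>) + ereal (Re (h \<zeta>)))"
    by (rule disc_test_add_Re[OF psh_onD(3)[OF v ab] h])
  have eq: "ereal (c * ln (cmod (k (along a b \<zeta>)))) = ereal (Re (h \<zeta>))" if "\<zeta> \<in> cball 0 1" for \<zeta>
    using g(2)[of \<zeta>, symmetric] that e(1) by (simp add: h_def)
  show "disc_test (\<lambda>\<zeta>. v (along a b \<zeta>) + ereal (c * ln (cmod (k (along a b \<zeta>)))))"
  proof -
    have "disc_test (\<lambda>\<zeta>. v (along a b \<zeta>) + ereal (c * ln (cmod (k (along a b \<zeta>))))) \<longleftrightarrow>
        disc_test (\<lambda>\<zeta>. v (along a b \<zeta>) + ereal (Re (h \<zeta>)))"
      by (rule disc_test_cong) (simp only: eq)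
    with t show ?thesis by blast
  qed
qed

section \<open>Equilibrium weights depending on a parameter\<close>

lemma manifold_chart:
  assumes "complex_manifold n X" "(S, p) \<in> X"
  shows "Cn_open n S" "inj_on p S"
  using assms unfolding complex_manifold_def by auto

lemma chart_preimage_open:
  assumes "(S, p) \<in> X" "openin (mtop X) W"
  shows "openin (top_of_set S) {s\<in>S. p s \<in> W}"
  using assms unfolding openin_mtop mopen_def by auto

lemma chart_preimage_Cn_open:
  assumes "complex_manifold n X" "(S, p) \<in> X" "openin (mtop X) W"
  shows "Cn_open n {s\<in>S. p s \<in> W}"
  using chart_preimage_open[OF assms(2,3)] manifold_chart(1)[OF assms(1,2)] openin_trans by blast

text \<open>In the final topology openness has to be checked in every chart q. There the set is the
  preimage of T under the transition map, whose coordinates are holomorphic below n and zero from n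
  on, hence continuous.\<close>

lemma chart_image_open:
  assumes X: "complex_manifold n X" and Sp: "(S, p) \<in> X" and T: "openin (top_of_set S) T"
  shows "openin (mtop X) (p ` T)"
  unfolding openin_mtop mopen_def
proof (intro conjI ballI, goal_cases)
  case 1
  show ?case using openin_imp_subset[OF T] Sp unfolding mcarrier_def by blast
next
  case (2 c)
  obtain S' q where c: "c = (S', q)" by (cases c)
  then have Sq: "(S', q) \<in> X" using 2 by simp
  note S = manifold_chart[OF X Sp] and S' = manifold_chart[OF X Sq]
  define R where "R = {s\<in>S'. q s \<in> p ` S}"
  define g where "g s = the_inv_into S p (q s)" for s
  have R: "Cn_open n R" and hol: "\<And>m. m < n \<Longrightarrow> holo_on n R (\<lambda>s. g s m)"
    using X Sp Sq unfolding complex_manifold_def R_def g_def by blast+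
  have gS: "g s \<in> S" "p (g s) = q s" if "s \<in> R" for s
    using that S(2) unfolding R_def g_def by (auto simp: the_inv_into_into f_the_inv_into_f)
  have "continuous_on R (\<lambda>s. g s m)" for m
  proof (cases "m < n")
    case True
    then show ?thesis using hol unfolding holo_on_def by blast
  next
    case False
    have "g s m = 0" if "s \<in> R" for s
      using gS(1)[OF that] openin_imp_subset[OF S(1)] False by (auto simp: Cn_def)
    then show ?thesis by (simp add: continuous_on_cong[of R R _ "\<lambda>_. 0"])
  qed
  then have "continuous_on R g" by (rule continuous_on_coordinatewise_then_product)
  then have "openin (top_of_set R) (R \<inter> g -` T)"
    using gS(1) T by (intro continuous_openin_preimage[of R g S]) auto
  moreover have "R \<inter> g -` T = {s\<in>S'. q s \<in> p ` T}"
  proof -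
    have "g s \<in> T" if "s \<in> S'" "q s = p a" "a \<in> T" for s a
    proof -
      have "a \<in> S" using that(3) openin_imp_subset[OF T] by blast
      then have "g s = a" using that S(2) by (simp add: g_def the_inv_into_f_f)
      then show ?thesis using that by simp
    qed
    moreover have "q s \<in> p ` T" if "s \<in> R" "g s \<in> T" for s
      using gS(2)[OF that(1)] that(2) by (metis imageI)
    moreover have "s \<in> R" if "s \<in> S'" "q s \<in> p ` T" for s
      using that openin_imp_subset[OF T] unfolding R_def by blast
    moreover have "R \<subseteq> S'" by (auto simp: R_def)
    ultimately show ?thesis unfolding vimage_def by blast
  qed
  moreover have "openin (top_of_set S') R"
    using openin_subset_trans[OF R _ openin_imp_subset[OF S'(1)]] by (auto simp: R_def)
  ultimately show ?case unfolding c using openin_trans by fastforce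
qed

lemma mcarrier_chart:
  assumes "x \<in> mcarrier X"
  obtains S p s where "(S, p) \<in> X" "s \<in> S" "x = p s"
  using assms unfolding mcarrier_def by auto

text \<open>Continuity of the weights in (t, x) jointly is what makes candidates for nearby
  parameters approximate candidates at t0.\<close>

locale weight_family =
  fixes n :: nat and X :: "'x atlas" and V :: "'k \<Rightarrow> 'x set" and \<theta> :: "real \<Rightarrow> 'k \<Rightarrow> 'x \<Rightarrow> real"
  assumes manifold: "complex_manifold n X"
    and open_V: "openin (mtop X) (V k)"
    and continuous_weight: "(S, p) \<in> X \<Longrightarrow>
      continuous_on ({0..1} \<times> {s\<in>S. p s \<in> V k}) (\<lambda>z. \<theta> (fst z) k (p (snd z)))"
begin

definition cand :: "real \<Rightarrow> ('x \<Rightarrow> ereal) set" where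
  "cand t = equilibrium_candidates n X V (\<theta> t)"

definition near :: "real \<Rightarrow> real \<Rightarrow> 'x set \<Rightarrow> (real \<times> 'x \<times> ('x \<Rightarrow> ereal)) set" where
  "near t0 \<delta> W = {(t, y, \<psi>). t \<in> {0..1} \<and> \<bar>t - t0\<bar> < \<delta> \<and> y \<in> W \<and> \<psi> \<in> cand t}"

text \<open>
  Regularizing in x and in the parameter simultaneously yields a candidate as well, so the result is
  no larger than the envelope itself.  This gives semicontinuity of the envelope in both variables.
\<close>

definition envelope :: "real \<Rightarrow> 'x \<Rightarrow> ereal" where
  "envelope t0 x = (INF (\<delta>, W)\<in>{(\<delta>, W). 0 < \<delta> \<and> openin (mtop X) W \<and> x \<in> W}.
     SUP (t, y, \<psi>)\<in>near t0 \<delta> W. \<psi> y)"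

lemma candD:
  assumes "\<psi> \<in> cand t"
  shows "x \<in> mcarrier X \<Longrightarrow> \<psi> x \<noteq> \<infinity>" "x \<in> mcarrier X \<Longrightarrow> \<psi> x \<le> 0"
    "(S, p) \<in> X \<Longrightarrow> psh_on n {s\<in>S. p s \<in> V k} (\<lambda>s. ereal (\<theta> t k (p s)) + \<psi> (p s))"
  using assms unfolding cand_def equilibrium_candidates_def mpsh_on_def by (auto simp: o_def)

lemma envelope_less:
  assumes "envelope t0 x < c"
  obtains \<delta> W where "0 < \<delta>" "openin (mtop X) W" "x \<in> W"
    "\<And>t y \<psi>. t \<in> {0..1} \<Longrightarrow> \<bar>t - t0\<bar> < \<delta> \<Longrightarrow> y \<in> W \<Longrightarrow> \<psi> \<in> cand t \<Longrightarrow> \<psi> y < c"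
proof -
  obtain \<delta> W where dW: "0 < \<delta>" "openin (mtop X) W" "x \<in> W"
    and less: "(SUP (t, y, \<psi>)\<in>near t0 \<delta> W. \<psi> y) < c"
    using assms unfolding envelope_def INF_less_iff by auto
  have "\<psi> y < c" if "t \<in> {0..1}" "\<bar>t - t0\<bar> < \<delta>" "y \<in> W" "\<psi> \<in> cand t" for t y \<psi>
    using SUP_lessD[OF less, of "(t, y, \<psi>)"] that by (simp add: near_def)
  with dW show ?thesis by (intro that[of \<delta> W])
qed

lemma envelope_approx:
  assumes "c < envelope t0 x" "0 < \<delta>" "openin (mtop X) W" "x \<in> W"
  obtains t y \<psi> where "t \<in> {0..1}" "\<bar>t - t0\<bar> < \<delta>" "y \<in> W" "\<psi> \<in> cand t" "c < \<psi> y"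
proof -
  have "envelope t0 x \<le> (SUP (t, y, \<psi>)\<in>near t0 \<delta> W. \<psi> y)"
    unfolding envelope_def using assms(2-4) by (intro INF_lower2[of "(\<delta>, W)"]) auto
  with assms(1) have "c < (SUP (t, y, \<psi>)\<in>near t0 \<delta> W. \<psi> y)" by order
  then obtain z where "z \<in> near t0 \<delta> W" "c < (case z of (t, y, \<psi>) \<Rightarrow> \<psi> y)"
    unfolding less_SUP_iff by blast
  then show ?thesis using that by (auto simp: near_def)
qed

lemma cand_le_envelope:
  assumes "\<psi> \<in> cand t" "t \<in> {0..1}"
  shows "\<psi> x \<le> envelope t x"
  unfolding envelope_def
proof (rule INF_greatest, clarify)
  fix \<delta> :: real and W assume "0 < \<delta>" "openin (mtop X) W" "x \<in> W"
  then show "\<psi> x \<le> (SUP (t, y, \<psi>)\<in>near t \<delta> W. \<psi> y)"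
    using assms by (intro SUP_upper2[of "(t, x, \<psi>)"]) (auto simp: near_def)
qed

lemma envelope_le_0:
  assumes "x \<in> mcarrier X"
  shows "envelope t x \<le> 0"
proof -
  have "openin (mtop X) (mcarrier X)" by (metis openin_topspace topspace_mtop)
  then have "envelope t x \<le> (SUP (t, y, \<psi>)\<in>near t 1 (mcarrier X). \<psi> y)"
    unfolding envelope_def using assms by (intro INF_lower2[of "(1, mcarrier X)"]) auto
  also have "\<dots> \<le> 0" by (intro SUP_least) (auto simp: near_def candD(2))
  finally show ?thesis .
qed

lemma envelope_usc:
  assumes "envelope t0 x < c"
  obtains \<delta> W where "0 < \<delta>" "openin (mtop X) W" "x \<in> W"
    "\<And>t y. \<bar>t - t0\<bar> < \<delta> \<Longrightarrow> y \<in> W \<Longrightarrow> envelope t y < c"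
proof -
  obtain c' where c': "envelope t0 x < c'" "c' < c" using dense[OF assms] by blast
  obtain \<delta> W where dW: "0 < \<delta>" "openin (mtop X) W" "x \<in> W"
    "\<And>t y \<psi>. t \<in> {0..1} \<Longrightarrow> \<bar>t - t0\<bar> < \<delta> \<Longrightarrow> y \<in> W \<Longrightarrow> \<psi> \<in> cand t \<Longrightarrow> \<psi> y < c'"
    using envelope_less[OF c'(1)] by metis
  \<comment> \<open>Half the radius, so that parameters within \<delta> / 2 of t are within \<delta>
    of t0.\<close>
  have "envelope t y < c" if t: "\<bar>t - t0\<bar> < \<delta> / 2" and y: "y \<in> W" for t y
  proof -
    have "envelope t y \<le> (SUP (t, y, \<psi>)\<in>near t (\<delta> / 2) W. \<psi> y)"
      unfolding envelope_def using dW y by (intro INF_lower2[of "(\<delta> / 2, W)"]) auto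
    also have "\<dots> \<le> c'"
    proof (rule SUP_least, clarify)
      fix t' y' \<psi> assume "(t', y', \<psi>) \<in> near t (\<delta> / 2) W"
      then have "t' \<in> {0..1}" "\<bar>t' - t\<bar> < \<delta> / 2" "y' \<in> W" "\<psi> \<in> cand t'" by (auto simp: near_def)
      moreover from this(2) t have "\<bar>t' - t0\<bar> < \<delta>" by linarith
      ultimately show "\<psi> y' \<le> c'" using dW(4) less_imp_le by blast
    qed
    finally show ?thesis using c'(2) by order
  qed
  with dW show ?thesis by (intro that[of "\<delta> / 2" W]) auto
qed

lemma usc_on_envelope_chart:
  assumes "(S, p) \<in> X"
  shows "usc_on (UNIV \<times> S) (\<lambda>z. envelope (fst z) (p (snd z)))"
  unfolding usc_on_def
proof (safe, simp)
  fix t0 s0 c assume s0: "s0 \<in> S" and less: "envelope t0 (p s0) < c"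
  obtain \<delta> W where dW: "0 < \<delta>" "openin (mtop X) W" "p s0 \<in> W"
    "\<And>t y. \<bar>t - t0\<bar> < \<delta> \<Longrightarrow> y \<in> W \<Longrightarrow> envelope t y < c"
    using envelope_usc[OF less] by metis
  obtain N where N: "open N" "{s\<in>S. p s \<in> W} = S \<inter> N"
    using chart_preimage_open[OF assms dW(2)] unfolding openin_open by blast
  show "\<exists>N. open N \<and> (t0, s0) \<in> N \<and> (\<forall>z\<in>N \<inter> UNIV \<times> S. envelope (fst z) (p (snd z)) < c)"
  proof (intro exI conjI ballI)
    show "open (ball t0 \<delta> \<times> N)" using N by (intro open_Times) auto
    show "(t0, s0) \<in> ball t0 \<delta> \<times> N" using dW N s0 by auto
    fix z assume "z \<in> (ball t0 \<delta> \<times> N) \<inter> UNIV \<times> S"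
    then have "\<bar>fst z - t0\<bar> < \<delta>" "snd z \<in> S \<inter> N" by (auto simp: dist_real_def)
    then show "envelope (fst z) (p (snd z)) < c" using dW(4) N(2) by blast
  qed
qed

text \<open>The envelope at p a is approached by values \<psi> y of candidates with (t, y) near (t0,
  p a), not at the center of the given disc. The disc is therefore translated to the coordinates a'
  of y: semicontinuity in (t, x) preserves the bound on its boundary up to e, and the disc test for
  \<psi> carries it to y.\<close>

lemma envelope_psh:
  assumes t0: "t0 \<in> {0..1}" and Sp: "(S, p) \<in> X"
  shows "psh_on n {s\<in>S. p s \<in> V k} (\<lambda>s. ereal (\<theta> t0 k (p s)) + envelope t0 (p s))"
proof -
  define T where "T = {s\<in>S. p s \<in> V k}"
  define u where "u t s = envelope t (p s) + ereal (\<theta> t k (p s))" for t s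
  have S: "Cn_open n S" by (rule manifold_chart(1)[OF manifold Sp])
  have T: "Cn_open n T" unfolding T_def by (rule chart_preimage_Cn_open[OF manifold Sp open_V])
  have TC: "T \<subseteq> Cn n" by (rule openin_imp_subset[OF T])
  have carrier: "p s \<in> mcarrier X" if "s \<in> S" for s using that Sp unfolding mcarrier_def by blast
  have ufin: "u t s \<noteq> \<infinity>" if "s \<in> T" for t s
    using envelope_le_0[of "p s" t] carrier[of s] that by (cases "envelope t (p s)") (auto simp: u_def T_def)
  have usc_u: "usc_on ({0..1} \<times> T) (\<lambda>z. u (fst z) (snd z))"
    unfolding u_def
    by (intro usc_on_add_continuous usc_on_subset[OF usc_on_envelope_chart[OF Sp]])
       (use continuous_weight[OF Sp, of k] in \<open>auto simp: T_def\<close>)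
  have "psh_on n T (u t0)"
  proof (rule psh_onI)
    show "u t0 s \<noteq> \<infinity>" if "s \<in> T" for s using ufin[OF that] .
    have "continuous_on T (\<lambda>s. (t0, s))" by (intro continuous_intros)
    moreover have "(\<lambda>s. (t0, s)) ` T \<subseteq> {0..1} \<times> T" using t0 by auto
    ultimately show "usc_on T (u t0)" using usc_on_compose[OF usc_u, of T "\<lambda>s. (t0, s)"] by simp
    fix a b assume ab: "a \<in> T" "b \<in> Cn n" "along a b ` cball 0 1 \<subseteq> T"
    have aS: "a \<in> S" using ab(1) by (simp add: T_def)
    show "disc_test (\<lambda>\<zeta>. u t0 (along a b \<zeta>))"
      unfolding disc_test_def
    proof (intro allI impI, rule ereal_le_epsilon2)
      fix G and \<epsilon> :: real
      assume G: "continuous_on (cball 0 1) G" "G holomorphic_on ball 0 1"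
        "\<forall>\<zeta>\<in>sphere 0 1. u t0 (along a b \<zeta>) \<le> ereal (Re (G \<zeta>))" and "0 < \<epsilon>"
      \<comment> \<open>One half of \<epsilon> pays for translating the boundary bound, the other
        for the change of the weight at the center.\<close>
      define e where "e = \<epsilon> / 2"
      have e: "0 < e" using \<open>0 < \<epsilon>\<close> by (simp add: e_def)
      \<comment> \<open>Centers whose translated disc stays in the domain; by compactness of the
        disc all points of \<open>Cn n\<close> near a qualify.\<close>
      define A where "A = {a'\<in>T. along a' b ` cball 0 1 \<subseteq> T}"
      define w where "w z = u (fst (fst z)) (along (snd (fst z)) b (snd z)) + ereal (- Re (G (snd z)))"
        for z :: "(real \<times> (nat \<Rightarrow> complex)) \<times> complex"
      have coord: "continuous_on Z (\<lambda>z. snd (fst z) m)" for Z :: "((real \<times> (nat \<Rightarrow> complex)) \<times> complex) set" and m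
        by (intro continuous_on_product_then_coordinatewise[OF continuous_on_snd[OF continuous_on_fst[OF continuous_on_id]]])
      have c1: "continuous_on (({0..1::real} \<times> A) \<times> sphere 0 1)
          (\<lambda>z. (fst (fst z), along (snd (fst z)) b (snd z)))"
        unfolding along_def by (intro continuous_intros continuous_on_coordinatewise_then_product coord)
      have c2: "(\<lambda>z. (fst (fst z), along (snd (fst z)) b (snd z))) ` (({0..1::real} \<times> A) \<times> sphere 0 1) \<subseteq> {0..1} \<times> T"
        by (force simp: A_def)
      have "usc_on (({0..1} \<times> A) \<times> sphere 0 1) (\<lambda>z. u (fst (fst z)) (along (snd (fst z)) b (snd z)))"
        using usc_on_compose[OF usc_u c1 c2] by simp
      then have uw: "usc_on (({0..1} \<times> A) \<times> sphere 0 1) w"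
        unfolding w_def
        by (intro usc_on_add_continuous continuous_on_minus continuous_on_Re
            continuous_on_compose2[OF G(1) continuous_on_snd[OF continuous_on_id]]) auto
      have aA: "(t0, a) \<in> {0..1} \<times> A" using ab t0 by (simp add: A_def)
      have w0: "w ((t0, a), \<zeta>) < ereal e" if \<zeta>: "\<zeta> \<in> sphere 0 1" for \<zeta>
        using bspec[OF G(3) \<zeta>] e by (cases "u t0 (along a b \<zeta>)") (auto simp: w_def)
      obtain N where N: "open N" "(t0, a) \<in> N"
        "\<And>x \<zeta>. x \<in> N \<Longrightarrow> x \<in> {0..1} \<times> A \<Longrightarrow> \<zeta> \<in> sphere 0 1 \<Longrightarrow> w (x, \<zeta>) < ereal e"
        using usc_on_tube[OF uw compact_sphere aA w0] by metis
      obtain M where M: "open M" "a \<in> M" "\<And>a'. a' \<in> M \<Longrightarrow> a' \<in> Cn n \<Longrightarrow> along a' b ` cball 0 1 \<subseteq> T"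
      proof -
        obtain O' where O': "open O'" "T = Cn n \<inter> O'" using T unfolding openin_open by blast
        have op: "open ((\<lambda>z. along (fst z) b (snd z)) -` O')"
          by (rule open_vimage[OF O'(1) continuous_on_along])
        have sub: "{a} \<times> cball 0 1 \<subseteq> (\<lambda>z. along (fst z) b (snd z)) -` O'"
          using ab(3) O'(2) by auto
        obtain M where M: "a \<in> M" "open M" "M \<times> cball 0 1 \<subseteq> (\<lambda>z. along (fst z) b (snd z)) -` O'"
          using Elementary_Topology.tube_lemma[OF compact_cball op sub] by blast
        have "along a' b \<zeta> \<in> T" if "a' \<in> M" "a' \<in> Cn n" "\<zeta> \<in> cball 0 1" for a' \<zeta>
          using M(3) that along_in_Cn[OF that(2) ab(2)] unfolding O'(2) by fastforce
        then show ?thesis using M by (intro that[of M]) auto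
      qed
      have "continuous_on ({0..1} \<times> T) (\<lambda>z. \<theta> (fst z) k (p (snd z)))"
        using continuous_weight[OF Sp] by (simp add: T_def)
      then have "usc_on ({0..1} \<times> T) (\<lambda>z. 0 + ereal (- \<theta> (fst z) k (p (snd z))))"
        by (intro usc_on_add_continuous continuous_intros) (auto simp: usc_on_def intro!: exI[of _ UNIV])
      moreover have "(t0, a) \<in> {0..1} \<times> T" using ab t0 by simp
      moreover have "0 + ereal (- \<theta> (fst (t0, a)) k (p (snd (t0, a)))) < ereal (e - \<theta> t0 k (p a))"
        using e by simp
      ultimately have "\<exists>N'. open N' \<and> (t0, a) \<in> N' \<and> (\<forall>z\<in>N' \<inter> {0..1} \<times> T. 0 + ereal (- \<theta> (fst z) k (p (snd z))) < ereal (e - \<theta> t0 k (p a)))"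
        unfolding usc_on_def by blast
      then obtain N' where N': "open N'" "(t0, a) \<in> N'"
        "\<And>z. z \<in> N' \<inter> {0..1} \<times> T \<Longrightarrow> \<theta> (fst z) k (p (snd z)) > \<theta> t0 k (p a) - e"
        by force
      obtain U1 U2 where U: "open U1" "open U2" "(t0, a) \<in> U1 \<times> U2" "U1 \<times> U2 \<subseteq> N \<inter> N'"
        using open_prod_elim[OF open_Int[OF N(1) N'(1)]] N(2) N'(2) by (metis IntI)
      obtain \<delta> where \<delta>: "\<delta> > 0" "ball t0 \<delta> \<subseteq> U1" using U(1,3) openE by (metis SigmaE2)
      define W where "W = p ` (T \<inter> (U2 \<inter> M))"
      have "openin (top_of_set S) (T \<inter> (U2 \<inter> M))"
        using chart_preimage_open[OF Sp open_V, of k] U(2) M(1) by (auto simp: T_def intro: openin_Int_open)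
      then have W: "openin (mtop X) W" unfolding W_def by (rule chart_image_open[OF manifold Sp])
      have aW: "p a \<in> W" unfolding W_def using ab(1) U(3) M(2) by blast
      \<comment> \<open>The limit that defines the envelope need not be attained by a candidate, so
        the estimate is made for every real c below it.\<close>
      have main: "ereal c + ereal (\<theta> t0 k (p a)) \<le> ereal (Re (G 0)) + ereal \<epsilon>" if c: "ereal c < envelope t0 (p a)" for c
      proof -
        obtain t y \<psi> where ty: "t \<in> {0..1}" "\<bar>t - t0\<bar> < \<delta>" "y \<in> W" "\<psi> \<in> cand t" "ereal c < \<psi> y"
          using envelope_approx[OF c \<delta>(1) W aW] by metis
        obtain a' where a': "a' \<in> T" "a' \<in> U2" "a' \<in> M" "y = p a'" using ty(3) unfolding W_def by blast
        have tU: "t \<in> U1" using \<delta>(2) ty(2) by (auto simp: dist_real_def abs_minus_commute)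
        have disc: "along a' b ` cball 0 1 \<subseteq> T" using M(3) a' TC by blast
        have inNN: "(t, a') \<in> N" "(t, a') \<in> N'" using U(4) tU a'(2) by blast+
        have inA: "(t, a') \<in> {0..1} \<times> A" using a'(1) disc ty(1) by (simp add: A_def)
        have psh: "psh_on n T (\<lambda>s. ereal (\<theta> t k (p s)) + \<psi> (p s))"
          unfolding T_def by (rule candD(3)[OF ty(4) Sp])
        have "ereal (\<theta> t k (p (along a' b 0))) + \<psi> (p (along a' b 0)) \<le> ereal (Re (G 0 + of_real e))"
        proof (rule disc_testD[OF psh_onD(3)[OF psh a'(1) ab(2) disc]])
          fix \<zeta> :: complex assume \<zeta>: "\<zeta> \<in> sphere 0 1"
          have "w ((t, a'), \<zeta>) < ereal e" by (rule N(3)[OF inNN(1) inA \<zeta>])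
          then have less: "u t (along a' b \<zeta>) + ereal (- Re (G \<zeta>)) < ereal e" by (simp add: w_def)
          have "x \<le> ereal (Re (G \<zeta> + of_real e))" if "x + ereal (- Re (G \<zeta>)) < ereal e" for x
            using that by (cases x) auto
          from this[OF less] have ule: "u t (along a' b \<zeta>) \<le> ereal (Re (G \<zeta> + of_real e))" .
          \<comment> \<open>The boundary bound is known for the envelope; \<psi> inherits it as a
            competitor for the same parameter t.\<close>
          have "\<psi> (p (along a' b \<zeta>)) \<le> envelope t (p (along a' b \<zeta>))"
            by (rule cand_le_envelope[OF ty(4,1)])
          then have "ereal (\<theta> t k (p (along a' b \<zeta>))) + \<psi> (p (along a' b \<zeta>)) \<le> u t (along a' b \<zeta>)"
            unfolding u_def by (subst add.commute) (rule add_right_mono)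
          then show "ereal (\<theta> t k (p (along a' b \<zeta>))) + \<psi> (p (along a' b \<zeta>)) \<le> ereal (Re (G \<zeta> + of_real e))"
            using ule by order
        qed (intro continuous_intros holomorphic_intros G)+
        then have "ereal (\<theta> t k y) + \<psi> y \<le> ereal (Re (G 0) + e)" by (simp add: a'(4))
        moreover have "\<theta> t k y > \<theta> t0 k (p a) - e"
          using N'(3)[of "(t, a')"] inNN(2) a' ty(1) by simp
        ultimately show ?thesis using ty(5) by (cases "\<psi> y") (auto simp: e_def)
      qed
      show "u t0 (along a b 0) \<le> ereal (Re (G 0)) + ereal \<epsilon>"
      proof (cases "envelope t0 (p a)")
        case (real x)
        have "x \<le> Re (G 0) + \<epsilon> - \<theta> t0 k (p a)"
        proof (rule dense_le)
          fix c assume "c < x"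
          then show "c \<le> Re (G 0) + \<epsilon> - \<theta> t0 k (p a)" using main[of c] real by simp
        qed
        then show ?thesis using real by (simp add: u_def)
      next
        case PInf
        then show ?thesis using ufin[OF ab(1), of t0] by (simp add: u_def)
      next
        case MInf
        then show ?thesis by (simp add: u_def)
      qed
    qed
  qed
  then show ?thesis by (simp add: T_def u_def[abs_def] add.commute)
qed

lemma envelope_cand:
  assumes "t \<in> {0..1}"
  shows "envelope t \<in> cand t"
  unfolding cand_def equilibrium_candidates_def mpsh_on_def o_def
  using envelope_le_0[of _ t] envelope_psh[OF assms] by (fastforce split: prod.splits)

text \<open>Regularizing in t as well could only increase the envelope. It does not, because the
  result is again a candidate and so lies below the supremum over candidates.\<close>

lemma equilibrium_weight_eq:
  assumes t: "t \<in> {0..1}"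
  shows "equilibrium_weight n X V (\<theta> t) k x = ereal (\<theta> t k x) + envelope t x"
proof -
  have "(INF W\<in>{W. openin (mtop X) W \<and> x \<in> W}. SUP y\<in>W. SUP \<psi>\<in>cand t. \<psi> y) = envelope t x"
  proof (rule antisym)
    show "(INF W\<in>{W. openin (mtop X) W \<and> x \<in> W}. SUP y\<in>W. SUP \<psi>\<in>cand t. \<psi> y) \<le> envelope t x"
      unfolding envelope_def
    proof (rule INF_greatest, clarify)
      fix \<delta> :: real and W assume dW: "0 < \<delta>" "openin (mtop X) W" "x \<in> W"
      have "(SUP y\<in>W. SUP \<psi>\<in>cand t. \<psi> y) \<le> (SUP (t, y, \<psi>)\<in>near t \<delta> W. \<psi> y)"
      proof (intro SUP_least)
        fix y \<psi> assume "y \<in> W" "\<psi> \<in> cand t"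
        then show "\<psi> y \<le> (SUP (t, y, \<psi>)\<in>near t \<delta> W. \<psi> y)"
          using dW t by (intro SUP_upper2[of "(t, y, \<psi>)"]) (auto simp: near_def)
      qed
      then show "(INF W\<in>{W. openin (mtop X) W \<and> x \<in> W}. SUP y\<in>W. SUP \<psi>\<in>cand t. \<psi> y) \<le> (SUP (t, y, \<psi>)\<in>near t \<delta> W. \<psi> y)"
        using dW by (intro INF_lower2[of W]) auto
    qed
    show "envelope t x \<le> (INF W\<in>{W. openin (mtop X) W \<and> x \<in> W}. SUP y\<in>W. SUP \<psi>\<in>cand t. \<psi> y)"
      by (intro INF_greatest SUP_upper2[of x] SUP_upper2[OF envelope_cand[OF t]]) auto
  qed
  then show ?thesis
    by (simp add: equilibrium_weight_def usc_regularization_def cand_def)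
qed

end

text \<open>Passes from local bounds to one constant by a finite subcover. With a predicate Q
  instead of an inequality, the bound can refer to all frames at a point at once.\<close>

lemma compact_uniform_bound:
  fixes Q :: "'x \<Rightarrow> real \<Rightarrow> bool"
  assumes compact: "compact_space (mtop X)"
    and mono: "\<And>x B B'. Q x B \<Longrightarrow> B \<le> B' \<Longrightarrow> Q x B'"
    and loc: "\<And>x. x \<in> mcarrier X \<Longrightarrow> \<exists>W B. openin (mtop X) W \<and> x \<in> W \<and> (\<forall>y\<in>W. Q y B)"
  obtains B where "\<And>x. x \<in> mcarrier X \<Longrightarrow> Q x B"
proof -
  obtain W B where WB: "\<And>x. x \<in> mcarrier X \<Longrightarrow> openin (mtop X) (W x) \<and> x \<in> W x \<and> (\<forall>y\<in>W x. Q y (B x))"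
    using loc by metis
  have cov: "\<exists>\<F>. finite \<F> \<and> \<F> \<subseteq> W ` mcarrier X \<and> topspace (mtop X) \<subseteq> \<Union>\<F>"
    using compact unfolding compact_space_alt by (rule allE[of _ "W ` mcarrier X"]) (use WB in \<open>force simp: topspace_mtop\<close>)
  then obtain D where D: "D \<subseteq> mcarrier X" "finite D" "mcarrier X \<subseteq> (\<Union>x\<in>D. W x)"
    unfolding topspace_mtop by (metis finite_subset_image)
  \<comment> \<open>The 0 keeps the set nonempty even if X has no points.\<close>
  have "Q x (Max (insert 0 (B ` D)))" if x: "x \<in> mcarrier X" for x
  proof -
    obtain d where d: "d \<in> D" "x \<in> W d" using D(3) x by blast
    then have "Q x (B d)" using WB D(1) by blast
    moreover have "B d \<le> Max (insert 0 (B ` D))" using d D(2) by (intro Max_ge) auto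
    ultimately show ?thesis by (rule mono)
  qed
  then show ?thesis by (rule that)
qed

section \<open>The metric on the projective bundle\<close>

lemma psh_on_subset:
  assumes "psh_on n S u" "T \<subseteq> S"
  shows "psh_on n T u"
proof (rule psh_onI)
  show "u a \<noteq> \<infinity>" if "a \<in> T" for a using psh_onD(1)[OF assms(1)] that assms(2) by blast
  show "usc_on T u" by (rule usc_on_subset[OF psh_onD(2)[OF assms(1)] assms(2)])
  show "disc_test (\<lambda>\<zeta>. u (along a b \<zeta>))" if "a \<in> T" "b \<in> Cn n" "along a b ` cball 0 1 \<subseteq> T" for a b
    using psh_onD(3)[OF assms(1), of a b] that assms(2) by blast
qed

lemma psh_on_cong:
  assumes "\<And>a. a \<in> S \<Longrightarrow> u a = v a"
  shows "psh_on n S u \<longleftrightarrow> psh_on n S v"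
proof -
  have "psh_on n S v" if "psh_on n S u" and eq: "\<And>a. a \<in> S \<Longrightarrow> u a = v a" for u v
  proof (rule psh_onI)
    show "v a \<noteq> \<infinity>" if "a \<in> S" for a using psh_onD(1)[OF \<open>psh_on n S u\<close> that] eq[OF that] by simp
    show "usc_on S v" using psh_onD(2)[OF \<open>psh_on n S u\<close>] usc_on_cong[of S u v] eq by blast
    show "disc_test (\<lambda>\<zeta>. v (along a b \<zeta>))" if ab: "a \<in> S" "b \<in> Cn n" "along a b ` cball 0 1 \<subseteq> S" for a b
      using psh_onD(3)[OF \<open>psh_on n S u\<close> ab]
        disc_test_cong[of "\<lambda>\<zeta>. u (along a b \<zeta>)" "\<lambda>\<zeta>. v (along a b \<zeta>)"] eq ab(3) by blast
  qed
  from this[of u v] this[of v u] assms show ?thesis by (metis (no_types))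
qed

text \<open>Half the exponent of the modulus of the fiber coordinate in the term with parameter t.
  Passing to the frame at infinity exchanges the roles of A and L and therefore of t and 1 -
  t.\<close>

primrec fiber_power :: "('i, 'j) proj_index \<Rightarrow> real \<Rightarrow> real" where
  "fiber_power (NormL i j) t = t"
| "fiber_power (NormA i j) t = 1 - t"

primrec index_pair :: "('i, 'j) proj_index \<Rightarrow> 'i \<times> 'j" where
  "index_pair (NormL i j) = (i, j)"
| "index_pair (NormA i j) = (i, j)"

lemma smooth_metric_continuous:
  assumes "smooth_metric n X B \<phi>" "(S, p) \<in> X"
  shows "continuous_on {s\<in>S. p s \<in> triv B i} (\<lambda>s. \<phi> i (p s))"
proof -
  have "Ck_on n {s\<in>S. p s \<in> triv B i} 0 (\<lambda>s. of_real (\<phi> i (p s)))"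
    using assms unfolding smooth_metric_def msmooth_on_def smooth_on_def by blast
  then have "continuous_on {s\<in>S. p s \<in> triv B i} (\<lambda>s. Re (of_real (\<phi> i (p s))))"
    by (simp only: Ck_on.simps) (rule continuous_on_Re)
  then show ?thesis by simp
qed

lemma line_bundleD:
  assumes "is_line_bundle n X B"
  shows "openin (mtop X) (triv B i)" "(\<Union>i. triv B i) = mcarrier X"
    "mholo_on n X (triv B i \<inter> triv B j) (transition B i j)"
    "x \<in> triv B i \<Longrightarrow> x \<in> triv B j \<Longrightarrow> transition B i j x \<noteq> 0"
    "x \<in> triv B i \<Longrightarrow> transition B i i x = 1"
  using assms unfolding is_line_bundle_def by auto

lemma exp_log_weight:
  assumes "E \<noteq> \<infinity>"
  shows "exp_ereal (log_weight c z + E) = rpow (cmod z) (2 * c) * exp_ereal E"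
  using assms
  by (cases E) (auto simp: exp_ereal_def log_weight_def rpow_def powr_def exp_add)

lemma ln_exp_ereal: "u \<noteq> \<infinity> \<Longrightarrow> ln_ereal (exp_ereal u) = u"
  by (cases u) (auto simp: ln_ereal_def exp_ereal_def)

lemma exp_ereal_mono: "u \<le> v \<Longrightarrow> v \<noteq> \<infinity> \<Longrightarrow> exp_ereal u \<le> exp_ereal v"
  by (cases u; cases v) (auto simp: exp_ereal_def)

text \<open>\<open>GREATEST\<close> denotes a greatest element only if there is one; attainment of
  the supremum at k provides it.\<close>

lemma ln_Greatest_exp:
  assumes "k \<in> K" "(SUP t\<in>K. h t) = h k" "h k \<noteq> \<infinity>"
  shows "ln_ereal (GREATEST y. \<exists>t\<in>K. y = exp_ereal (h t)) = (SUP t\<in>K. h t)"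
proof -
  have "(GREATEST y. \<exists>t\<in>K. y = exp_ereal (h t)) = exp_ereal (h k)"
  proof (rule Greatest_equality)
    show "\<exists>t\<in>K. exp_ereal (h k) = exp_ereal (h t)" using assms(1) by blast
    fix y assume "\<exists>t\<in>K. y = exp_ereal (h t)"
    then obtain t where t: "t \<in> K" "y = exp_ereal (h t)" by blast
    have "h t \<le> h k" unfolding assms(2)[symmetric] by (rule SUP_upper[OF t(1)])
    then show "y \<le> exp_ereal (h k)" unfolding t(2) using assms(3) by (rule exp_ereal_mono)
  qed
  then show ?thesis using assms(2,3) by (simp add: ln_exp_ereal)
qed

section \<open>Coordinates of X and of the total space\<close>

lemma along_Suc: "along a b \<zeta> \<circ> Suc = along (a \<circ> Suc) (b \<circ> Suc) \<zeta>"
  by (simp add: along_def fun_eq_iff)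

lemma Cn_Suc: "b \<in> Cn (Suc n) \<Longrightarrow> b \<circ> Suc \<in> Cn n"
  by (simp add: Cn_def)

lemma Cn_Suc_iff: "u \<circ> Suc \<in> Cn n \<longleftrightarrow> u \<in> Cn (Suc n)"
  unfolding Cn_def mem_Collect_eq o_apply by (metis Suc_le_D Suc_le_mono)

lemma continuous_on_shift: "continuous_on S (\<lambda>u. u \<circ> Suc :: nat \<Rightarrow> complex)"
  unfolding o_def
  by (intro continuous_on_coordinatewise_then_product continuous_on_product_then_coordinatewise[OF continuous_on_id])

lemma continuous_on_coordinate: "continuous_on S (\<lambda>u. u m :: complex)"
  by (rule continuous_on_product_then_coordinatewise[OF continuous_on_id])

lemma Cn_open_shift:
  assumes "Cn_open n T"
  shows "Cn_open (Suc n) {u. u \<circ> Suc \<in> T}"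
proof -
  obtain O' where O': "open O'" "T = Cn n \<inter> O'" using assms unfolding openin_open by blast
  have "open ((\<lambda>u. u \<circ> Suc :: nat \<Rightarrow> complex) -` O')" by (rule open_vimage[OF O'(1) continuous_on_shift])
  moreover have "{u. u \<circ> Suc \<in> T} = Cn (Suc n) \<inter> (\<lambda>u. u \<circ> Suc) -` O'"
    unfolding O'(2) using Cn_Suc_iff by blast
  ultimately show ?thesis unfolding openin_open by blast
qed

locale sum_bundle =
  fixes n :: nat and X :: "'x atlas" and A :: "('x, 'i) line_bundle" and L :: "('x, 'j) line_bundle"
    and \<phi>A :: "'i \<Rightarrow> 'x \<Rightarrow> real" and \<phi>L :: "'j \<Rightarrow> 'x \<Rightarrow> real"
  assumes manifold: "complex_manifold n X"
    and A: "is_line_bundle n X A" and L: "is_line_bundle n X L"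
    and \<phi>A: "smooth_metric n X A \<phi>A" and \<phi>L: "smooth_metric n X L \<phi>L"
begin

definition pair_triv :: "'i \<times> 'j \<Rightarrow> 'x set" where
  "pair_triv = (\<lambda>(i, j). triv A i \<inter> triv L j)"

definition pair_weight :: "real \<Rightarrow> 'i \<times> 'j \<Rightarrow> 'x \<Rightarrow> real" where
  "pair_weight t = (\<lambda>(i, j) x. t * \<phi>A i x + (1 - t) * \<phi>L j x)"

lemma proj_base_pair: "proj_base A L \<alpha> = pair_triv (index_pair \<alpha>)"
  by (cases \<alpha>) (simp_all add: pair_triv_def)

sublocale weight_family n X pair_triv pair_weight
proof
  show "complex_manifold n X" by (rule manifold)
  show "openin (mtop X) (pair_triv k)" for k
    using line_bundleD(1)[OF A] line_bundleD(1)[OF L] by (cases k) (auto simp: pair_triv_def)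
  show "continuous_on ({0..1} \<times> {s\<in>S. p s \<in> pair_triv k}) (\<lambda>z. pair_weight (fst z) k (p (snd z)))"
    if Sp: "(S, p) \<in> X" for S p k
  proof (cases k)
    case (Pair i j)
    let ?T = "{0..1::real} \<times> {s\<in>S. p s \<in> pair_triv k}"
    have "continuous_on ?T (\<lambda>z. \<phi>A i (p (snd z)))"
      using Pair by (intro continuous_on_compose2[OF smooth_metric_continuous[OF \<phi>A Sp, of i] continuous_on_snd[OF continuous_on_id]])
        (auto simp: pair_triv_def)
    moreover have "continuous_on ?T (\<lambda>z. \<phi>L j (p (snd z)))"
      using Pair by (intro continuous_on_compose2[OF smooth_metric_continuous[OF \<phi>L Sp, of j] continuous_on_snd[OF continuous_on_id]])
        (auto simp: pair_triv_def)
    ultimately show ?thesis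
      unfolding Pair pair_weight_def by (auto intro!: continuous_on_add continuous_on_mult continuous_on_diff continuous_on_const continuous_on_fst[OF continuous_on_id])
  qed
qed

text \<open>The logarithm of the expression under the maximum that defines the metric, with the
  equilibrium weight written as envelope plus smooth weight.\<close>

definition term_weight :: "('i, 'j) proj_index \<Rightarrow> real \<Rightarrow> complex \<Rightarrow> 'x \<Rightarrow> ereal" where
  "term_weight \<alpha> t z x = log_weight (fiber_power \<alpha> t) z + (envelope t x + ereal (pair_weight t (index_pair \<alpha>) x))"

definition max_weight :: "('i, 'j) proj_index \<Rightarrow> complex \<Rightarrow> 'x \<Rightarrow> ereal" where
  "max_weight \<alpha> z x = (SUP t\<in>{0..1}. term_weight \<alpha> t z x)"

definition chart_domain :: "(nat \<Rightarrow> complex) set \<Rightarrow> ((nat \<Rightarrow> complex) \<Rightarrow> 'x) \<Rightarrow> ('i, 'j) proj_index \<Rightarrow> (nat \<Rightarrow> complex) set" where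
  "chart_domain S p \<alpha> = {u. u \<circ> Suc \<in> S \<and> p (u \<circ> Suc) \<in> proj_base A L \<alpha>}"

lemma proj_base_carrier: "x \<in> proj_base A L \<alpha> \<Longrightarrow> x \<in> mcarrier X"
  using line_bundleD(2)[OF A] by (cases \<alpha>) auto

lemma index_exists:
  assumes "x \<in> mcarrier X"
  obtains i j where "x \<in> triv A i" "x \<in> triv L j"
  using assms line_bundleD(2)[OF A] line_bundleD(2)[OF L] that by blast

lemma term_weight_finite: "x \<in> mcarrier X \<Longrightarrow> envelope t x + ereal c \<noteq> \<infinity>"
  using envelope_le_0[of x t] by (cases "envelope t x") auto

lemma term_weight_not_inf: "x \<in> mcarrier X \<Longrightarrow> term_weight \<alpha> t z x \<noteq> \<infinity>"
  using term_weight_finite[of x t "pair_weight t (index_pair \<alpha>) x"] by (simp add: term_weight_def)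

lemma chart_domain_Cn_open:
  assumes "(S, p) \<in> X"
  shows "Cn_open (Suc n) (chart_domain S p \<alpha>)"
  using Cn_open_shift[OF chart_preimage_Cn_open[OF manifold assms open_V, of "index_pair \<alpha>"]]
  by (simp add: chart_domain_def proj_base_pair)

text \<open>Semicontinuity in the point and in t together: it makes the maximum over the compact
  interval attained and the resulting weight upper semicontinuous. Semicontinuity for each fixed t
  would give neither.\<close>

lemma term_weight_usc:
  assumes Sp: "(S, p) \<in> X"
  shows "usc_on (chart_domain S p \<alpha> \<times> {0..1}) (\<lambda>z. term_weight \<alpha> (snd z) (fst z 0) (p (fst z \<circ> Suc)))"
proof -
  let ?D = "chart_domain S p \<alpha> \<times> {0..1::real}"
  have carrier: "p (u \<circ> Suc) \<in> mcarrier X" if "u \<in> chart_domain S p \<alpha>" for u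
    using that Sp unfolding chart_domain_def mcarrier_def by blast
  have c1: "continuous_on ?D (\<lambda>z. (snd z, fst z \<circ> Suc))"
    by (intro continuous_on_Pair continuous_on_snd continuous_on_id
        continuous_on_compose2[OF continuous_on_shift[of UNIV] continuous_on_fst[OF continuous_on_id]]) auto
  have i1: "(\<lambda>z. (snd z, fst z \<circ> Suc)) ` ?D \<subseteq> {0..1} \<times> {s\<in>S. p s \<in> pair_triv (index_pair \<alpha>)}"
    by (auto simp: chart_domain_def proj_base_pair)
  have "usc_on ({0..1} \<times> {s\<in>S. p s \<in> pair_triv (index_pair \<alpha>)}) (\<lambda>z. envelope (fst z) (p (snd z)) + ereal (pair_weight (fst z) (index_pair \<alpha>) (p (snd z))))"
    by (intro usc_on_add_continuous continuous_weight[OF Sp] usc_on_subset[OF usc_on_envelope_chart[OF Sp]]) auto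
  from usc_on_compose[OF this c1 i1]
  have u1: "usc_on ?D (\<lambda>z. envelope (snd z) (p (fst z \<circ> Suc)) + ereal (pair_weight (snd z) (index_pair \<alpha>) (p (fst z \<circ> Suc))))"
    by simp
  have "continuous_on ?D (\<lambda>z. fiber_power \<alpha> (snd z))"
    by (cases \<alpha>) (auto intro!: continuous_intros)
  then have c2: "continuous_on ?D (\<lambda>z. (fiber_power \<alpha> (snd z), fst z 0))"
    by (intro continuous_on_Pair continuous_on_compose2[OF continuous_on_coordinate[of UNIV] continuous_on_fst[OF continuous_on_id]]) auto
  have i2: "(\<lambda>z. (fiber_power \<alpha> (snd z), fst z 0)) ` ?D \<subseteq> {0..} \<times> UNIV"
    by (cases \<alpha>) auto
  from usc_on_compose[OF usc_log_weight c2 i2]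
  have u2: "usc_on ?D (\<lambda>z. log_weight (fiber_power \<alpha> (snd z)) (fst z 0))" by simp
  show ?thesis
    unfolding term_weight_def using term_weight_finite carrier
    by (intro usc_on_add u1 u2) auto
qed

lemma max_weight_attained:
  assumes x: "x \<in> proj_base A L \<alpha>"
  obtains t where "t \<in> {0..1}" "max_weight \<alpha> z x = term_weight \<alpha> t z x"
proof -
  obtain S p s where s: "(S, p) \<in> X" "s \<in> S" "x = p s" using mcarrier_chart[OF proj_base_carrier[OF x]] by metis
  define u where "u = case_nat z s"
  have u: "u \<circ> Suc = s" "u 0 = z" by (auto simp: u_def)
  have c: "continuous_on {0..1::real} (\<lambda>t. (u, t))" by (intro continuous_intros)
  have i: "(\<lambda>t. (u, t)) ` {0..1::real} \<subseteq> chart_domain S p \<alpha> \<times> {0..1}"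
    using s x u by (auto simp: chart_domain_def)
  from usc_on_compose[OF term_weight_usc[OF s(1)] c i]
  have "usc_on {0..1} (\<lambda>t. term_weight \<alpha> t z x)" by (simp add: u s(3))
  then obtain t where "t \<in> {0..1}" "(SUP t\<in>{0..1}. term_weight \<alpha> t z x) = term_weight \<alpha> t z x"
    using SUP_usc_compact_attained[of "{0..1}" "\<lambda>t. term_weight \<alpha> t z x"] by (metis atLeastAtMost_iff compact_Icc empty_iff le_numeral_extra(4) zero_le_one)
  then show ?thesis using that by (simp add: max_weight_def)
qed

lemma max_weight_not_inf: "x \<in> proj_base A L \<alpha> \<Longrightarrow> max_weight \<alpha> z x \<noteq> \<infinity>"
  using max_weight_attained[of x \<alpha> z] term_weight_not_inf[OF proj_base_carrier] by metis

text \<open>Since the maximum over t is attained, the logarithm of the \<open>GREATEST\<close>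
  reduces to a supremum of \<open>ereal\<close> functions, the form to which the disc test
  applies.\<close>

lemma tilde_metric_eq:
  assumes x: "x \<in> proj_base A L \<alpha>"
  shows "tilde_metric n X A L \<phi>A \<phi>L \<alpha> (proj_point A L \<alpha> z x) = max_weight \<alpha> z x"
proof -
  obtain i j where ij: "index_pair \<alpha> = (i, j)" by fastforce
  have eq: "exp_ereal (term_weight \<alpha> t z x) =
      rpow (cmod z) (2 * fiber_power \<alpha> t) * exp_ereal (equilibrium_AL n X A L \<phi>A \<phi>L t i j x)" if "t \<in> {0..1}" for t
  proof -
    have "equilibrium_AL n X A L \<phi>A \<phi>L t i j x = envelope t x + ereal (pair_weight t (index_pair \<alpha>) x)"
      using equilibrium_weight_eq[OF that, of "(i, j)" x]
      unfolding equilibrium_AL_def pair_triv_def pair_weight_def ij by (simp add: add.commute)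
    then show ?thesis
      unfolding term_weight_def using term_weight_finite[OF proj_base_carrier[OF x]]
      by (simp add: exp_log_weight)
  qed
  obtain t where t: "t \<in> {0..1}" "max_weight \<alpha> z x = term_weight \<alpha> t z x" using max_weight_attained[OF x] by metis
  have *: "ln_ereal (GREATEST y. \<exists>t\<in>{0..1}. y = rpow (cmod z) (2 * fiber_power \<alpha> t) * exp_ereal (equilibrium_AL n X A L \<phi>A \<phi>L t i j x))
      = max_weight \<alpha> z x"
  proof -
    have "(\<exists>t\<in>{0..1}. y = rpow (cmod z) (2 * fiber_power \<alpha> t) * exp_ereal (equilibrium_AL n X A L \<phi>A \<phi>L t i j x)) \<longleftrightarrow>
        (\<exists>t\<in>{0..1}. y = exp_ereal (term_weight \<alpha> t z x))" for y
      by (intro bex_cong refl) (simp only: eq)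
    then show ?thesis
      using ln_Greatest_exp[of t "{0..1}" "\<lambda>t. term_weight \<alpha> t z x"] t term_weight_not_inf[OF proj_base_carrier[OF x]]
      by (simp add: max_weight_def)
  qed
  show ?thesis
  proof (cases \<alpha>)
    case (NormL i' j')
    then show ?thesis using * x ij tilde_metric_proj_point(1)[OF A L] by (simp add: tilde_phi_def)
  next
    case (NormA i' j')
    then show ?thesis using * x ij tilde_metric_proj_point(2)[OF A L] by (simp add: tilde_phi_inf_def)
  qed
qed

text \<open>Each term is a nonnegative multiple of the logarithm of the fiber coordinate plus a psh
  function of x, and the disc test passes to suprema. Semicontinuity comes from compactness of the
  interval of parameters.\<close>

lemma max_weight_psh:
  assumes Sp: "(S, p) \<in> X"
  shows "psh_on (Suc n) (chart_domain S p \<alpha>) (\<lambda>u. max_weight \<alpha> (u 0) (p (u \<circ> Suc)))"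
proof (rule psh_onI)
  show "max_weight \<alpha> (u 0) (p (u \<circ> Suc)) \<noteq> \<infinity>" if "u \<in> chart_domain S p \<alpha>" for u
    using that max_weight_not_inf unfolding chart_domain_def by blast
  show "usc_on (chart_domain S p \<alpha>) (\<lambda>u. max_weight \<alpha> (u 0) (p (u \<circ> Suc)))"
    using usc_on_SUP_compact[OF term_weight_usc[OF Sp, of \<alpha>]] by (simp add: max_weight_def)
  fix a b assume ab: "a \<in> chart_domain S p \<alpha>" "b \<in> Cn (Suc n)" "along a b ` cball 0 1 \<subseteq> chart_domain S p \<alpha>"
  define T where "T = {s\<in>S. p s \<in> pair_triv (index_pair \<alpha>)}"
  define a' where "a' = a \<circ> Suc"
  define b' where "b' = b \<circ> Suc"
  have b': "b' \<in> Cn n" using Cn_Suc[OF ab(2)] by (simp add: b'_def)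
  have disc: "along a' b' \<zeta> \<in> T" if "\<zeta> \<in> cball 0 1" for \<zeta>
  proof -
    have "along a b \<zeta> \<in> chart_domain S p \<alpha>" using ab(3) that by blast
    then show ?thesis
      unfolding a'_def b'_def along_Suc[symmetric] T_def by (simp add: chart_domain_def proj_base_pair)
  qed
  show "disc_test (\<lambda>\<zeta>. max_weight \<alpha> (along a b \<zeta> 0) (p (along a b \<zeta> \<circ> Suc)))"
    unfolding max_weight_def
  proof (rule disc_test_SUP)
    fix t :: real assume t: "t \<in> {0..1}"
    define E where "E s = ereal (pair_weight t (index_pair \<alpha>) (p s)) + envelope t (p s)" for s
    have psh: "psh_on n T E" unfolding T_def E_def by (rule envelope_psh[OF t Sp])
    have "disc_test (\<lambda>\<zeta>. log_weight (fiber_power \<alpha> t) (a 0 + \<zeta> * b 0) + E (along a' b' \<zeta>))"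
    proof (rule disc_test_add_log_weight)
      show "usc_on (cball 0 1) (\<lambda>\<zeta>. E (along a' b' \<zeta>))"
        by (rule usc_on_compose[OF psh_onD(2)[OF psh] continuous_on_along_disc]) (use disc in auto)
      show "E (along a' b' \<zeta>) \<noteq> \<infinity>" if "\<zeta> \<in> cball 0 1" for \<zeta>
        by (rule psh_onD(1)[OF psh disc[OF that]])
      show "0 \<le> fiber_power \<alpha> t" using t by (cases \<alpha>) auto
      fix r :: real assume r: "0 < r" "r \<le> 1"
      \<comment> \<open>The smaller concentric discs required for adding the logarithm are again
        affine discs, with the direction scaled by r.\<close>
      define b'' where "b'' = (\<lambda>m. of_real r * b' m)"
      have e: "along a' b'' \<zeta> = along a' b' (of_real r * \<zeta>)" for \<zeta> by (simp add: along_def b''_def algebra_simps)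
      have in_disc: "of_real r * \<zeta> \<in> cball 0 1" if "\<zeta> \<in> cball 0 1" for \<zeta> :: complex
        using that r by (auto simp: norm_mult mult_le_one)
      have "disc_test (\<lambda>\<zeta>. E (along a' b'' \<zeta>))"
      proof (rule psh_onD(3)[OF psh])
        show "a' \<in> T" using disc[of 0] by simp
        show "b'' \<in> Cn n" using b' by (simp add: Cn_def b''_def)
        show "along a' b'' ` cball 0 1 \<subseteq> T" using disc in_disc unfolding e by blast
      qed
      then show "disc_test (\<lambda>\<zeta>. E (along a' b' (of_real r * \<zeta>)))" by (simp only: e)
    qed
    moreover have "along a b \<zeta> 0 = a 0 + \<zeta> * b 0" for \<zeta> by (simp add: along_def)
    ultimately show "disc_test (\<lambda>\<zeta>. term_weight \<alpha> t (along a b \<zeta> 0) (p (along a b \<zeta> \<circ> Suc)))"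
      unfolding term_weight_def along_Suc a'_def[symmetric] b'_def[symmetric] E_def by (simp add: add.commute)
  qed
qed

section \<open>Homogeneous coordinates and change of frame\<close>

lemma frame_vector_coords:
  assumes "x \<in> proj_base A L \<beta>"
  shows "frame_vector A L \<beta> w x \<in> dual_sum_fiber A L x"
proof -
  obtain i j where ij: "\<beta> = NormL i j \<or> \<beta> = NormA i j" by (cases \<beta>) auto
  then have xij: "x \<in> triv A i" "x \<in> triv L j" using assms by auto
  show ?thesis
    using ij frame_in_fiber(1)[OF A xij(1)] frame_in_fiber(1)[OF L xij(2)]
      fiber_scale[of _ "dual_bundle A"] fiber_scale[of _ "dual_bundle L"]
    unfolding dual_sum_fiber_def by (elim disjE; simp; blast)
qed

text \<open>Normalization of homogeneous coordinates: dividing by the coordinate that the frame sets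
  to 1 leaves the quotient as fiber coordinate.\<close>

lemma vector_eq_frame_vector:
  assumes v: "v \<in> dual_sum_fiber A L x" and x: "x \<in> proj_base A L \<alpha>" and nz: "taut_coord \<alpha> v \<noteq> 0"
  shows "v = (\<lambda>k. taut_coord \<alpha> v * frame_vector A L \<alpha> (fiber_coord \<alpha> v / taut_coord \<alpha> v) x k)"
proof -
  obtain a b where ab: "v = case_sum a b" "a \<in> fiber (dual_bundle A) x" "b \<in> fiber (dual_bundle L) x"
    using v unfolding dual_sum_fiber_def by blast
  have sc: "c \<noteq> 0 \<Longrightarrow> c * (d / c * e) = d * e" for c d e :: complex by simp
  show ?thesis
  proof (cases \<alpha>)
    case (NormL i j)
    have xij: "x \<in> triv A i" "x \<in> triv L j" using x NormL by auto
    have nz': "b j \<noteq> 0" using nz by (simp add: NormL ab(1))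
    show ?thesis
    proof
      fix k
      show "v k = taut_coord \<alpha> v * frame_vector A L \<alpha> (fiber_coord \<alpha> v / taut_coord \<alpha> v) x k"
      proof (cases k)
        case (Inl m)
        show ?thesis
          unfolding NormL ab(1) Inl taut_coord.simps fiber_coord.simps frame_vector.simps sum.case sc[OF nz']
          by (rule fun_cong[OF fiber_eq_frame[OF xij(1) ab(2)]])
      next
        case (Inr m)
        show ?thesis
          unfolding NormL ab(1) Inr taut_coord.simps fiber_coord.simps frame_vector.simps sum.case sc[OF nz']
          by (rule fun_cong[OF fiber_eq_frame[OF xij(2) ab(3)]])
      qed
    qed
  next
    case (NormA i j)
    have xij: "x \<in> triv A i" "x \<in> triv L j" using x NormA by auto
    have nz': "a i \<noteq> 0" using nz by (simp add: NormA ab(1))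
    show ?thesis
    proof
      fix k
      show "v k = taut_coord \<alpha> v * frame_vector A L \<alpha> (fiber_coord \<alpha> v / taut_coord \<alpha> v) x k"
      proof (cases k)
        case (Inl m)
        show ?thesis
          unfolding NormA ab(1) Inl taut_coord.simps fiber_coord.simps frame_vector.simps sum.case sc[OF nz']
          by (rule fun_cong[OF fiber_eq_frame[OF xij(1) ab(2)]])
      next
        case (Inr m)
        show ?thesis
          unfolding NormA ab(1) Inr taut_coord.simps fiber_coord.simps frame_vector.simps sum.case sc[OF nz']
          by (rule fun_cong[OF fiber_eq_frame[OF xij(2) ab(3)]])
      qed
    qed
  qed
qed

lemma proj_point_change:
  assumes "x \<in> proj_base A L \<alpha>" "x \<in> proj_base A L \<beta>" "taut_coord \<alpha> (frame_vector A L \<beta> w x) \<noteq> 0"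
  shows "proj_point A L \<beta> w x = proj_point A L \<alpha>
    (fiber_coord \<alpha> (frame_vector A L \<beta> w x) / taut_coord \<alpha> (frame_vector A L \<beta> w x)) x"
  unfolding proj_point_def
  using vector_eq_frame_vector[OF frame_vector_coords[OF assms(2)] assms(1,3)] cline_scale[OF assms(3)] by metis

lemma hyperplane_triv_iff:
  "P \<in> triv (hyperplane_bundle X A L) \<alpha> \<longleftrightarrow>
    (\<exists>x z. x \<in> proj_base A L \<alpha> \<and> P = proj_point A L \<alpha> z x)"
proof
  assume "P \<in> triv (hyperplane_bundle X A L) \<alpha>"
  then have P: "P \<in> proj_bundle X A L" "fst P \<in> proj_base A L \<alpha>" "\<exists>v\<in>snd P. taut_coord \<alpha> v = 1"
    unfolding hyperplane_bundle_def dual_bundle_sel tautological_bundle_def by auto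
  obtain x v where xv: "P = (x, cline v)" "v \<in> dual_sum_fiber A L x" using P(1) unfolding proj_bundle_def by blast
  obtain c where c: "taut_coord \<alpha> (\<lambda>k. c * v k) = 1" using P(3) unfolding xv(1) cline_def by auto
  then have nz: "taut_coord \<alpha> v \<noteq> 0" unfolding taut_coord_scale by auto
  have x: "x \<in> proj_base A L \<alpha>" using P(2) by (simp add: xv)
  have "cline v = cline (frame_vector A L \<alpha> (fiber_coord \<alpha> v / taut_coord \<alpha> v) x)"
    using vector_eq_frame_vector[OF xv(2) x nz] cline_scale[OF nz] by metis
  then show "\<exists>x z. x \<in> proj_base A L \<alpha> \<and> P = proj_point A L \<alpha> z x"
    using x unfolding xv(1) proj_point_def by blast
next
  assume "\<exists>x z. x \<in> proj_base A L \<alpha> \<and> P = proj_point A L \<alpha> z x"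
  then obtain x z where x: "x \<in> proj_base A L \<alpha>" and P: "P = proj_point A L \<alpha> z x" by blast
  define v where "v = frame_vector A L \<alpha> z x"
  have v1: "taut_coord \<alpha> v = 1" unfolding v_def by (rule coord_frame_vector(1)[OF A L x])
  have "v \<noteq> (\<lambda>_. 0)"
  proof
    assume "v = (\<lambda>_. 0)"
    then have "taut_coord \<alpha> v = 0" by (cases \<alpha>) auto
    with v1 show False by simp
  qed
  then have "P \<in> proj_bundle X A L"
    using proj_base_carrier[OF x] frame_vector_coords[OF x, of z]
    unfolding P proj_point_def proj_bundle_def v_def by blast
  moreover have "v \<in> cline v" by (force simp: cline_def intro: rev_image_eqI[of 1])
  ultimately show "P \<in> triv (hyperplane_bundle X A L) \<alpha>"
    using x v1 unfolding hyperplane_bundle_def dual_bundle_sel tautological_bundle_def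
    by (auto simp: P proj_point_def v_def)
qed

lemma proj_point_in_triv_iff:
  assumes "x \<in> proj_base A L \<beta>"
  shows "proj_point A L \<beta> w x \<in> triv (hyperplane_bundle X A L) \<alpha> \<longleftrightarrow>
    x \<in> proj_base A L \<alpha> \<and> taut_coord \<alpha> (frame_vector A L \<beta> w x) \<noteq> 0"
proof
  assume "proj_point A L \<beta> w x \<in> triv (hyperplane_bundle X A L) \<alpha>"
  then obtain z where x: "x \<in> proj_base A L \<alpha>" and eq: "proj_point A L \<beta> w x = proj_point A L \<alpha> z x"
    unfolding hyperplane_triv_iff by (auto simp: proj_point_def)
  have "frame_vector A L \<alpha> z x \<in> cline (frame_vector A L \<alpha> z x)" by (force simp: cline_def intro: rev_image_eqI[of 1])
  then have "frame_vector A L \<alpha> z x \<in> cline (frame_vector A L \<beta> w x)" using eq by (simp add: proj_point_def)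
  then obtain c where c: "frame_vector A L \<alpha> z x = (\<lambda>k. c * frame_vector A L \<beta> w x k)" by (auto simp: cline_def)
  have "taut_coord \<alpha> (frame_vector A L \<alpha> z x) = 1" by (rule coord_frame_vector(1)[OF A L x])
  then have "c * taut_coord \<alpha> (frame_vector A L \<beta> w x) = 1" unfolding c taut_coord_scale .
  then show "x \<in> proj_base A L \<alpha> \<and> taut_coord \<alpha> (frame_vector A L \<beta> w x) \<noteq> 0" using x by auto
next
  assume "x \<in> proj_base A L \<alpha> \<and> taut_coord \<alpha> (frame_vector A L \<beta> w x) \<noteq> 0"
  then show "proj_point A L \<beta> w x \<in> triv (hyperplane_bundle X A L) \<alpha>"
    using proj_point_change[OF _ assms] unfolding hyperplane_triv_iff by blast
qed

text \<open>The inverse appears because O(1) is dual to the tautological bundle.\<close>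

lemma transition_proj_point:
  assumes "x \<in> proj_base A L \<beta>"
  shows "transition (hyperplane_bundle X A L) \<alpha> \<beta> (proj_point A L \<beta> w x) = inverse (taut_coord \<alpha> (frame_vector A L \<beta> w x))"
  unfolding hyperplane_bundle_def dual_bundle_sel tautological_bundle_def
  by (simp add: taut_frame_proj_point[OF A L assms])

lemma frame_at:
  assumes "x \<in> triv B k" "x \<in> triv B l"
  shows "frame (dual_bundle B) k x l = inverse (transition B l k x)"
  using assms by (simp add: frame_def dual_bundle_sel)

lemma metric_change:
  "x \<in> triv A i \<Longrightarrow> x \<in> triv A i' \<Longrightarrow> \<phi>A i x = \<phi>A i' x + 2 * ln (cmod (transition A i i' x))"
  "x \<in> triv L j \<Longrightarrow> x \<in> triv L j' \<Longrightarrow> \<phi>L j x = \<phi>L j' x + 2 * ln (cmod (transition L j j' x))"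
  using \<phi>A \<phi>L unfolding smooth_metric_def by blast+

text \<open>The transition functions of A and L enter with exponents governed by t, through the
  smooth weights and again through the fiber coordinate d / c. What does not cancel is a power of
  |c| independent of t, so the supremum over t obeys the same rule.\<close>

lemma term_weight_change:
  fixes w :: complex
  assumes x: "x \<in> proj_base A L \<alpha>" "x \<in> proj_base A L \<beta>"
  defines "c \<equiv> taut_coord \<alpha> (frame_vector A L \<beta> w x)" and "d \<equiv> fiber_coord \<alpha> (frame_vector A L \<beta> w x)"
  assumes nz: "c \<noteq> 0"
  shows "term_weight \<alpha> t (d / c) x = term_weight \<beta> t w x + ereal (- 2 * ln (cmod c))"
proof -
  obtain i j where a: "index_pair \<alpha> = (i, j)" by fastforce
  obtain i' j' where b: "index_pair \<beta> = (i', j')" by fastforce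
  have xa: "x \<in> triv A i" "x \<in> triv L j" using x(1) by (auto simp: proj_base_pair a pair_triv_def)
  have xb: "x \<in> triv A i'" "x \<in> triv L j'" using x(2) by (auto simp: proj_base_pair b pair_triv_def)
  define gA where "gA = transition A i i' x"
  define gL where "gL = transition L j j' x"
  have g: "gA \<noteq> 0" "gL \<noteq> 0" using line_bundleD(4)[OF A xa(1) xb(1)] line_bundleD(4)[OF L xa(2) xb(2)]
    by (simp_all add: gA_def gL_def)
  have fr: "frame (dual_bundle A) i' x i = inverse gA" "frame (dual_bundle L) j' x j = inverse gL"
    using frame_at xa xb by (simp_all add: gA_def gL_def)
  define lA where "lA = ln (cmod gA)"
  define lL where "lL = ln (cmod gL)"
  have m: "pair_weight t (i, j) x = pair_weight t (i', j') x + 2 * t * lA + 2 * (1 - t) * lL"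
    unfolding pair_weight_def using metric_change(1)[OF xa(1) xb(1)] metric_change(2)[OF xa(2) xb(2)]
    by (simp add: gA_def gL_def lA_def lL_def algebra_simps)
  \<comment> \<open>Covers w = 0, which can occur when both frames have the same type. For frames of
    different types c is a multiple of w, so c \<noteq> 0 excludes it.\<close>
  have lw0: "log_weight s (w * y) = log_weight s w + ereal (2 * s * ln (cmod y))" if "y \<noteq> 0" for s y
    using that by (cases "w = 0") (auto simp: log_weight_def ln_mult norm_mult algebra_simps)
  have core: "log_weight (fiber_power \<alpha> t) (d / c) + ereal (2 * t * lA + 2 * (1 - t) * lL)
      = log_weight (fiber_power \<beta> t) w + ereal (- 2 * ln (cmod c))"
  proof (cases \<alpha>; cases \<beta>)
    fix i0 j0 i1 j1 assume ab: "\<alpha> = NormL i0 j0" "\<beta> = NormL i1 j1"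
    then have cd: "c = inverse gL" "d = w * inverse gA" using a b fr by (simp_all add: c_def d_def)
    have "d / c = w * (gL / gA)" unfolding cd using g by (simp add: field_simps)
    then show ?thesis
      using g ab cd(1) lw0[of "gL / gA" t]
      by (cases "log_weight t w") (auto simp: norm_inverse norm_divide ln_div ln_inverse lA_def lL_def algebra_simps)
  next
    fix i0 j0 i1 j1 assume ab: "\<alpha> = NormL i0 j0" "\<beta> = NormA i1 j1"
    then have cd: "c = w * inverse gL" "d = inverse gA" using a b fr by (simp_all add: c_def d_def)
    then have w: "w \<noteq> 0" using nz by auto
    have "d / c = gL / (gA * w)" unfolding cd using g w by (simp add: field_simps)
    then show ?thesis
      using g w ab cd
      by (simp add: log_weight_nonzero norm_inverse norm_divide norm_mult ln_div ln_inverse ln_mult lA_def lL_def algebra_simps)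
  next
    fix i0 j0 i1 j1 assume ab: "\<alpha> = NormA i0 j0" "\<beta> = NormL i1 j1"
    then have cd: "c = w * inverse gA" "d = inverse gL" using a b fr by (simp_all add: c_def d_def)
    then have w: "w \<noteq> 0" using nz by auto
    have "d / c = gA / (gL * w)" unfolding cd using g w by (simp add: field_simps)
    then show ?thesis
      using g w ab cd
      by (simp add: log_weight_nonzero norm_inverse norm_divide norm_mult ln_div ln_inverse ln_mult lA_def lL_def algebra_simps)
  next
    fix i0 j0 i1 j1 assume ab: "\<alpha> = NormA i0 j0" "\<beta> = NormA i1 j1"
    then have cd: "c = inverse gA" "d = w * inverse gL" using a b fr by (simp_all add: c_def d_def)
    have "d / c = w * (gA / gL)" unfolding cd using g by (simp add: field_simps)
    then show ?thesis
      using g ab cd(1) lw0[of "gA / gL" "1 - t"]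
      by (cases "log_weight (1 - t) w") (auto simp: norm_inverse norm_divide ln_div ln_inverse lA_def lL_def algebra_simps)
  qed
  have "term_weight \<alpha> t (d / c) x =
      (log_weight (fiber_power \<alpha> t) (d / c) + ereal (2 * t * lA + 2 * (1 - t) * lL)) + (envelope t x + ereal (pair_weight t (i', j') x))"
    unfolding term_weight_def a m by (simp add: plus_ereal.simps(1)[symmetric] ac_simps del: plus_ereal.simps(1))
  also have "\<dots> = term_weight \<beta> t w x + ereal (- 2 * ln (cmod c))"
    unfolding core term_weight_def b by (simp add: ac_simps)
  finally show ?thesis .
qed

lemma max_weight_change:
  assumes x: "x \<in> proj_base A L \<alpha>" "x \<in> proj_base A L \<beta>"
    and nz: "taut_coord \<alpha> (frame_vector A L \<beta> w x) \<noteq> 0"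
  shows "max_weight \<alpha> (fiber_coord \<alpha> (frame_vector A L \<beta> w x) / taut_coord \<alpha> (frame_vector A L \<beta> w x)) x
    = max_weight \<beta> w x + ereal (- 2 * ln (cmod (taut_coord \<alpha> (frame_vector A L \<beta> w x))))"
  unfolding max_weight_def term_weight_change[OF x nz]
  by (rule SUP_ereal_add_left) auto

lemma tilde_metric_change:
  assumes x: "x \<in> proj_base A L \<alpha>" "x \<in> proj_base A L \<beta>"
    and nz: "taut_coord \<alpha> (frame_vector A L \<beta> w x) \<noteq> 0"
  shows "tilde_metric n X A L \<phi>A \<phi>L \<alpha> (proj_point A L \<beta> w x)
    = max_weight \<beta> w x + ereal (- 2 * ln (cmod (taut_coord \<alpha> (frame_vector A L \<beta> w x))))"
  unfolding proj_point_change[OF x nz] tilde_metric_eq[OF x(1)] by (rule max_weight_change[OF x nz])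

lemma tilde_metric_transition:
  assumes "P \<in> triv (hyperplane_bundle X A L) \<alpha> \<inter> triv (hyperplane_bundle X A L) \<beta>"
  shows "tilde_metric n X A L \<phi>A \<phi>L \<alpha> P = tilde_metric n X A L \<phi>A \<phi>L \<beta> P
    + ereal (2 * ln (cmod (transition (hyperplane_bundle X A L) \<alpha> \<beta> P)))"
proof -
  obtain x w where x: "x \<in> proj_base A L \<beta>" and P: "P = proj_point A L \<beta> w x"
    using assms hyperplane_triv_iff[of P \<beta>] by auto
  have xa: "x \<in> proj_base A L \<alpha>" "taut_coord \<alpha> (frame_vector A L \<beta> w x) \<noteq> 0"
    using assms proj_point_in_triv_iff[OF x, of w \<alpha>] unfolding P by auto
  show ?thesis
    unfolding P tilde_metric_change[OF xa(1) x xa(2)] tilde_metric_eq[OF x] transition_proj_point[OF x]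
    using xa(2) by (simp add: norm_inverse ln_inverse)
qed

text \<open>k is the reciprocal of a transition function of A or L, multiplied by the fiber
  coordinate if the two frames are of different types. It is the factor whose logarithm changes the
  weights.\<close>

lemma taut_coord_holomorphic:
  fixes \<alpha> \<beta> :: "('i, 'j) proj_index"
  assumes Sp: "(S, p) \<in> X"
  defines "D \<equiv> chart_domain S p \<alpha> \<inter> chart_domain S p \<beta>"
    and "k \<equiv> \<lambda>u. taut_coord \<alpha> (frame_vector A L \<beta> (u 0) (p (u \<circ> Suc)))"
  shows "continuous_on D k"
    and "\<And>a b. a \<in> D \<Longrightarrow> b \<in> Cn (Suc n) \<Longrightarrow> (\<lambda>\<zeta>. k (along a b \<zeta>)) holomorphic_on {\<zeta>. along a b \<zeta> \<in> D}"
proof -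
  obtain i j where a: "index_pair \<alpha> = (i, j)" by fastforce
  obtain i' j' where b: "index_pair \<beta> = (i', j')" by fastforce
  have in_triv: "p (u \<circ> Suc) \<in> triv A i \<inter> triv A i'" "p (u \<circ> Suc) \<in> triv L j \<inter> triv L j'" "u \<circ> Suc \<in> S" if "u \<in> D" for u
    using that by (auto simp: D_def chart_domain_def proj_base_pair a b pair_triv_def)
  define gA where "gA u = transition A i i' (p (u \<circ> Suc))" for u
  define gL where "gL u = transition L j j' (p (u \<circ> Suc))" for u
  have "gA u \<noteq> 0 \<and> gL u \<noteq> 0 \<and> frame (dual_bundle A) i' (p (u \<circ> Suc)) i = inverse (gA u)
      \<and> frame (dual_bundle L) j' (p (u \<circ> Suc)) j = inverse (gL u)" if "u \<in> D" for u
    using in_triv[OF that] line_bundleD(4)[OF A] line_bundleD(4)[OF L] by (simp add: gA_def gL_def frame_at)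
  then have g: "gA u \<noteq> 0" "gL u \<noteq> 0" "frame (dual_bundle A) i' (p (u \<circ> Suc)) i = inverse (gA u)"
    "frame (dual_bundle L) j' (p (u \<circ> Suc)) j = inverse (gL u)" if "u \<in> D" for u
    using that by blast+
  define f where "f = (\<lambda>u. if \<exists>i j. \<alpha> = NormL i j then inverse (gL u) else inverse (gA u))"
  define same where "same \<longleftrightarrow> (\<exists>i j. \<alpha> = NormL i j) = (\<exists>i j. \<beta> = NormL i j)"
  define e where "e = (\<lambda>u::nat \<Rightarrow> complex. if same then 1 else u 0)"
  have keq: "k u = e u * f u" if "u \<in> D" for u
    unfolding k_def e_def same_def f_def using g(3,4)[OF that] a b by (cases \<alpha>; cases \<beta>) auto
  have hA: "holo_on n {s\<in>S. p s \<in> triv A i \<inter> triv A i'} (transition A i i' \<circ> p)"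
    using line_bundleD(3)[OF A, of i i'] Sp unfolding mholo_on_def by blast
  have hL: "holo_on n {s\<in>S. p s \<in> triv L j \<inter> triv L j'} (transition L j j' \<circ> p)"
    using line_bundleD(3)[OF L, of j j'] Sp unfolding mholo_on_def by blast
  have "continuous_on D (\<lambda>u. (transition A i i' \<circ> p) (u \<circ> Suc))"
    by (rule continuous_on_compose2[OF hA[unfolded holo_on_def, THEN conjunct1] continuous_on_shift]) (use in_triv in auto)
  then have "continuous_on D gA" unfolding gA_def o_apply .
  moreover have "continuous_on D (\<lambda>u. (transition L j j' \<circ> p) (u \<circ> Suc))"
    by (rule continuous_on_compose2[OF hL[unfolded holo_on_def, THEN conjunct1] continuous_on_shift]) (use in_triv in auto)
  then have "continuous_on D gL" unfolding gL_def o_apply .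
  ultimately have "continuous_on D f"
    unfolding f_def using g(1,2) by (cases "\<exists>i j. \<alpha> = NormL i j") (auto intro!: continuous_on_inverse)
  moreover have "continuous_on D e"
    unfolding e_def using continuous_on_coordinate[of D 0]
    by (cases same) simp_all
  ultimately have "continuous_on D (\<lambda>u. e u * f u)" by (intro continuous_intros)
  then show "continuous_on D k" using keq by (metis (no_types, lifting) continuous_on_cong)
  fix a b assume ab: "a \<in> D" "b \<in> Cn (Suc n)"
  let ?\<Omega> = "{\<zeta>. along a b \<zeta> \<in> D}"
  have holA: "(\<lambda>\<zeta>. (transition A i i' \<circ> p) (along (a \<circ> Suc) (b \<circ> Suc) \<zeta>)) holomorphic_on
      {\<zeta>. along (a \<circ> Suc) (b \<circ> Suc) \<zeta> \<in> {s\<in>S. p s \<in> triv A i \<inter> triv A i'}}"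
    using line_bundleD(1)[OF A]
    by (intro holo_on_along[OF hA] chart_preimage_Cn_open[OF manifold Sp] Cn_Suc ab) (rule openin_Int)
  have subA: "?\<Omega> \<subseteq> {\<zeta>. along (a \<circ> Suc) (b \<circ> Suc) \<zeta> \<in> {s\<in>S. p s \<in> triv A i \<inter> triv A i'}}"
    using in_triv unfolding along_Suc[symmetric] by blast
  have hgA: "(\<lambda>\<zeta>. gA (along a b \<zeta>)) holomorphic_on ?\<Omega>"
    using holomorphic_on_subset[OF holA subA] by (simp add: gA_def along_Suc)
  have holL: "(\<lambda>\<zeta>. (transition L j j' \<circ> p) (along (a \<circ> Suc) (b \<circ> Suc) \<zeta>)) holomorphic_on
      {\<zeta>. along (a \<circ> Suc) (b \<circ> Suc) \<zeta> \<in> {s\<in>S. p s \<in> triv L j \<inter> triv L j'}}"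
    using line_bundleD(1)[OF L]
    by (intro holo_on_along[OF hL] chart_preimage_Cn_open[OF manifold Sp] Cn_Suc ab) (rule openin_Int)
  have subL: "?\<Omega> \<subseteq> {\<zeta>. along (a \<circ> Suc) (b \<circ> Suc) \<zeta> \<in> {s\<in>S. p s \<in> triv L j \<inter> triv L j'}}"
    using in_triv unfolding along_Suc[symmetric] by blast
  have hgL: "(\<lambda>\<zeta>. gL (along a b \<zeta>)) holomorphic_on ?\<Omega>"
    using holomorphic_on_subset[OF holL subL] by (simp add: gL_def along_Suc)
  have "(\<lambda>\<zeta>. f (along a b \<zeta>)) holomorphic_on ?\<Omega>"
    unfolding f_def using g(1,2) hgA hgL by (cases "\<exists>i j. \<alpha> = NormL i j") (auto intro!: holomorphic_on_inverse)
  moreover have "(\<lambda>\<zeta>. e (along a b \<zeta>)) holomorphic_on ?\<Omega>"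
    unfolding e_def along_def
    by (cases same) (auto intro!: holomorphic_intros)
  ultimately have "(\<lambda>\<zeta>. e (along a b \<zeta>) * f (along a b \<zeta>)) holomorphic_on ?\<Omega>"
    by (intro holomorphic_intros)
  then show "(\<lambda>\<zeta>. k (along a b \<zeta>)) holomorphic_on ?\<Omega>"
    using holomorphic_cong[OF refl, of ?\<Omega> "\<lambda>\<zeta>. k (along a b \<zeta>)" "\<lambda>\<zeta>. e (along a b \<zeta>) * f (along a b \<zeta>)"] keq by auto
qed

text \<open>A chart uses one frame, while the weight may refer to another. On the overlap the weight
  is \<open>max_weight\<close> in the frame of the chart plus a multiple of the logarithm of a
  holomorphic function without zeros.\<close>

lemma tilde_metric_psh:
  "mpsh_on (Suc n) (proj_atlas X A L) (triv (hyperplane_bundle X A L) \<alpha>) (tilde_metric n X A L \<phi>A \<phi>L \<alpha>)"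
  unfolding mpsh_on_def
proof (clarify)
  fix S' q assume "(S', q) \<in> proj_atlas X A L"
  then obtain S p \<beta> where Sp: "(S, p) \<in> X" and S': "S' = chart_domain S p \<beta>"
    and q: "q = (\<lambda>u. proj_point A L \<beta> (u 0) (p (u \<circ> Suc)))"
    unfolding proj_atlas_def chart_domain_def by blast
  define k where "k u = taut_coord \<alpha> (frame_vector A L \<beta> (u 0) (p (u \<circ> Suc)))" for u
  define D0 where "D0 = chart_domain S p \<alpha> \<inter> chart_domain S p \<beta>"
  define D where "D = {u\<in>D0. k u \<noteq> 0}"
  note kh = taut_coord_holomorphic[OF Sp, where \<alpha> = \<alpha> and \<beta> = \<beta>, folded k_def D0_def]
  have k0: "continuous_on D0 k" using kh(1) by (simp add: k_def[abs_def])
  have "openin (top_of_set D0) (D0 \<inter> k -` (- {0}))"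
    using k0 by (intro continuous_openin_preimage_gen) auto
  moreover have "D = D0 \<inter> k -` (- {0})" by (auto simp: D_def)
  moreover have "Cn_open (Suc n) D0"
    unfolding D0_def by (intro openin_Int chart_domain_Cn_open[OF Sp])
  ultimately have Dopen: "Cn_open (Suc n) D" using openin_trans by metis
  have DD: "D \<subseteq> chart_domain S p \<beta>" "D \<subseteq> D0" by (auto simp: D_def D0_def)
  have dom: "{u\<in>S'. q u \<in> triv (hyperplane_bundle X A L) \<alpha>} = D"
    unfolding S' q D_def D0_def k_def using proj_point_in_triv_iff by (auto simp: chart_domain_def)
  have "psh_on (Suc n) D (\<lambda>u. max_weight \<beta> (u 0) (p (u \<circ> Suc)) + ereal (- 2 * ln (cmod (k u))))"
  proof (rule psh_on_add_log[OF psh_on_subset[OF max_weight_psh[OF Sp] DD(1)] Dopen])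
    show "continuous_on D k" using k0 DD(2) continuous_on_subset by blast
    show "k u \<noteq> 0" if "u \<in> D" for u using that by (simp add: D_def)
    show "(\<lambda>\<zeta>. k (along a b \<zeta>)) holomorphic_on {\<zeta>. along a b \<zeta> \<in> D}" if "a \<in> D" "b \<in> Cn (Suc n)" for a b
    proof (rule holomorphic_on_subset)
      show "(\<lambda>\<zeta>. k (along a b \<zeta>)) holomorphic_on {\<zeta>. along a b \<zeta> \<in> D0}"
        using kh(2)[of a b] that DD(2) by (auto simp: k_def[abs_def])
    qed (use DD(2) in auto)
  qed
  then show "psh_on (Suc n) {u\<in>S'. q u \<in> triv (hyperplane_bundle X A L) \<alpha>} (tilde_metric n X A L \<phi>A \<phi>L \<alpha> \<circ> q)"
    unfolding dom
  proof (rule psh_on_cong[THEN iffD1, rotated])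
    fix u assume u: "u \<in> D"
    then show "max_weight \<beta> (u 0) (p (u \<circ> Suc)) + ereal (- 2 * ln (cmod (k u))) = (tilde_metric n X A L \<phi>A \<phi>L \<alpha> \<circ> q) u"
      using tilde_metric_change[of "p (u \<circ> Suc)" \<alpha> \<beta> "u 0"]
      by (auto simp: q D_def D0_def k_def chart_domain_def)
  qed
qed

end

section \<open>Nontriviality of the weights\<close>

lemma psh_on_add_const:
  assumes "psh_on n S u"
  shows "psh_on n S (\<lambda>a. u a + ereal c)"
proof (rule psh_onI)
  show "u a + ereal c \<noteq> \<infinity>" if "a \<in> S" for a using psh_onD(1)[OF assms that] by (cases "u a") auto
  show "usc_on S (\<lambda>a. u a + ereal c)" by (intro usc_on_add_continuous psh_onD(2)[OF assms] continuous_on_const)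
  show "disc_test (\<lambda>\<zeta>. u (along a b \<zeta>) + ereal c)" if "a \<in> S" "b \<in> Cn n" "along a b ` cball 0 1 \<subseteq> S" for a b
    using disc_test_add_Re[OF psh_onD(3)[OF assms that], of "\<lambda>_. of_real c"] by simp
qed

context sum_bundle
begin

text \<open>The difference of a psh weight of L and \<phi>L is a function on X. It is bounded above
  by compactness, and subtracting the bound gives a competitor for t = 0; in this way
  pseudo-effectivity makes the envelope nontrivial.\<close>

lemma psh_metric_candidate:
  assumes compact: "compact_space (mtop X)" and \<phi>: "psh_metric n X L \<phi>"
  obtains \<psi> where "\<psi> \<in> cand 0" "\<And>x j. x \<in> triv L j \<Longrightarrow> \<phi> j x \<noteq> - \<infinity> \<Longrightarrow> \<psi> x \<noteq> - \<infinity>"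
proof -
  \<comment> \<open>The choice of j is immaterial, since both weights change by the same
    logarithm.\<close>
  define \<psi>0 where "\<psi>0 x = (let j = SOME j. x \<in> triv L j in \<phi> j x + ereal (- \<phi>L j x))" for x
  have \<psi>0: "\<psi>0 x = \<phi> j x + ereal (- \<phi>L j x)" if j: "x \<in> triv L j" for x j
  proof -
    define j' where "j' = (SOME j. x \<in> triv L j)"
    have j': "x \<in> triv L j'" unfolding j'_def by (rule someI[of _ j]) (rule j)
    have "\<phi> j x = \<phi> j' x + ereal (2 * ln (cmod (transition L j j' x)))"
      using \<phi> j j' unfolding psh_metric_def by blast
    then show ?thesis
      using metric_change(2)[OF j j'] by (cases "\<phi> j' x") (auto simp: \<psi>0_def j'_def[symmetric])
  qed
  have psh: "psh_on n {s\<in>S. p s \<in> triv L j} (\<lambda>s. \<phi> j (p s))" if "(S, p) \<in> X" for S p j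
    using \<phi> that unfolding psh_metric_def mpsh_on_def by (auto simp: o_def)
  obtain B where B: "\<And>x. x \<in> mcarrier X \<Longrightarrow> \<psi>0 x \<le> ereal B"
  proof (rule compact_uniform_bound[OF compact, of "\<lambda>x B. \<psi>0 x \<le> ereal B"])
    show "\<psi>0 x \<le> ereal B'" if "\<psi>0 x \<le> ereal B" "B \<le> B'" for x B B' using that by (meson ereal_less_eq(3) order_trans)
    fix x assume x: "x \<in> mcarrier X"
    obtain S p s where s: "(S, p) \<in> X" "s \<in> S" "x = p s" using mcarrier_chart[OF x] by metis
    obtain j where j: "x \<in> triv L j" using index_exists[OF x] by metis
    define T where "T = {s\<in>S. p s \<in> triv L j}"
    have sT: "s \<in> T" using s j by (simp add: T_def)
    have usc: "usc_on T (\<lambda>s. \<phi> j (p s) + ereal (- \<phi>L j (p s)))"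
      unfolding T_def
      by (intro usc_on_add_continuous psh_onD(2)[OF psh[OF s(1)]] continuous_on_minus smooth_metric_continuous[OF \<phi>L s(1)])
    have "\<phi> j (p s) \<noteq> \<infinity>" using psh_onD(1)[OF psh[OF s(1)], of s j] sT by (simp add: T_def)
    then have "\<phi> j (p s) + ereal (- \<phi>L j (p s)) < \<infinity>" by (cases "\<phi> j (p s)") auto
    then obtain B where "\<phi> j (p s) + ereal (- \<phi>L j (p s)) < ereal B" using ereal_dense2 by blast
    then obtain N where N: "open N" "s \<in> N" "\<And>s. s \<in> N \<Longrightarrow> s \<in> T \<Longrightarrow> \<phi> j (p s) + ereal (- \<phi>L j (p s)) < ereal B"
      using usc_onD[where u = "\<lambda>s. \<phi> j (p s) + ereal (- \<phi>L j (p s))", OF usc sT] by metis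
    have "openin (top_of_set S) (T \<inter> N)"
      unfolding T_def by (intro openin_Int_open chart_preimage_open[OF s(1)] line_bundleD(1)[OF L] N(1))
    then have "openin (mtop X) (p ` (T \<inter> N))" by (rule chart_image_open[OF manifold s(1)])
    moreover have "x \<in> p ` (T \<inter> N)" using s(3) sT N(2) by blast
    moreover have "\<psi>0 y \<le> ereal B" if "y \<in> p ` (T \<inter> N)" for y
      using that N(3) \<psi>0 by (force simp: T_def intro: less_imp_le)
    ultimately show "\<exists>W B. openin (mtop X) W \<and> x \<in> W \<and> (\<forall>y\<in>W. \<psi>0 y \<le> ereal B)" by blast
  qed blast
  define \<psi> where "\<psi> x = \<psi>0 x + ereal (- B)" for x
  have le0: "\<psi> x \<le> 0" if "x \<in> mcarrier X" for x
    using B[OF that] by (cases "\<psi>0 x") (auto simp: \<psi>_def)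
  have "\<psi> \<in> cand 0"
    unfolding cand_def equilibrium_candidates_def
  proof (intro CollectI conjI ballI allI)
    show "\<psi> x \<noteq> \<infinity>" "\<psi> x \<le> 0" if "x \<in> mcarrier X" for x using le0[OF that] by auto
    fix k :: "'i \<times> 'j"
    obtain i j where k: "k = (i, j)" by fastforce
    show "mpsh_on n X (pair_triv k) (\<lambda>x. ereal (pair_weight 0 k x) + \<psi> x)"
      unfolding mpsh_on_def o_def
    proof clarify
      fix S p assume Sp: "(S, p) \<in> X"
      have "psh_on n {s\<in>S. p s \<in> pair_triv k} (\<lambda>s. \<phi> j (p s) + ereal (- B))"
        by (rule psh_on_subset[OF psh_on_add_const[OF psh[OF Sp, of j]]]) (auto simp: k pair_triv_def)
      then show "psh_on n {s\<in>S. p s \<in> pair_triv k} (\<lambda>s. ereal (pair_weight 0 k (p s)) + \<psi> (p s))"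
      proof (rule psh_on_cong[THEN iffD1, rotated])
        fix s assume "s \<in> {s\<in>S. p s \<in> pair_triv k}"
        then have "p s \<in> triv L j" by (simp add: k pair_triv_def)
        then show "\<phi> j (p s) + ereal (- B) = ereal (pair_weight 0 k (p s)) + \<psi> (p s)"
          by (cases "\<phi> j (p s)") (simp_all add: \<psi>_def \<psi>0 k pair_weight_def)
      qed
    qed
  qed
  moreover have "\<psi> x \<noteq> - \<infinity>" if "x \<in> triv L j" "\<phi> j x \<noteq> - \<infinity>" for x j
    using that(2) by (cases "\<phi> j x") (auto simp: \<psi>_def \<psi>0[OF that(1)])
  ultimately show ?thesis by (rule that)
qed

lemma continuous_on_case_nat:
  "continuous_on T g \<Longrightarrow> continuous_on T h \<Longrightarrow> continuous_on T (\<lambda>x. case_nat (g x) (h x) :: nat \<Rightarrow> complex)"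
proof (rule continuous_on_coordinatewise_then_product)
  fix m assume gh: "continuous_on T g" "continuous_on T h"
  show "continuous_on T (\<lambda>x. case m of 0 \<Rightarrow> g x | Suc k \<Rightarrow> h x k)"
    using gh by (cases m) (auto intro: continuous_on_product_then_coordinatewise)
qed

lemma case_nat_Suc: "case_nat z s \<circ> Suc = s"
  by (simp add: fun_eq_iff)

text \<open>The term t = 0 suffices: it can be -\<infinity> only where the candidate coming from L
  is or where the fiber coordinate vanishes, and both can be avoided in a nonempty open set.\<close>

lemma tilde_metric_nontrivial:
  assumes compact: "compact_space (mtop X)" and psef: "pseudo_effective n X L"
    and W: "openin (mtop (proj_atlas X A L)) W" "W \<noteq> {}" "W \<subseteq> triv (hyperplane_bundle X A L) \<alpha>"
  shows "\<exists>P\<in>W. tilde_metric n X A L \<phi>A \<phi>L \<alpha> P \<noteq> - \<infinity>"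
proof -
  obtain \<phi> where \<phi>: "psh_metric n X L \<phi>" using psef unfolding pseudo_effective_def by blast
  obtain \<psi> where \<psi>: "\<psi> \<in> cand 0" "\<And>x j. x \<in> triv L j \<Longrightarrow> \<phi> j x \<noteq> - \<infinity> \<Longrightarrow> \<psi> x \<noteq> - \<infinity>"
    using psh_metric_candidate[OF compact \<phi>] by metis
  obtain P x z where P: "P \<in> W" "x \<in> proj_base A L \<alpha>" "P = proj_point A L \<alpha> z x"
    using W(2,3) hyperplane_triv_iff[of _ \<alpha>] by blast
  obtain S p s where s: "(S, p) \<in> X" "s \<in> S" "x = p s" using mcarrier_chart[OF proj_base_carrier[OF P(2)]] by metis
  define q where "q u = proj_point A L \<alpha> (u 0) (p (u \<circ> Suc))" for u
  define Q where "Q = {u\<in>chart_domain S p \<alpha>. q u \<in> W}"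
  have "(chart_domain S p \<alpha>, q) \<in> proj_atlas X A L"
    unfolding proj_atlas_def chart_domain_def q_def using s(1) by blast
  then have "openin (top_of_set (chart_domain S p \<alpha>)) Q"
    unfolding Q_def by (rule chart_preimage_open[OF _ W(1)])
  then have Q: "Cn_open (Suc n) Q" using chart_domain_Cn_open[OF s(1)] openin_trans by blast
  have SC: "S \<subseteq> Cn n" by (rule openin_imp_subset[OF manifold_chart(1)[OF manifold s(1)]])
  have inQ: "case_nat z s \<in> Q"
    using s P by (simp add: Q_def q_def chart_domain_def case_nat_Suc)
  have in_Cn: "case_nat z' s' \<in> Cn (Suc n)" if "s' \<in> Cn n" for z' s'
    using that unfolding Cn_Suc_iff[symmetric] case_nat_Suc .
  obtain O' where O': "open O'" "Q = Cn (Suc n) \<inter> O'" using Q unfolding openin_open by blast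
  have "open ((\<lambda>z'. case_nat z' s) -` O')"
    by (rule open_vimage[OF O'(1)]) (intro continuous_on_case_nat continuous_on_id continuous_on_const)
  moreover have "z \<in> (\<lambda>z'. case_nat z' s) -` O'" using inQ O'(2) by blast
  ultimately obtain r where r: "r > 0" "ball z r \<subseteq> (\<lambda>z'. case_nat z' s) -` O'" using openE by blast
  \<comment> \<open>In the frame at infinity the term t = 0 carries the square of the modulus of the
    fiber coordinate and would be -\<infinity> at 0.\<close>
  obtain z1 where z1: "z1 \<noteq> 0" "z1 \<in> ball z r"
  proof (cases "z = 0")
    case True
    show ?thesis by (rule that[of "of_real (r / 2)"]) (use r True in auto)
  next
    case False
    then show ?thesis by (intro that[of z]) (use r in auto)
  qed
  \<comment> \<open>The slice of the open set at z1. Its image in X is open, so the weight of L is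
    not identically -\<infinity> on it.\<close>
  define T where "T = {s'\<in>Cn n. case_nat z1 s' \<in> O'}"
  have "continuous_on UNIV (\<lambda>s'. case_nat z1 s' :: nat \<Rightarrow> complex)"
    by (intro continuous_on_case_nat continuous_on_id continuous_on_const)
  then have "open ((\<lambda>s'. case_nat z1 s') -` O')" using O'(1) by (intro open_vimage)
  then have "Cn_open n (Cn n \<inter> (\<lambda>s'. case_nat z1 s') -` O')" by (rule openin_open_Int)
  then have T: "Cn_open n T" by (simp add: T_def Int_def)
  have TQ: "case_nat z1 s' \<in> Q" if "s' \<in> T" for s' using that in_Cn O'(2) by (simp add: T_def)
  have TS: "s' \<in> S" "p s' \<in> proj_base A L \<alpha>" if "s' \<in> T" for s'
    using TQ[OF that] by (simp_all add: Q_def chart_domain_def case_nat_Suc)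
  have sT: "s \<in> T" using r(2) z1(2) SC s(2) by (auto simp: T_def)
  have "openin (top_of_set S) T"
    using openin_subset_trans[OF T _ SC] TS(1) by blast
  then have pT: "openin (mtop X) (p ` T)" by (rule chart_image_open[OF manifold s(1)])
  obtain i j where ij: "index_pair \<alpha> = (i, j)" by fastforce
  have "p ` T \<subseteq> triv L j" using TS(2) by (auto simp: proj_base_pair ij pair_triv_def)
  moreover have "p ` T \<noteq> {}" using sT by blast
  ultimately obtain s' where s': "s' \<in> T" "\<phi> j (p s') \<noteq> - \<infinity>"
    using \<phi> pT unfolding psh_metric_def by (metis (no_types, lifting) imageE)
  have s'L: "p s' \<in> triv L j" using TS(2)[OF s'(1)] by (auto simp: proj_base_pair ij pair_triv_def)
  have "\<psi> (p s') \<le> envelope 0 (p s')" by (rule cand_le_envelope[OF \<psi>(1)]) simp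
  then have "envelope 0 (p s') \<noteq> - \<infinity>" using \<psi>(2)[OF s'L s'(2)] by auto
  then have "term_weight \<alpha> 0 z1 (p s') \<noteq> - \<infinity>"
    unfolding term_weight_def log_weight_nonzero[OF z1(1)]
    using envelope_le_0[OF proj_base_carrier[OF TS(2)[OF s'(1)]], of 0] by (cases "envelope 0 (p s')") auto
  moreover have "term_weight \<alpha> 0 z1 (p s') \<le> max_weight \<alpha> z1 (p s')"
    unfolding max_weight_def by (rule SUP_upper) simp
  ultimately have "max_weight \<alpha> z1 (p s') \<noteq> - \<infinity>" by auto
  moreover have "proj_point A L \<alpha> z1 (p s') \<in> W"
    using TQ[OF s'(1)] by (simp add: Q_def q_def case_nat_Suc)
  ultimately show ?thesis using tilde_metric_eq[OF TS(2)[OF s'(1)]] by metis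
qed

lemma tilde_metric_psh_metric:
  assumes "compact_space (mtop X)" "pseudo_effective n X L"
  shows "psh_metric (Suc n) (proj_atlas X A L) (hyperplane_bundle X A L) (tilde_metric n X A L \<phi>A \<phi>L)"
  unfolding psh_metric_def
  using tilde_metric_psh tilde_metric_transition tilde_metric_nontrivial[OF assms] by blast

end

section \<open>Minimality\<close>

locale hyperplane_metric = sum_bundle n X A L \<phi>A \<phi>L
  for n :: nat and X :: "'x atlas" and A :: "('x, 'i) line_bundle" and L :: "('x, 'j) line_bundle"
    and \<phi>A :: "'i \<Rightarrow> 'x \<Rightarrow> real" and \<phi>L :: "'j \<Rightarrow> 'x \<Rightarrow> real" +
  fixes \<phi> :: "('i, 'j) proj_index \<Rightarrow> 'x \<times> ('i + 'j \<Rightarrow> complex) set \<Rightarrow> ereal"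
  assumes compact: "compact_space (mtop X)"
    and metric: "psh_metric (Suc n) (proj_atlas X A L) (hyperplane_bundle X A L) \<phi>"
begin

definition weight :: "('i, 'j) proj_index \<Rightarrow> complex \<Rightarrow> 'x \<Rightarrow> ereal" where
  "weight \<alpha> z x = \<phi> \<alpha> (proj_point A L \<alpha> z x)"

text \<open>The rotations form a compact circle, so upper semicontinuity survives the supremum
  without regularization.\<close>

definition rad :: "('i, 'j) proj_index \<Rightarrow> complex \<Rightarrow> 'x \<Rightarrow> ereal" where
  "rad \<alpha> z x = (SUP c\<in>sphere 0 1. weight \<alpha> (c * z) x)"

lemma weight_psh:
  assumes Sp: "(S, p) \<in> X"
  shows "psh_on (Suc n) (chart_domain S p \<alpha>) (\<lambda>u. weight \<alpha> (u 0) (p (u \<circ> Suc)))"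
proof -
  define q where "q u = proj_point A L \<alpha> (u 0) (p (u \<circ> Suc))" for u
  have "(chart_domain S p \<alpha>, q) \<in> proj_atlas X A L"
    unfolding proj_atlas_def chart_domain_def q_def using Sp by blast
  then have "psh_on (Suc n) {u\<in>chart_domain S p \<alpha>. q u \<in> triv (hyperplane_bundle X A L) \<alpha>} (\<phi> \<alpha> \<circ> q)"
    using metric unfolding psh_metric_def mpsh_on_def by blast
  moreover have "{u\<in>chart_domain S p \<alpha>. q u \<in> triv (hyperplane_bundle X A L) \<alpha>} = chart_domain S p \<alpha>"
    using hyperplane_triv_iff unfolding q_def chart_domain_def by blast
  moreover have "\<phi> \<alpha> \<circ> q = (\<lambda>u. weight \<alpha> (u 0) (p (u \<circ> Suc)))" by (simp add: fun_eq_iff q_def weight_def)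
  ultimately show ?thesis by simp
qed

lemma weight_change:
  assumes x: "x \<in> proj_base A L \<alpha>" "x \<in> proj_base A L \<beta>"
    and nz: "taut_coord \<alpha> (frame_vector A L \<beta> w x) \<noteq> 0"
  shows "weight \<alpha> (fiber_coord \<alpha> (frame_vector A L \<beta> w x) / taut_coord \<alpha> (frame_vector A L \<beta> w x)) x
    = weight \<beta> w x + ereal (- 2 * ln (cmod (taut_coord \<alpha> (frame_vector A L \<beta> w x))))"
proof -
  define P where "P = proj_point A L \<beta> w x"
  have "P \<in> triv (hyperplane_bundle X A L) \<alpha> \<inter> triv (hyperplane_bundle X A L) \<beta>"
    unfolding P_def using proj_point_in_triv_iff[OF x(2)] x nz coord_frame_vector(1)[OF A L x(2)] by auto
  then have "\<phi> \<alpha> P = \<phi> \<beta> P + ereal (2 * ln (cmod (transition (hyperplane_bundle X A L) \<alpha> \<beta> P)))"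
    using metric unfolding psh_metric_def by blast
  moreover have "weight \<beta> w x = \<phi> \<beta> P" by (simp add: weight_def P_def)
  moreover have "weight \<alpha> (fiber_coord \<alpha> (frame_vector A L \<beta> w x) / taut_coord \<alpha> (frame_vector A L \<beta> w x)) x = \<phi> \<alpha> P"
    unfolding weight_def P_def proj_point_change[OF x nz] ..
  ultimately show ?thesis
    using nz unfolding P_def transition_proj_point[OF x(2)] by (simp add: norm_inverse ln_inverse)
qed

lemma weight_change_NormL:
  assumes x: "x \<in> triv A i" "x \<in> triv L j" "x \<in> triv A i'" "x \<in> triv L j'"
  shows "weight (NormL i j) (w * (transition L j j' x / transition A i i' x)) x
    = weight (NormL i' j') w x + ereal (2 * ln (cmod (transition L j j' x)))"
proof -
  have g: "transition A i i' x \<noteq> 0" "transition L j j' x \<noteq> 0"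
    using line_bundleD(4)[OF A x(1,3)] line_bundleD(4)[OF L x(2,4)] by auto
  have e: "taut_coord (NormL i j) (frame_vector A L (NormL i' j') w x) = inverse (transition L j j' x)"
    "fiber_coord (NormL i j) (frame_vector A L (NormL i' j') w x) = w * inverse (transition A i i' x)"
    using frame_at x by (simp_all add: frame_at)
  have "weight (NormL i j) (w * inverse (transition A i i' x) / inverse (transition L j j' x)) x
      = weight (NormL i' j') w x + ereal (- 2 * ln (cmod (inverse (transition L j j' x))))"
    using weight_change[of x "NormL i j" "NormL i' j'" w, unfolded e] x g by simp
  moreover have "w * inverse (transition A i i' x) / inverse (transition L j j' x)
      = w * (transition L j j' x / transition A i i' x)" using g by (simp add: field_simps)
  ultimately show ?thesis using g by (simp add: norm_inverse ln_inverse)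
qed

lemma weight_change_NormA:
  assumes x: "x \<in> triv A i" "x \<in> triv L j" and w: "w \<noteq> 0"
  shows "weight (NormL i j) (1 / w) x = weight (NormA i j) w x + ereal (- 2 * ln (cmod w))"
proof -
  have e: "taut_coord (NormL i j) (frame_vector A L (NormA i j) w x) = w"
    "fiber_coord (NormL i j) (frame_vector A L (NormA i j) w x) = 1"
    using frame_at[OF x(1,1)] frame_at[OF x(2,2)] line_bundleD(5)[OF A x(1)] line_bundleD(5)[OF L x(2)] by simp_all
  show ?thesis
    using weight_change[of x "NormL i j" "NormA i j" w, unfolded e] x w by simp
qed

lemma weight_usc:
  assumes Sp: "(S, p) \<in> X"
  shows "usc_on (UNIV \<times> {s\<in>S. p s \<in> proj_base A L \<alpha>}) (\<lambda>z. weight \<alpha> (fst z) (p (snd z)))"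
proof -
  let ?D = "(UNIV :: complex set) \<times> {s\<in>S. p s \<in> proj_base A L \<alpha>}"
  have c: "continuous_on ?D (\<lambda>z. case_nat (fst z) (snd z) :: nat \<Rightarrow> complex)"
    by (intro continuous_on_case_nat continuous_intros)
  have i: "(\<lambda>z. case_nat (fst z) (snd z)) ` ?D \<subseteq> chart_domain S p \<alpha>"
    by (auto simp: chart_domain_def case_nat_Suc)
  from usc_on_compose[OF psh_onD(2)[OF weight_psh[OF Sp]] c i] show ?thesis by (simp add: case_nat_Suc)
qed

lemma weight_not_inf:
  assumes "x \<in> proj_base A L \<alpha>"
  shows "weight \<alpha> z x \<noteq> \<infinity>"
proof -
  obtain S p s where s: "(S, p) \<in> X" "s \<in> S" "x = p s" using mcarrier_chart[OF proj_base_carrier[OF assms]] by metis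
  have "case_nat z s \<in> chart_domain S p \<alpha>" using s assms by (simp add: chart_domain_def case_nat_Suc)
  from psh_onD(1)[OF weight_psh[OF s(1)] this] show ?thesis by (simp add: case_nat_Suc s(3))
qed

lemma rad_usc:
  assumes Sp: "(S, p) \<in> X"
  shows "usc_on (UNIV \<times> {s\<in>S. p s \<in> proj_base A L \<alpha>}) (\<lambda>z. rad \<alpha> (fst z) (p (snd z)))"
proof -
  let ?D = "(UNIV :: complex set) \<times> {s\<in>S. p s \<in> proj_base A L \<alpha>}"
  have c: "continuous_on (?D \<times> sphere 0 1) (\<lambda>y. (snd y * fst (fst y), snd (fst y)))"
    by (intro continuous_intros)
  have i: "(\<lambda>y. (snd y * fst (fst y), snd (fst y))) ` (?D \<times> sphere 0 1) \<subseteq> ?D" by auto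
  from usc_on_compose[OF weight_usc[OF Sp] c i]
  have "usc_on (?D \<times> sphere 0 1) (\<lambda>y. weight \<alpha> (snd y * fst (fst y)) (p (snd (fst y))))" by simp
  from usc_on_SUP_compact[OF this] show ?thesis by (simp add: rad_def)
qed

lemma rad_not_inf:
  assumes x: "x \<in> proj_base A L \<alpha>"
  shows "rad \<alpha> z x \<noteq> \<infinity>"
proof -
  obtain S p s where s: "(S, p) \<in> X" "s \<in> S" "x = p s" using mcarrier_chart[OF proj_base_carrier[OF x]] by metis
  have c: "continuous_on (sphere 0 1) (\<lambda>c. (c * z, s))" by (intro continuous_intros)
  have i: "(\<lambda>c. (c * z, s)) ` sphere 0 1 \<subseteq> UNIV \<times> {s\<in>S. p s \<in> proj_base A L \<alpha>}" using s x by auto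
  from usc_on_compose[OF weight_usc[OF s(1)] c i] have "usc_on (sphere 0 1) (\<lambda>c. weight \<alpha> (c * z) x)" by (simp add: s(3))
  then obtain c where "(SUP c\<in>sphere 0 1. weight \<alpha> (c * z) x) = weight \<alpha> (c * z) x"
    using SUP_usc_compact_attained[of "sphere 0 1" "\<lambda>c. weight \<alpha> (c * z) x"] by auto
  then show ?thesis using weight_not_inf[OF x] by (simp add: rad_def)
qed

lemma weight_le_rad: "weight \<alpha> z x \<le> rad \<alpha> z x"
  unfolding rad_def by (rule SUP_upper2[of 1]) auto

lemma rad_rotate_le:
  assumes "cmod u = 1"
  shows "rad \<alpha> (u * z) x \<le> rad \<alpha> z x"
  unfolding rad_def[of \<alpha> "u * z"]
proof (rule SUP_least)
  fix c :: complex assume "c \<in> sphere 0 1"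
  then show "weight \<alpha> (c * (u * z)) x \<le> rad \<alpha> z x"
    unfolding rad_def using assms by (intro SUP_upper2[of "c * u"]) (auto simp: norm_mult mult.assoc)
qed

lemma rad_radial: "rad \<alpha> z x = rad \<alpha> (of_real (cmod z)) x"
proof (cases "z = 0")
  case False
  define u where "u = z / of_real (cmod z)"
  have u: "cmod u = 1" "cmod (inverse u) = 1" "u \<noteq> 0" using False by (auto simp: u_def norm_divide norm_inverse)
  have e: "z = u * of_real (cmod z)" "of_real (cmod z) = inverse u * z" using False by (auto simp: u_def field_simps)
  show ?thesis
    using rad_rotate_le[OF u(1), of \<alpha> "of_real (cmod z)" x] rad_rotate_le[OF u(2), of \<alpha> z x]
    unfolding e(1)[symmetric] e(2)[symmetric] by (rule antisym)
qed simp

lemma rad_cmod: "cmod z = exp s \<Longrightarrow> rad \<alpha> z x = rad \<alpha> (of_real (exp s)) x"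
  using rad_radial[of \<alpha> z x] by simp

text \<open>For each rotation c, an affine disc in (z, \<zeta>) lifts to an affine disc in the
  bundle chart: the fiber coordinate is c * (z + \<tau> * v), and the base point runs along the disc
  in X.\<close>

lemma rad_family:
  assumes Sp: "(S, p) \<in> X" and b: "b \<in> Cn n"
    and disc: "\<And>\<zeta>. \<zeta> \<in> cball 0 1 \<Longrightarrow> along a b \<zeta> \<in> {s\<in>S. p s \<in> proj_base A L \<alpha>}"
  shows "radial_subharmonic_family (\<lambda>z \<zeta>. rad \<alpha> z (p (along a b \<zeta>)))"
proof
  let ?T = "{s\<in>S. p s \<in> proj_base A L \<alpha>}"
  have c: "continuous_on (UNIV \<times> cball 0 1) (\<lambda>y. (fst y, along a b (snd y)))"
    by (intro continuous_on_Pair continuous_on_fst continuous_on_id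
        continuous_on_compose2[OF continuous_on_along_disc[of UNIV] continuous_on_snd[OF continuous_on_id]]) auto
  have i: "(\<lambda>y. (fst y, along a b (snd y))) ` (UNIV \<times> cball 0 1) \<subseteq> UNIV \<times> ?T" using disc by auto
  from usc_on_compose[OF rad_usc[OF Sp] c i]
  show "usc_on (UNIV \<times> cball 0 1) (\<lambda>y. rad \<alpha> (fst y) (p (along a b (snd y))))" by simp
  show "rad \<alpha> z (p (along a b \<zeta>)) \<noteq> \<infinity>" if "\<zeta> \<in> cball 0 1" for \<zeta> z
    using disc[OF that] rad_not_inf by blast
  show "rad \<alpha> z (p (along a b \<zeta>)) = rad \<alpha> (of_real (cmod z)) (p (along a b \<zeta>))" for z \<zeta>
    by (rule rad_radial)
  fix \<zeta> e z v :: complex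
  assume in_disc: "\<And>\<tau>. \<tau> \<in> cball 0 1 \<Longrightarrow> \<zeta> + \<tau> * e \<in> cball 0 1"
  show "disc_test (\<lambda>\<tau>. rad \<alpha> (z + \<tau> * v) (p (along a b (\<zeta> + \<tau> * e))))"
    unfolding rad_def
  proof (rule disc_test_SUP)
    fix c :: complex
    define a' where "a' = case_nat (c * z) (along a b \<zeta>)"
    define b' where "b' = case_nat (c * v) (\<lambda>m. e * b m)"
    have e1: "along a' b' \<tau> 0 = c * (z + \<tau> * v)" "along a' b' \<tau> \<circ> Suc = along a b (\<zeta> + \<tau> * e)" for \<tau>
      by (simp_all add: a'_def b'_def along_def fun_eq_iff algebra_simps)
    have "b' \<circ> Suc = (\<lambda>m. e * b m)" by (simp add: b'_def fun_eq_iff)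
    moreover have "(\<lambda>m. e * b m) \<in> Cn n" using b by (simp add: Cn_def)
    ultimately have b': "b' \<in> Cn (Suc n)" using Cn_Suc_iff[of b' n] by simp
    have dom: "along a' b' \<tau> \<in> chart_domain S p \<alpha>" if "\<tau> \<in> cball 0 1" for \<tau>
      using disc[OF in_disc[OF that]] by (simp add: chart_domain_def e1)
    have a': "a' \<in> chart_domain S p \<alpha>" using dom[of 0] by simp
    have "along a' b' ` cball 0 1 \<subseteq> chart_domain S p \<alpha>" using dom by blast
    from psh_onD(3)[OF weight_psh[OF Sp] a' b' this]
    show "disc_test (\<lambda>\<tau>. weight \<alpha> (c * (z + \<tau> * v)) (p (along a b (\<zeta> + \<tau> * e))))" by (simp only: e1)
  qed
qed

text \<open>The degenerate family over a constant disc in X; it makes the one-variable facts of the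
  locale available on a single fiber.\<close>

lemma rad_family_const:
  assumes x: "x \<in> proj_base A L \<alpha>"
  shows "radial_subharmonic_family (\<lambda>z \<zeta>. rad \<alpha> z x)"
proof -
  obtain S p s where s: "(S, p) \<in> X" "s \<in> S" "x = p s" using mcarrier_chart[OF proj_base_carrier[OF x]] by metis
  have "along s (\<lambda>_. 0) \<zeta> = s" for \<zeta> by (simp add: along_def)
  moreover have "(\<lambda>_. 0) \<in> Cn n" by (simp add: Cn_def)
  ultimately show ?thesis using rad_family[OF s(1), of "\<lambda>_. 0" s \<alpha>] s x by simp
qed

text \<open>On |z| \<le> 1 compactness applies; the rest of the fiber is the corresponding disc in
  the other frame. The continuous g puts the bound in the form of a smooth weight plus a
  constant.\<close>

lemma weight_locally_bounded:
  assumes Sp: "(S, p) \<in> X" and s: "s \<in> S" "p s \<in> proj_base A L \<alpha>"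
    and g: "continuous_on {s\<in>S. p s \<in> proj_base A L \<alpha>} (\<lambda>s. g (p s) :: real)"
  obtains B N where "open N" "s \<in> N"
    "\<And>s' z. s' \<in> N \<Longrightarrow> s' \<in> S \<Longrightarrow> p s' \<in> proj_base A L \<alpha> \<Longrightarrow> cmod z \<le> 1 \<Longrightarrow> weight \<alpha> z (p s') \<le> ereal (g (p s') + B)"
proof -
  define T where "T = {s\<in>S. p s \<in> proj_base A L \<alpha>}"
  define w where "w y = weight \<alpha> (snd y) (p (fst y)) + ereal (- g (p (fst y)))" for y
  have sT: "s \<in> T" using s by (simp add: T_def)
  have c: "continuous_on (T \<times> cball 0 1) (\<lambda>y. (snd y, fst y))" by (intro continuous_intros)
  have i: "(\<lambda>y. (snd y, fst y)) ` (T \<times> cball 0 1) \<subseteq> UNIV \<times> {s\<in>S. p s \<in> proj_base A L \<alpha>}" by (auto simp: T_def)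
  from usc_on_compose[OF weight_usc[OF Sp] c i]
  have "usc_on (T \<times> cball 0 1) (\<lambda>y. weight \<alpha> (snd y) (p (fst y)))" by simp
  then have usc: "usc_on (T \<times> cball 0 1) w"
    unfolding w_def
    by (intro usc_on_add_continuous continuous_on_minus
        continuous_on_compose2[OF g[folded T_def] continuous_on_fst[OF continuous_on_id]]) auto
  have fin: "w (s, z) \<noteq> \<infinity>" for z using weight_not_inf[OF s(2), of z] by (cases "weight \<alpha> z (p s)") (auto simp: w_def)
  have c': "continuous_on (cball 0 1) (\<lambda>z::complex. (s, z))" by (intro continuous_intros)
  have i': "(\<lambda>z. (s, z)) ` cball (0::complex) 1 \<subseteq> T \<times> cball 0 1" using sT by auto
  obtain B where B: "\<And>z. z \<in> cball 0 1 \<Longrightarrow> w (s, z) \<le> ereal B"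
    using usc_on_bounded_above[OF usc_on_compose[OF usc c' i'] compact_cball fin] by metis
  have less: "w (s, z) < ereal (B + 1)" if "z \<in> cball 0 1" for z
    using B[OF that] by (rule order_le_less_trans) simp
  obtain N where N: "open N" "s \<in> N" "\<And>s' z. s' \<in> N \<Longrightarrow> s' \<in> T \<Longrightarrow> z \<in> cball 0 1 \<Longrightarrow> w (s', z) < ereal (B + 1)"
    using usc_on_tube[OF usc compact_cball sT less] by metis
  show ?thesis
  proof (rule that[OF N(1,2)])
    fix s' z assume *: "s' \<in> N" "s' \<in> S" "p s' \<in> proj_base A L \<alpha>" "cmod z \<le> 1"
    then have "w (s', z) < ereal (B + 1)" using N(3)[of s' z] by (simp add: T_def)
    then show "weight \<alpha> z (p s') \<le> ereal (g (p s') + (B + 1))"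
      by (cases "weight \<alpha> z (p s')") (auto simp: w_def)
  qed
qed

text \<open>The discs |z| \<le> 1 and |1 / z| \<le> 1 cover the fiber; on them the weight is
  compared with \<phi>L and \<phi>A. The right-hand side changes with the frames as the weight does,
  so one pair of frames near x settles all pairs, which makes M independent of i and j.\<close>

lemma weight_upper_bound:
  obtains M where "\<And>x i j z. x \<in> triv A i \<Longrightarrow> x \<in> triv L j \<Longrightarrow> z \<noteq> 0 \<Longrightarrow>
    weight (NormL i j) z x \<le> ereal (max (2 * ln (cmod z) + \<phi>A i x) (\<phi>L j x) + M)"
proof -
  define Q where "Q x B \<longleftrightarrow> (\<forall>i j z. x \<in> triv A i \<longrightarrow> x \<in> triv L j \<longrightarrow> z \<noteq> 0 \<longrightarrow>
    weight (NormL i j) z x \<le> ereal (max (2 * ln (cmod z) + \<phi>A i x) (\<phi>L j x) + B))" for x B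
  obtain M where M: "\<And>x. x \<in> mcarrier X \<Longrightarrow> Q x M"
  proof (rule compact_uniform_bound[OF compact, of Q])
    show "Q x B'" if Q: "Q x B" and B: "B \<le> B'" for x B B'
      unfolding Q_def
    proof (intro allI impI)
      fix i j z assume "x \<in> triv A i" "x \<in> triv L j" "z \<noteq> (0::complex)"
      then have "weight (NormL i j) z x \<le> ereal (max (2 * ln (cmod z) + \<phi>A i x) (\<phi>L j x) + B)" using Q unfolding Q_def by blast
      also have "\<dots> \<le> ereal (max (2 * ln (cmod z) + \<phi>A i x) (\<phi>L j x) + B')" using B by simp
      finally show "weight (NormL i j) z x \<le> \<dots>" .
    qed
    fix x assume x: "x \<in> mcarrier X"
    obtain S p s where s: "(S, p) \<in> X" "s \<in> S" "x = p s" using mcarrier_chart[OF x] by metis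
    obtain i j where ij: "x \<in> triv A i" "x \<in> triv L j" using index_exists[OF x] by metis
    have cA: "continuous_on {s\<in>S. p s \<in> proj_base A L (NormA i j)} (\<lambda>s. \<phi>A i (p s))"
      by (rule continuous_on_subset[OF smooth_metric_continuous[OF \<phi>A s(1), of i]]) auto
    have cL: "continuous_on {s\<in>S. p s \<in> proj_base A L (NormL i j)} (\<lambda>s. \<phi>L j (p s))"
      by (rule continuous_on_subset[OF smooth_metric_continuous[OF \<phi>L s(1), of j]]) auto
    have sb: "p s \<in> proj_base A L (NormA i j)" "p s \<in> proj_base A L (NormL i j)" using ij s(3) by auto
    obtain B1 N1 where N1: "open N1" "s \<in> N1"
      "\<And>s' z. s' \<in> N1 \<Longrightarrow> s' \<in> S \<Longrightarrow> p s' \<in> proj_base A L (NormA i j) \<Longrightarrow> cmod z \<le> 1 \<Longrightarrow> weight (NormA i j) z (p s') \<le> ereal (\<phi>A i (p s') + B1)"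
      using weight_locally_bounded[OF s(1,2) sb(1) cA] by metis
    obtain B2 N2 where N2: "open N2" "s \<in> N2"
      "\<And>s' z. s' \<in> N2 \<Longrightarrow> s' \<in> S \<Longrightarrow> p s' \<in> proj_base A L (NormL i j) \<Longrightarrow> cmod z \<le> 1 \<Longrightarrow> weight (NormL i j) z (p s') \<le> ereal (\<phi>L j (p s') + B2)"
      using weight_locally_bounded[OF s(1,2) sb(2) cL] by metis
    define T where "T = {s\<in>S. p s \<in> pair_triv (i, j)} \<inter> (N1 \<inter> N2)"
    define B where "B = max B1 B2"
    have "openin (top_of_set S) T"
      unfolding T_def by (intro openin_Int_open chart_preimage_open[OF s(1)] open_V open_Int N1(1) N2(1))
    then have "openin (mtop X) (p ` T)" by (rule chart_image_open[OF manifold s(1)])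
    moreover have "x \<in> p ` T" using s ij N1(2) N2(2) by (auto simp: T_def pair_triv_def)
    moreover have "Q y B" if "y \<in> p ` T" for y
      unfolding Q_def
    proof (intro allI impI)
      fix i' j' and z :: complex assume ij': "y \<in> triv A i'" "y \<in> triv L j'" and z: "z \<noteq> 0"
      obtain s' where s': "s' \<in> T" "y = p s'" using \<open>y \<in> p ` T\<close> by blast
      have y: "y \<in> triv A i" "y \<in> triv L j" using s' by (auto simp: T_def pair_triv_def)
      have core: "weight (NormL i j) w y \<le> ereal (max (2 * ln (cmod w) + \<phi>A i y) (\<phi>L j y) + B)" if w: "w \<noteq> 0" for w
      proof (cases "cmod w \<le> 1")
        case True
        then have "weight (NormL i j) w y \<le> ereal (\<phi>L j y + B2)"
          using N2(3)[of s' w] s' y by (auto simp: T_def)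
        also have "\<dots> \<le> ereal (max (2 * ln (cmod w) + \<phi>A i y) (\<phi>L j y) + B)" by (auto simp: B_def)
        finally show ?thesis .
      next
        case False
        have "1 < cmod w" using False by simp
        then have "cmod (1 / w) \<le> 1" using w by (simp add: norm_divide divide_le_eq_1)
        then have "weight (NormA i j) (1 / w) y \<le> ereal (\<phi>A i y + B1)"
          using N1(3)[of s' "1 / w"] s' y by (auto simp: T_def)
        then have "weight (NormA i j) (1 / w) y + ereal (- 2 * ln (cmod (1 / w))) \<le> ereal (2 * ln (cmod w) + \<phi>A i y + B1)"
          using w by (cases "weight (NormA i j) (1 / w) y") (auto simp: norm_divide ln_div)
        then have "weight (NormL i j) w y \<le> ereal (2 * ln (cmod w) + \<phi>A i y + B1)"
          using weight_change_NormA[OF y, of "1 / w"] w by simp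
        also have "\<dots> \<le> ereal (max (2 * ln (cmod w) + \<phi>A i y) (\<phi>L j y) + B)" by (auto simp: B_def)
        finally show ?thesis .
      qed
      define gA where "gA = transition A i' i y"
      define gL where "gL = transition L j' j y"
      have g: "gA \<noteq> 0" "gL \<noteq> 0"
        using line_bundleD(4)[OF A ij'(1) y(1)] line_bundleD(4)[OF L ij'(2) y(2)] by (auto simp: gA_def gL_def)
      \<comment> \<open>The fiber coordinate of the same point in the frames i and j, where the
        bound is already known.\<close>
      define w where "w = z * (gA / gL)"
      have w: "w \<noteq> 0" "w * (gL / gA) = z" using z g by (auto simp: w_def)
      have lnw: "ln (cmod w) = ln (cmod z) + ln (cmod gA) - ln (cmod gL)"
        unfolding w_def using z g by (simp add: norm_mult norm_divide ln_mult ln_div)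
      have "weight (NormL i' j') z y = weight (NormL i j) w y + ereal (2 * ln (cmod gL))"
        using weight_change_NormL[OF ij' y, of w] w(2) by (simp add: gA_def gL_def)
      also have "\<dots> \<le> ereal (max (2 * ln (cmod w) + \<phi>A i y) (\<phi>L j y) + B) + ereal (2 * ln (cmod gL))"
        by (rule add_right_mono[OF core[OF w(1)]])
      also have "\<dots> = ereal (max (2 * ln (cmod z) + \<phi>A i' y) (\<phi>L j' y) + B)"
        using metric_change(1)[OF ij'(1) y(1)] metric_change(2)[OF ij'(2) y(2)]
        by (simp add: lnw gA_def[symmetric] gL_def[symmetric] max_def)
      finally show "weight (NormL i' j') z y \<le> ereal (max (2 * ln (cmod z) + \<phi>A i' y) (\<phi>L j' y) + B)" .
    qed
    ultimately show "\<exists>W B. openin (mtop X) W \<and> x \<in> W \<and> (\<forall>y\<in>W. Q y B)" by blast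
  qed blast
  show ?thesis
  proof (rule that)
    fix x i j and z :: complex assume x: "x \<in> triv A i" "x \<in> triv L j" "z \<noteq> 0"
    have "Q x M" using line_bundleD(2)[OF A] x(1) by (intro M) blast
    then show "weight (NormL i j) z x \<le> ereal (max (2 * ln (cmod z) + \<phi>A i x) (\<phi>L j x) + M)"
      using x unfolding Q_def by blast
  qed
qed

section \<open>The Legendre transform in the fiber direction\<close>

definition legendre :: "real \<Rightarrow> 'i \<times> 'j \<Rightarrow> 'x \<Rightarrow> ereal" where
  "legendre t k x = (INF s. rad (NormL (fst k) (snd k)) (of_real (exp s)) x - ereal (2 * t * s))"

text \<open>Changing frames multiplies the fiber coordinate by gL / gA, which shifts s by d, and
  adds 2 * ln |gL|. Together this is the change of a weight of the t-th power of A times the (1 -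
  t)-th power of L. Exchanging the frames gives the reverse inequality.\<close>

lemma legendre_change_le:
  assumes x: "x \<in> pair_triv k" "x \<in> pair_triv k'"
  shows "legendre t k x \<le> legendre t k' x + ereal (pair_weight t k x - pair_weight t k' x)"
proof -
  obtain i j i' j' where k: "k = (i, j)" "k' = (i', j')" by (cases k; cases k')
  have ij: "x \<in> triv A i" "x \<in> triv L j" "x \<in> triv A i'" "x \<in> triv L j'" using x by (auto simp: k pair_triv_def)
  define gA where "gA = transition A i i' x"
  define gL where "gL = transition L j j' x"
  have g: "gA \<noteq> 0" "gL \<noteq> 0"
    using line_bundleD(4)[OF A ij(1,3)] line_bundleD(4)[OF L ij(2,4)] by (auto simp: gA_def gL_def)
  define d where "d = ln (cmod gL) - ln (cmod gA)"
  have pw: "pair_weight t k x - pair_weight t k' x = 2 * ln (cmod gL) - 2 * t * d"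
    using metric_change(1)[OF ij(1,3)] metric_change(2)[OF ij(2,4)]
    by (simp add: k pair_weight_def gA_def[symmetric] gL_def[symmetric] d_def algebra_simps)
  have rad: "rad (NormL i j) (of_real (exp (s + d))) x \<le> rad (NormL i' j') (of_real (exp s)) x + ereal (2 * ln (cmod gL))" for s
  proof -
    have cm: "cmod (of_real (exp s) * (gL / gA)) = exp (s + d)"
      using g by (simp add: norm_mult norm_divide d_def exp_add exp_diff)
    have "rad (NormL i j) (of_real (exp s) * (gL / gA)) x \<le> rad (NormL i' j') (of_real (exp s)) x + ereal (2 * ln (cmod gL))"
      unfolding rad_def[of "NormL i j"]
    proof (rule SUP_least)
      fix c :: complex assume c: "c \<in> sphere 0 1"
      have "weight (NormL i j) (c * (of_real (exp s) * (gL / gA))) x = weight (NormL i' j') (c * of_real (exp s)) x + ereal (2 * ln (cmod gL))"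
        using weight_change_NormL[OF ij, of "c * of_real (exp s)"] by (simp only: gA_def[symmetric] gL_def[symmetric] mult.assoc)
      also have "\<dots> \<le> rad (NormL i' j') (of_real (exp s)) x + ereal (2 * ln (cmod gL))"
        unfolding rad_def by (intro add_right_mono SUP_upper c)
      finally show "weight (NormL i j) (c * (of_real (exp s) * (gL / gA))) x \<le> \<dots>" .
    qed
    then show ?thesis using rad_cmod[OF cm] by simp
  qed
  have "legendre t k x + ereal (- (2 * ln (cmod gL) - 2 * t * d)) \<le> legendre t k' x"
    unfolding legendre_def[of t k']
  proof (rule INF_greatest)
    fix s
    have "legendre t k x \<le> rad (NormL i j) (of_real (exp (s + d))) x - ereal (2 * t * (s + d))"
      unfolding legendre_def k by (rule INF_lower2[OF UNIV_I[of "s + d"]]) simp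
    also have "\<dots> \<le> rad (NormL i' j') (of_real (exp s)) x + ereal (2 * ln (cmod gL)) - ereal (2 * t * (s + d))"
      by (intro ereal_minus_mono rad) simp
    finally show "legendre t k x + ereal (- (2 * ln (cmod gL) - 2 * t * d))
        \<le> rad (NormL (fst k') (snd k')) (of_real (exp s)) x - ereal (2 * t * s)"
      by (cases "rad (NormL i' j') (of_real (exp s)) x"; cases "legendre t k x") (auto simp: k algebra_simps)
  qed
  then show ?thesis unfolding pw by (cases "legendre t k x"; cases "legendre t k' x") auto
qed

lemma legendre_change:
  assumes x: "x \<in> pair_triv k" "x \<in> pair_triv k'"
  shows "legendre t k x = legendre t k' x + ereal (pair_weight t k x - pair_weight t k' x)"
  using legendre_change_le[OF x, of t] legendre_change_le[OF x(2,1), of t]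
  by (cases "legendre t k x"; cases "legendre t k' x") auto

lemma legendre_le:
  assumes M: "\<And>x i j z. x \<in> triv A i \<Longrightarrow> x \<in> triv L j \<Longrightarrow> z \<noteq> 0 \<Longrightarrow>
      weight (NormL i j) z x \<le> ereal (max (2 * ln (cmod z) + \<phi>A i x) (\<phi>L j x) + M)"
    and x: "x \<in> triv A i" "x \<in> triv L j"
  shows "rad (NormL i j) (of_real (exp s)) x \<le> ereal (max (2 * s + \<phi>A i x) (\<phi>L j x) + M)"
    and "legendre t (i, j) x \<le> ereal (pair_weight t (i, j) x + M)"
proof -
  show rad: "rad (NormL i j) (of_real (exp s)) x \<le> ereal (max (2 * s + \<phi>A i x) (\<phi>L j x) + M)" for s
    unfolding rad_def
  proof (rule SUP_least)
    fix c :: complex assume "c \<in> sphere 0 1"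
    then have "cmod (c * of_real (exp s)) = exp s" "c * of_real (exp s) \<noteq> 0" by (auto simp: norm_mult)
    then show "weight (NormL i j) (c * of_real (exp s)) x \<le> ereal (max (2 * s + \<phi>A i x) (\<phi>L j x) + M)"
      using M[OF x, of "c * of_real (exp s)"] by simp
  qed
  \<comment> \<open>Balances the two entries of the maximum: 2 * s + \<phi>A = \<phi>L. Subtracting
    2 * t * s leaves t * \<phi>A + (1 - t) * \<phi>L, so the excess M does not depend on t.\<close>
  define s where "s = (\<phi>L j x - \<phi>A i x) / 2"
  have "legendre t (i, j) x \<le> rad (NormL i j) (of_real (exp s)) x - ereal (2 * t * s)"
    unfolding legendre_def by (rule INF_lower2[OF UNIV_I[of s]]) simp
  also have "\<dots> \<le> ereal (max (2 * s + \<phi>A i x) (\<phi>L j x) + M) - ereal (2 * t * s)"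
    by (intro ereal_minus_mono rad) simp
  also have "\<dots> = ereal (pair_weight t (i, j) x + M)"
  proof -
    have s: "2 * s + \<phi>A i x = \<phi>L j x" by (simp add: s_def field_simps)
    then have "2 * t * s = t * (\<phi>L j x - \<phi>A i x)" by (simp add: s_def)
    then show ?thesis unfolding s by (simp add: pair_weight_def algebra_simps)
  qed
  finally show "legendre t (i, j) x \<le> ereal (pair_weight t (i, j) x + M)" .
qed

lemma legendre_psh:
  assumes Sp: "(S, p) \<in> X" and fin: "\<And>x. x \<in> pair_triv k \<Longrightarrow> legendre t k x \<noteq> \<infinity>"
  shows "psh_on n {s\<in>S. p s \<in> pair_triv k} (\<lambda>s. legendre t k (p s))"
proof (rule psh_onI)
  define \<alpha> where "\<alpha> = NormL (fst k) (snd k)"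
  have base: "proj_base A L \<alpha> = pair_triv k" by (cases k) (simp add: pair_triv_def \<alpha>_def)
  let ?T = "{s\<in>S. p s \<in> pair_triv k}"
  show "legendre t k (p s) \<noteq> \<infinity>" if "s \<in> ?T" for s using fin that by blast
  show "usc_on ?T (\<lambda>s. legendre t k (p s))"
    unfolding legendre_def \<alpha>_def[symmetric]
  proof (rule usc_on_INF)
    fix r :: real
    have c: "continuous_on ?T (\<lambda>s. (complex_of_real (exp r), s))" by (intro continuous_intros)
    have i: "(\<lambda>s. (complex_of_real (exp r), s)) ` ?T \<subseteq> UNIV \<times> {s\<in>S. p s \<in> proj_base A L \<alpha>}" by (auto simp: base)
    have "usc_on ?T (\<lambda>s. rad \<alpha> (of_real (exp r)) (p s) + ereal (- (2 * t * r)))"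
      using usc_on_compose[OF rad_usc[OF Sp] c i] by (intro usc_on_add_continuous continuous_on_const) simp
    then show "usc_on ?T (\<lambda>s. rad \<alpha> (of_real (exp r)) (p s) - ereal (2 * t * r))"
      by (simp add: minus_ereal_def)
  qed
  fix a b assume ab: "a \<in> ?T" "b \<in> Cn n" "along a b ` cball 0 1 \<subseteq> ?T"
  have "along a b \<zeta> \<in> {s\<in>S. p s \<in> proj_base A L \<alpha>}" if "\<zeta> \<in> cball 0 1" for \<zeta>
    using ab(3) that unfolding base by blast
  from radial_subharmonic_family.minimum_principle[OF rad_family[OF Sp ab(2) this], of "2 * t"]
  show "disc_test (\<lambda>\<zeta>. legendre t k (p (along a b \<zeta>)))"
    unfolding legendre_def \<alpha>_def .
qed

text \<open>Subtracting the smooth weight and M from the Legendre transform leaves a function on X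
  that is independent of frames, at most 0, and psh once the weight is added back: a competitor in
  the envelope.\<close>

lemma legendre_le_envelope:
  assumes M: "\<And>x i j z. x \<in> triv A i \<Longrightarrow> x \<in> triv L j \<Longrightarrow> z \<noteq> 0 \<Longrightarrow>
      weight (NormL i j) z x \<le> ereal (max (2 * ln (cmod z) + \<phi>A i x) (\<phi>L j x) + M)"
    and t: "t \<in> {0..1}" and x: "x \<in> pair_triv k"
  shows "legendre t k x \<le> envelope t x + ereal (pair_weight t k x) + ereal M"
proof -
  define \<psi> where "\<psi> x = (let k = SOME k. x \<in> pair_triv k in legendre t k x + ereal (- pair_weight t k x - M))" for x
  have \<psi>: "\<psi> x = legendre t k x + ereal (- pair_weight t k x - M)" if x: "x \<in> pair_triv k" for x k
  proof -
    define k' where "k' = (SOME k. x \<in> pair_triv k)"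
    have k': "x \<in> pair_triv k'" unfolding k'_def by (rule someI[of _ k]) (rule x)
    show ?thesis
      using legendre_change[OF x k', of t] by (cases "legendre t k' x") (auto simp: \<psi>_def k'_def[symmetric])
  qed
  have le: "legendre t k x \<le> ereal (pair_weight t k x + M)" if "x \<in> pair_triv k" for x k
    using legendre_le(2)[OF M, of x "fst k" "snd k" t] that by (cases k) (auto simp: pair_triv_def)
  have ex: "\<exists>k. x \<in> pair_triv k" if x: "x \<in> mcarrier X" for x
  proof -
    obtain i j where "x \<in> triv A i" "x \<in> triv L j" using index_exists[OF x] by metis
    then show ?thesis by (intro exI[of _ "(i, j)"]) (simp add: pair_triv_def)
  qed
  have le0: "\<psi> x \<le> 0" if "x \<in> mcarrier X" for x
  proof -
    obtain k where k: "x \<in> pair_triv k" using ex[OF \<open>x \<in> mcarrier X\<close>] by blast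
    show ?thesis using le[OF k] unfolding \<psi>[OF k] by (cases "legendre t k x") auto
  qed
  have "\<psi> \<in> cand t"
    unfolding cand_def equilibrium_candidates_def
  proof (intro CollectI conjI ballI allI)
    show "\<psi> x \<noteq> \<infinity>" "\<psi> x \<le> 0" if "x \<in> mcarrier X" for x using le0[OF that] by auto
    fix k :: "'i \<times> 'j"
    show "mpsh_on n X (pair_triv k) (\<lambda>x. ereal (pair_weight t k x) + \<psi> x)"
      unfolding mpsh_on_def o_def
    proof clarify
      fix S p assume Sp: "(S, p) \<in> X"
      have "legendre t k x \<noteq> \<infinity>" if "x \<in> pair_triv k" for x using le[OF that] by auto
      then have "psh_on n {s\<in>S. p s \<in> pair_triv k} (\<lambda>s. legendre t k (p s) + ereal (- M))"
        by (intro psh_on_add_const legendre_psh[OF Sp])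
      then show "psh_on n {s\<in>S. p s \<in> pair_triv k} (\<lambda>s. ereal (pair_weight t k (p s)) + \<psi> (p s))"
      proof (rule psh_on_cong[THEN iffD1, rotated])
        fix s assume "s \<in> {s\<in>S. p s \<in> pair_triv k}"
        then have "p s \<in> pair_triv k" by simp
        then show "legendre t k (p s) + ereal (- M) = ereal (pair_weight t k (p s)) + \<psi> (p s)"
          by (cases "legendre t k (p s)") (simp_all add: \<psi>)
      qed
    qed
  qed
  then have "\<psi> x \<le> envelope t x" by (rule cand_le_envelope[OF _ t])
  then show ?thesis
    unfolding \<psi>[OF x] by (cases "legendre t k x"; cases "envelope t x") auto
qed

lemma metric_le_tilde:
  "\<exists>C::real. \<forall>\<alpha>. \<forall>P\<in>triv (hyperplane_bundle X A L) \<alpha>. \<phi> \<alpha> P \<le> tilde_metric n X A L \<phi>A \<phi>L \<alpha> P + ereal C"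
proof -
  obtain M where M: "\<And>x i j z. x \<in> triv A i \<Longrightarrow> x \<in> triv L j \<Longrightarrow> z \<noteq> 0 \<Longrightarrow>
      weight (NormL i j) z x \<le> ereal (max (2 * ln (cmod z) + \<phi>A i x) (\<phi>L j x) + M)"
    using weight_upper_bound by metis
  have env: "legendre t (i, j) x \<le> envelope t x + ereal (pair_weight t (i, j) x) + ereal M"
    if "t \<in> {0..1}" "x \<in> triv A i" "x \<in> triv L j" for t i j x
    using legendre_le_envelope[OF M that(1), of x "(i, j)"] that(2,3) by (simp add: pair_triv_def)
  have term_le: "term_weight \<alpha> t z x \<le> max_weight \<alpha> z x" if "t \<in> {0..1}" for \<alpha> t z x
    unfolding max_weight_def using that by (rule SUP_upper)
  have main: "weight (NormL i j) z x \<le> max_weight (NormL i j) z x + ereal M"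
    if x: "x \<in> triv A i" "x \<in> triv L j" for i j z x
  proof -
    have base: "x \<in> proj_base A L (NormL i j)" using x by simp
    interpret radial_subharmonic_family "\<lambda>z \<zeta>. rad (NormL i j) z x" by (rule rad_family_const[OF base])
    \<comment> \<open>Biconjugation: a supporting line at s0 = ln |z| recovers the radial function
      from its Legendre transform. At z = 0 the parameter t = 0 serves, because the radial function
      is smallest there.\<close>
    have "\<exists>t\<in>{0..1}. weight (NormL i j) z x \<le> log_weight t z + legendre t (i, j) x"
    proof (cases "z = 0")
      case True
      have "rad (NormL i j) 0 x \<le> legendre 0 (i, j) x"
        unfolding legendre_def using at_zero_le[of 0] by (intro INF_greatest) simp
      then have "weight (NormL i j) 0 x \<le> legendre 0 (i, j) x" using weight_le_rad order_trans by blast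
      then show ?thesis using True by (intro bexI[of _ 0]) (auto simp: log_weight_def)
    next
      case False
      define s0 where "s0 = ln (cmod z)"
      have cm: "cmod z = exp s0" using False by (simp add: s0_def)
      have growth: "rad (NormL i j) (of_real (exp s)) x \<le> ereal (max (2 * s) 0 + (max (\<phi>A i x) (\<phi>L j x) + M))" for s
      proof -
        have "rad (NormL i j) (of_real (exp s)) x \<le> ereal (max (2 * s + \<phi>A i x) (\<phi>L j x) + M)"
          by (rule legendre_le(1)[OF M x])
        also have "\<dots> \<le> ereal (max (2 * s) 0 + (max (\<phi>A i x) (\<phi>L j x) + M))"
          by (simp add: max_def)
        finally show ?thesis .
      qed
      have "0 \<in> cball (0::complex) 1" by simp
      from supporting_line[OF this growth, of s0]
      obtain t where t: "t \<in> {0..1}"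
        "rad (NormL i j) (of_real (exp s0)) x - ereal (2 * t * s0) \<le> legendre t (i, j) x"
        unfolding legendre_def fst_conv snd_conv by blast
      have "weight (NormL i j) z x \<le> rad (NormL i j) (of_real (exp s0)) x"
        using weight_le_rad[of "NormL i j" z x] rad_cmod[OF cm] by simp
      also have "\<dots> \<le> ereal (2 * t * s0) + legendre t (i, j) x"
        using t(2) by (cases "rad (NormL i j) (of_real (exp s0)) x"; cases "legendre t (i, j) x") auto
      also have "ereal (2 * t * s0) = log_weight t z" using False by (simp add: log_weight_nonzero s0_def)
      finally show ?thesis using t(1) by blast
    qed
    then obtain t where t: "t \<in> {0..1}" "weight (NormL i j) z x \<le> log_weight t z + legendre t (i, j) x" by blast
    note t(2)
    also have "log_weight t z + legendre t (i, j) x \<le> log_weight t z + (envelope t x + ereal (pair_weight t (i, j) x) + ereal M)"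
      by (intro add_left_mono env t(1) x)
    also have "\<dots> = term_weight (NormL i j) t z x + ereal M" by (simp add: term_weight_def add.assoc)
    also have "\<dots> \<le> max_weight (NormL i j) z x + ereal M" by (intro add_right_mono term_le t(1))
    finally show ?thesis .
  qed
  have mainA: "weight (NormA i j) w x \<le> max_weight (NormA i j) w x + ereal M"
    if x: "x \<in> triv A i" "x \<in> triv L j" for i j w x
  proof (cases "w = 0")
    case False
    have base: "x \<in> proj_base A L (NormL i j)" "x \<in> proj_base A L (NormA i j)" using x by auto
    have e: "taut_coord (NormL i j) (frame_vector A L (NormA i j) w x) = w"
      "fiber_coord (NormL i j) (frame_vector A L (NormA i j) w x) = 1"
      using frame_at[OF x(1,1)] frame_at[OF x(2,2)] line_bundleD(5)[OF A x(1)] line_bundleD(5)[OF L x(2)] by simp_all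
    have "max_weight (NormL i j) (1 / w) x = max_weight (NormA i j) w x + ereal (- 2 * ln (cmod w))"
      using max_weight_change[OF base, of w, unfolded e] False by simp
    then show ?thesis
      using main[OF x, of "1 / w"] weight_change_NormA[OF x False]
      by (cases "weight (NormA i j) w x"; cases "max_weight (NormA i j) w x") auto
  next
    case True
    have base: "x \<in> proj_base A L (NormA i j)" using x by simp
    interpret radial_subharmonic_family "\<lambda>z \<zeta>. rad (NormA i j) z x" by (rule rad_family_const[OF base])
    \<comment> \<open>The other frame misses the point w = 0. Here t = 1 serves, whose power of |w|
      is the zeroth; on |w| = exp (- s) the change of frame with z = 1 / w supplies the linear term
      2 * s.\<close>
    have "weight (NormA i j) 0 x \<le> legendre 1 (i, j) x"
      unfolding legendre_def fst_conv snd_conv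
    proof (rule INF_greatest)
      fix s
      have "weight (NormA i j) 0 x \<le> rad (NormA i j) (of_real (exp (- s))) x"
        using weight_le_rad[of "NormA i j" 0 x] at_zero_le[of 0 "of_real (exp (- s))"] by auto
      also have "\<dots> \<le> rad (NormL i j) (of_real (exp s)) x - ereal (2 * 1 * s)"
        unfolding rad_def[of "NormA i j"]
      proof (rule SUP_least)
        fix c :: complex assume c: "c \<in> sphere 0 1"
        define w where "w = c * of_real (exp (- s))"
        have w: "w \<noteq> 0" "cmod w = exp (- s)" using c by (auto simp: w_def norm_mult)
        have "1 / w = inverse c * of_real (exp s)"
          using c by (auto simp: w_def exp_minus field_simps)
        then have "weight (NormL i j) (1 / w) x \<le> rad (NormL i j) (of_real (exp s)) x"
          unfolding rad_def using c by (intro SUP_upper2[of "inverse c"]) (auto simp: norm_inverse)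
        then have "weight (NormA i j) w x + ereal (2 * s) \<le> rad (NormL i j) (of_real (exp s)) x"
          using weight_change_NormA[OF x w(1)] w(2) by simp
        then show "weight (NormA i j) (c * of_real (exp (- s))) x \<le> rad (NormL i j) (of_real (exp s)) x - ereal (2 * 1 * s)"
          unfolding w_def by (simp add: ereal_le_minus)
      qed
      finally show "weight (NormA i j) 0 x \<le> rad (NormL i j) (of_real (exp s)) x - ereal (2 * 1 * s)" .
    qed
    also have "\<dots> \<le> envelope 1 x + ereal (pair_weight 1 (i, j) x) + ereal M" by (intro env x) simp
    also have "\<dots> = term_weight (NormA i j) 1 0 x + ereal M" by (simp add: term_weight_def log_weight_def)
    also have "\<dots> \<le> max_weight (NormA i j) 0 x + ereal M" by (intro add_right_mono term_le) simp
    finally show ?thesis using True by simp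
  qed
  have "\<phi> \<alpha> P \<le> tilde_metric n X A L \<phi>A \<phi>L \<alpha> P + ereal M" if P: "P \<in> triv (hyperplane_bundle X A L) \<alpha>" for \<alpha> P
  proof -
    obtain x z where x: "x \<in> proj_base A L \<alpha>" and Px: "P = proj_point A L \<alpha> z x" using P hyperplane_triv_iff by blast
    have "weight \<alpha> z x \<le> max_weight \<alpha> z x + ereal M" using x main mainA by (cases \<alpha>) auto
    then show ?thesis unfolding Px tilde_metric_eq[OF x] weight_def .
  qed
  then show ?thesis by blast
qed

end

theorem theorem2p2:
  fixes n :: nat
    and X :: "'x atlas"
    and A :: "('x, 'i) line_bundle"
    and L :: "('x, 'j) line_bundle"
    and \<phi>A :: "'i \<Rightarrow> 'x \<Rightarrow> real"
    and \<phi>L :: "'j \<Rightarrow> 'x \<Rightarrow> real"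
  assumes "smooth_projective_variety n X"
    and "is_line_bundle n X A" and "ample n X A"
    and "is_line_bundle n X L" and "pseudo_effective n X L"
    and "smooth_metric n X L \<phi>L"
    and "smooth_metric n X A \<phi>A" and "positive_curvature n X A \<phi>A"
  shows "minimal_singular_metric (Suc n) (proj_atlas X A L) (hyperplane_bundle X A L)
           (tilde_metric n X A L \<phi>A \<phi>L)"
proof -
  have X: "complex_manifold n X" "compact_space (mtop X)"
    using assms(1) by (simp_all add: smooth_projective_variety_def)
  interpret sum_bundle n X A L \<phi>A \<phi>L
    using X(1) assms by unfold_locales
  have "\<exists>C::real. \<forall>\<alpha>. \<forall>P\<in>triv (hyperplane_bundle X A L) \<alpha>. \<phi> \<alpha> P \<le> tilde_metric n X A L \<phi>A \<phi>L \<alpha> P + ereal C"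
    if "psh_metric (Suc n) (proj_atlas X A L) (hyperplane_bundle X A L) \<phi>" for \<phi>
  proof -
    interpret hyperplane_metric n X A L \<phi>A \<phi>L \<phi>
      using X(2) that by unfold_locales
    show ?thesis by (rule metric_le_tilde)
  qed
  then show ?thesis
    unfolding minimal_singular_metric_def using tilde_metric_psh_metric[OF X(2) assms(5)] by blast
qed

end
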